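(* Let $R$ be a finite unital associative ring (not necessarily commutative), let $R^{\mathrm{ss}} = R/\mathrm{Rad}(R)$ be its semisimplification, and suppose that $$R^{\mathrm{ss}} \cong \prod_{i=1}^{s} R_i \times \prod_{i=1}^{r} M_{d_i}(F_i),$$ where $s, r \ge 0$, each $R_i$ is a finite field with $2 \le |R_1| \le |R_2| \le \cdots \le |R_s|$, each $d_i \ge 2$ is an integer, and each $F_i$ is a finite field. Then the unitary Cayley graph $G_R$ is a perfect graph if and only if one of the following conditions is satisfied: (1) $s \ge 1$ and $|R_1| = 2$ (in this case $G_R$ is a bipartite graph, and hence perfect); (2) $s \le 2$ and $r = 0$ (in other words, $R^{\mathrm{ss}}$ is $R_1$ or $R_1 \times R_2$); (3) $R^{\mathrm{ss}} \cong M_2(\mathbb{F}_2)$.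
   Context: For a finite unital associative ring $R$ with group of invertible elements $R^{\times}$, the unitary Cayley graph $G_R = \mathrm{Cay}(R, R^{\times})$ is the simple undirected graph with vertex set $R$ in which two distinct vertices $a, b$ are adjacent if and only if $a - b \in R^{\times}$. $\mathrm{Rad}(R)$ denotes the Jacobson radical of $R$ (the intersection of all maximal left ideals, which is a two-sided ideal). $M_d(F)$ denotes the ring of $d \times d$ matrices over $F$, and $\mathbb{F}_2$ is the field with two elements. A decomposition of $R^{\mathrm{ss}} = R/\mathrm{Rad}(R)$ of the form $R^{\mathrm{ss}} \cong \prod_{i=1}^{s} R_i \times \prod_{i=1}^{r} M_{d_i}(F_i)$, with $s, r \ge 0$, each $R_i$ a finite field, $2 \le |R_1| \le |R_2| \le \cdots \le |R_s|$, each $d_i \ge 2$ an integer, and each $F_i$ a finite field, always exists by the Artin–Wedderburn theorem (and since finite division rings are fields). A graph $G$ is perfect if for every induced subgraph $H$ of $G$ the chromatic number of $H$ equals the size of a maximum clique of $H$. *)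

theory Defs
  imports
    "HOL-Algebra.Algebra"
    "HOL-Number_Theory.Residues"
    "Graph_Theory.Graph_Theory"
    "Jordan_Normal_Form.Matrix"
begin

section \<open>The Jacobson radical\<close>

definition left_ideal :: "'a set \<Rightarrow> ('a, 'm) ring_scheme \<Rightarrow> bool" where
  "left_ideal I R \<longleftrightarrow>
     additive_subgroup I R \<and> (\<forall>x \<in> carrier R. \<forall>a \<in> I. x \<otimes>\<^bsub>R\<^esub> a \<in> I)"

definition maximal_left_ideal :: "'a set \<Rightarrow> ('a, 'm) ring_scheme \<Rightarrow> bool" where
  "maximal_left_ideal I R \<longleftrightarrow>
     left_ideal I R \<and> I \<noteq> carrier R \<and>
     (\<forall>J. left_ideal J R \<longrightarrow> I \<subseteq> J \<longrightarrow> J = I \<or> J = carrier R)"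

text \<open>The intersection with the carrier only matters for the zero ring, which has no
  maximal left ideals and is its own radical.\<close>

definition jacobson_radical :: "('a, 'm) ring_scheme \<Rightarrow> 'a set" where
  "jacobson_radical R = carrier R \<inter> \<Inter> {I. maximal_left_ideal I R}"

definition semisimplification :: "('a, 'm) ring_scheme \<Rightarrow> 'a set ring" where
  "semisimplification R = R Quot (jacobson_radical R)"


section \<open>Matrices over a ring given by a carrier\<close>

text \<open>The matrix ring of \<^theory>\<open>Jordan_Normal_Form.Matrix\<close> takes its entries in a type class.
  Here the entries come from an arbitrary ring record, so that the coefficient ring may vary
  with an index.\<close>

definition matrix_ring :: "nat \<Rightarrow> ('a, 'm) ring_scheme \<Rightarrow> 'a mat ring" where
  "matrix_ring n F =
     \<lparr> carrier = {A \<in> carrier_mat n n. elements_mat A \<subseteq> carrier F},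
       monoid.mult = (\<lambda>A B. mat n n (\<lambda>(i, j). \<Oplus>\<^bsub>F\<^esub>k \<in> {..<n}. A $$ (i, k) \<otimes>\<^bsub>F\<^esub> B $$ (k, j))),
       monoid.one = mat n n (\<lambda>(i, j). if i = j then \<one>\<^bsub>F\<^esub> else \<zero>\<^bsub>F\<^esub>),
       ring.zero = mat n n (\<lambda>(i, j). \<zero>\<^bsub>F\<^esub>),
       ring.add = (\<lambda>A B. mat n n (\<lambda>(i, j). A $$ (i, j) \<oplus>\<^bsub>F\<^esub> B $$ (i, j))) \<rparr>"


section \<open>Perfect and bipartite graphs\<close>

text \<open>An undirected graph is a symmetric loop-free digraph, as in the locale \<^locale>\<open>graph\<close>.\<close>

definition proper_colouring :: "('a, 'b) pre_digraph \<Rightarrow> nat \<Rightarrow> ('a \<Rightarrow> nat) \<Rightarrow> bool" where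
  "proper_colouring G k c \<longleftrightarrow>
     c ` verts G \<subseteq> {..<k} \<and> (\<forall>u v. u \<rightarrow>\<^bsub>G\<^esub> v \<longrightarrow> c u \<noteq> c v)"

definition chromatic_number :: "('a, 'b) pre_digraph \<Rightarrow> nat" where
  "chromatic_number G = (LEAST k. \<exists>c. proper_colouring G k c)"

definition clique :: "('a, 'b) pre_digraph \<Rightarrow> 'a set \<Rightarrow> bool" where
  "clique G K \<longleftrightarrow> K \<subseteq> verts G \<and> (\<forall>u \<in> K. \<forall>v \<in> K. u \<noteq> v \<longrightarrow> u \<rightarrow>\<^bsub>G\<^esub> v)"

definition clique_number :: "('a, 'b) pre_digraph \<Rightarrow> nat" where
  "clique_number G = Max (card ` {K. clique G K})"

definition perfect_graph :: "('a, 'b) pre_digraph \<Rightarrow> bool" where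
  "perfect_graph G \<longleftrightarrow>
     (\<forall>H. induced_subgraph H G \<longrightarrow> chromatic_number H = clique_number H)"

definition bipartite_graph :: "('a, 'b) pre_digraph \<Rightarrow> bool" where
  "bipartite_graph G \<longleftrightarrow>
     (\<exists>U V. U \<union> V = verts G \<and> U \<inter> V = {} \<and>
       (\<forall>u v. u \<rightarrow>\<^bsub>G\<^esub> v \<longrightarrow> u \<in> U \<and> v \<in> V \<or> u \<in> V \<and> v \<in> U))"


section \<open>Unitary Cayley graphs\<close>

definition unitary_cayley_graph :: "('a, 'm) ring_scheme \<Rightarrow> 'a pair_pre_digraph" where
  "unitary_cayley_graph R =
     \<lparr> pverts = carrier R,
       parcs = {(a, b) \<in> carrier R \<times> carrier R. a \<noteq> b \<and> a \<ominus>\<^bsub>R\<^esub> b \<in> Units R} \<rparr>"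

lemma (in ring) Units_a_inv_closed:
  assumes "u \<in> Units R"
  shows "\<ominus> u \<in> Units R"
proof -
  obtain v where v: "v \<in> carrier R" "u \<otimes> v = \<one>" "v \<otimes> u = \<one>"
    using assms unfolding Units_def by blast
  have u: "u \<in> carrier R" using assms by blast
  have "(\<ominus> u) \<otimes> (\<ominus> v) = \<one>" "(\<ominus> v) \<otimes> (\<ominus> u) = \<one>"
    using u v by (simp_all add: l_minus r_minus)
  with u v show ?thesis unfolding Units_def by blast
qed

lemma pair_graph_unitary_cayley_graph:
  fixes R (structure)
  assumes "ring R" "finite (carrier R)"
  shows "pair_graph (unitary_cayley_graph R)"
proof -
  interpret ring R by fact
  have sym: "b \<ominus> a \<in> Units R"
    if "a \<in> carrier R" "b \<in> carrier R" "a \<ominus> b \<in> Units R" for a b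
  proof -
    have "b \<ominus> a = \<ominus> (a \<ominus> b)"
      using that by (simp add: a_minus_def minus_add a_comm)
    with that Units_a_inv_closed show ?thesis by metis
  qed
  have "finite (parcs (unitary_cayley_graph R))"
    by (rule finite_subset[of _ "carrier R \<times> carrier R"])
      (use assms in \<open>auto simp: unitary_cayley_graph_def\<close>)
  then show ?thesis
    using assms sym
    by unfold_locales (auto simp: unitary_cayley_graph_def symmetric_def intro!: symI)
qed

end

theory Submission
  imports Defs
begin

text \<open>Since a finite ring element is invertible iff it is invertible modulo the Jacobson radical,
  adjacency in the unitary Cayley graph of \<open>R\<close> can be tested in the given product of fields and
  matrix rings. A factor with two elements yields a 2-colouring. For at most two fields, adjacency
  means that two coordinates both differ, so cliques are matchings and colourings are line covers of
  a bipartite graph, and perfection is Konig's min-max theorem. For two by two matrices over the field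
  with two elements the graph is the four by four rook's graph, and perfection is Konig's
  edge-colouring theorem. In all other cases the graph contains an induced pentagon: five ring
  elements whose cyclically consecutive differences are units while each of the other differences is
  a zero divisor in at least one factor. A three-colouring of the pentagon by \<open>0, 1, c\<close> with \<open>c\<close>
  and \<open>c - 1\<close> invertible makes one or two diagonals vanish, \<open>M\<^sub>2\<close> handles four of the five diagonals
  over every field and all of them over a field with more than two elements, and \<open>M\<^sub>n\<close> with
  \<open>n \<ge> 3\<close> handles all of them.\<close>

text \<open>A unit of a product is a unit in every factor, while a zero divisor in a single factor
  already rules out adjacency. So every factor must realise the five edges of the pentagon, but the
  five diagonals can be shared out among the factors. Elements 0, 1, c with pairwise unit
  differences realise the edges because a pentagon is 3-colourable; among the factors only the field
  with two elements lacks them, and it is absent once the smallest field \<open>K 1\<close> has more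
  than two elements. A 3-colouring of a pentagon has two classes of size two, so it collapses two
  diagonals: two fields leave a diagonal over, and a third one supplies it, which is where the bound
  \<open>s \<le> 2\<close> comes from. The graph of M_2 over two elements is perfect, so this factor
  must also leave a diagonal over, and any second factor supplies it. The explicit matrices are
  chosen to work in every characteristic. Pentagons are built in the decomposed ring and pulled back
  along a surjection from \<open>R\<close> that preserves and reflects units.\<close>

no_notation vwalk_join (infixr \<open>\<oplus>\<close> 65)
hide_const (open) Ring_Hom.ring_hom

section \<open>Perfect graphs\<close>

lemma induced_subgraph_dominates_iff:
  assumes "induced_subgraph H G"
  shows "u \<rightarrow>\<^bsub>H\<^esub> v \<longleftrightarrow> u \<in> verts H \<and> v \<in> verts H \<and> u \<rightarrow>\<^bsub>G\<^esub> v"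
  using assms
  by (auto simp: induced_subgraph_def subgraph_def compatible_def arcs_ends_def arc_to_ends_def)

lemma clique_card_le:
  assumes "proper_colouring G k c" "clique G Q"
  shows "card Q \<le> k"
proof -
  have "inj_on c Q"
    using assms by (force simp: inj_on_def proper_colouring_def clique_def)
  moreover have "c ` Q \<subseteq> {..<k}"
    using assms by (auto simp: proper_colouring_def clique_def image_subset_iff subset_iff)
  ultimately show ?thesis
    using card_inj_on_le[of c Q "{..<k}"] by simp
qed

lemma finite_cliques: "finite (verts G) \<Longrightarrow> finite {Q. clique G Q}"
  by (rule finite_subset[of _ "Pow (verts G)"]) (auto simp: clique_def)

text \<open>Every clique needs as many colours as it has vertices, so a clique and a colouring of
  equal size certify each other's optimality.\<close>

lemma chromatic_eq_clique_numberI: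
  assumes "finite (verts G)" "proper_colouring G (card Q) c" "clique G Q"
  shows "chromatic_number G = clique_number G"
proof -
  have chi: "chromatic_number G = card Q"
    unfolding chromatic_number_def
    by (rule Least_equality) (use assms clique_card_le in blast)+
  have omega: "clique_number G = card Q"
    unfolding clique_number_def
    by (rule Max_eqI) (use assms clique_card_le finite_cliques[OF assms(1)] in auto)
  from chi omega show ?thesis by simp
qed

text \<open>Turns perfection into a min-max certificate on each vertex set \<open>S\<close>. Induced
  subgraphs disappear from the later perfection proofs, and \<open>c\<close> only matters on
  \<open>S\<close>.\<close>

lemma perfect_graphI:
  assumes "finite (verts G)"
    and "\<And>S. S \<subseteq> verts G \<Longrightarrow> \<exists>Q c. Q \<subseteq> S \<and> (\<forall>u \<in> Q. \<forall>v \<in> Q. u \<noteq> v \<longrightarrow> u \<rightarrow>\<^bsub>G\<^esub> v) \<and>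
      c ` S \<subseteq> {..<card Q} \<and> (\<forall>u \<in> S. \<forall>v \<in> S. u \<rightarrow>\<^bsub>G\<^esub> v \<longrightarrow> c u \<noteq> (c v :: nat))"
  shows "perfect_graph G"
  unfolding perfect_graph_def
proof (intro allI impI)
  fix H assume H: "induced_subgraph H G"
  then have sub: "verts H \<subseteq> verts G"
    by (simp add: induced_subgraph_def subgraph_def)
  from assms(2)[OF this] obtain Q c where
    "Q \<subseteq> verts H" "\<forall>u \<in> Q. \<forall>v \<in> Q. u \<noteq> v \<longrightarrow> u \<rightarrow>\<^bsub>G\<^esub> v" "c ` verts H \<subseteq> {..<card Q}"
    "\<forall>u \<in> verts H. \<forall>v \<in> verts H. u \<rightarrow>\<^bsub>G\<^esub> v \<longrightarrow> c u \<noteq> c v"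
    by blast
  then have "proper_colouring H (card Q) c" "clique H Q"
    using induced_subgraph_dominates_iff[OF H]
    by (auto simp: proper_colouring_def clique_def subset_iff)
  with finite_subset[OF sub assms(1)] show "chromatic_number H = clique_number H"
    by (intro chromatic_eq_clique_numberI)
qed

lemma bipartite_imp_perfect:
  assumes "finite (verts G)" "bipartite_graph G" and sym: "\<And>u v. u \<rightarrow>\<^bsub>G\<^esub> v \<Longrightarrow> v \<rightarrow>\<^bsub>G\<^esub> u"
  shows "perfect_graph G"
proof (rule perfect_graphI[OF assms(1)])
  fix S assume S: "S \<subseteq> verts G"
  obtain U V where UV: "U \<union> V = verts G" "U \<inter> V = {}"
    "\<And>u v. u \<rightarrow>\<^bsub>G\<^esub> v \<Longrightarrow> u \<in> U \<and> v \<in> V \<or> u \<in> V \<and> v \<in> U"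
    using assms(2) unfolding bipartite_graph_def by blast
  \<comment> \<open>The number of colours allowed is \<open>card Q\<close>, so sets with an edge,
    empty sets and nonempty edgeless sets need cliques of size 2, 0 and 1.\<close>
  consider "\<exists>u \<in> S. \<exists>v \<in> S. u \<rightarrow>\<^bsub>G\<^esub> v" | "S = {}" | "S \<noteq> {}" "\<forall>u \<in> S. \<forall>v \<in> S. \<not> u \<rightarrow>\<^bsub>G\<^esub> v"
    by blast
  then show "\<exists>Q c. Q \<subseteq> S \<and> (\<forall>u \<in> Q. \<forall>v \<in> Q. u \<noteq> v \<longrightarrow> u \<rightarrow>\<^bsub>G\<^esub> v) \<and>
      c ` S \<subseteq> {..<card Q} \<and> (\<forall>u \<in> S. \<forall>v \<in> S. u \<rightarrow>\<^bsub>G\<^esub> v \<longrightarrow> c u \<noteq> (c v :: nat))"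
  proof cases
    case 1
    then obtain u v where uv: "u \<in> S" "v \<in> S" "u \<rightarrow>\<^bsub>G\<^esub> v" by blast
    then have "u \<noteq> v" using UV by blast
    have "(if x \<in> U then 0 else 1) \<noteq> (if y \<in> U then 0 else (1::nat))" if "x \<rightarrow>\<^bsub>G\<^esub> y" for x y
      using UV(2) UV(3)[OF that] by auto
    moreover have "(\<lambda>w. if w \<in> U then 0 else (1::nat)) ` S \<subseteq> {..<card {u, v}}"
      using \<open>u \<noteq> v\<close> by auto
    moreover have "\<forall>x \<in> {u, v}. \<forall>y \<in> {u, v}. x \<noteq> y \<longrightarrow> x \<rightarrow>\<^bsub>G\<^esub> y"
      using uv(3) sym by blast
    ultimately show ?thesis
      using uv(1,2) by (intro exI[of _ "{u, v}"] exI[of _ "\<lambda>w. if w \<in> U then 0 else 1"]) blast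
  next
    case 2
    then show ?thesis by auto
  next
    case 3
    then obtain u where "u \<in> S" by blast
    with 3 show ?thesis
      by (intro exI[of _ "{u}"] exI[of _ "\<lambda>_. 0"]) auto
  qed
qed

text \<open>The five-cycle has no triangle, so perfection would give it a 2-colouring, which an odd
  cycle does not admit.\<close>

lemma pentagon_imp_not_perfect:
  assumes "wf_digraph G" "v ` {..<5::nat} \<subseteq> verts G"
    and adj: "\<And>i j. i < 5 \<Longrightarrow> j < 5 \<Longrightarrow> v i \<rightarrow>\<^bsub>G\<^esub> v j \<longleftrightarrow> i = (j + 1) mod 5 \<or> j = (i + 1) mod 5"
  shows "\<not> perfect_graph G"
proof
  assume perf: "perfect_graph G"
  define H where "H = G \<restriction> v ` {..<5}"
  have H: "induced_subgraph H G"
    unfolding H_def using assms(1,2) by (rule wf_digraph.induced_induce)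
  have verts: "verts H = v ` {..<5}"
    by (simp add: H_def)
  have adjH: "v i \<rightarrow>\<^bsub>H\<^esub> v j \<longleftrightarrow> i = (j + 1) mod 5 \<or> j = (i + 1) mod 5" if "i < 5" "j < 5" for i j
    using that induced_subgraph_dominates_iff[OF H] adj by (simp add: verts)
  have "card Q \<le> 2" if Q: "clique H Q" for Q
  proof (rule ccontr)
    assume "\<not> card Q \<le> 2"
    then have "3 \<le> card Q" by simp
    then obtain T where "T \<subseteq> Q" "card T = 3"
      by (meson obtain_subset_with_card_n)
    then obtain x y z where xyz: "x \<in> Q" "y \<in> Q" "z \<in> Q" "x \<noteq> y" "y \<noteq> z" "x \<noteq> z"
      by (auto simp: card_3_iff)
    moreover have "Q \<subseteq> v ` {..<5}" using Q verts by (simp add: clique_def)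
    ultimately obtain i j k where ijk: "i < 5" "j < 5" "k < 5" "x = v i" "y = v j" "z = v k"
      by (meson imageE lessThan_iff subsetD)
    have "v i \<rightarrow>\<^bsub>H\<^esub> v j" "v j \<rightarrow>\<^bsub>H\<^esub> v k" "v i \<rightarrow>\<^bsub>H\<^esub> v k"
      using Q xyz ijk by (auto simp: clique_def)
    then have "i \<in> set [0..<5]" "j \<in> set [0..<5]" "k \<in> set [0..<5]"
      "i = (j + 1) mod 5 \<or> j = (i + 1) mod 5" "j = (k + 1) mod 5 \<or> k = (j + 1) mod 5"
      "i = (k + 1) mod 5 \<or> k = (i + 1) mod 5"
      using ijk(1-3) adjH by auto
    \<comment> \<open>Triangle-freeness is checked by evaluation over all index triples.\<close>
    moreover have "\<forall>i \<in> set [0..<5]. \<forall>j \<in> set [0..<5]. \<forall>k \<in> set [0..<5].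
        \<not> ((i = (j + 1) mod 5 \<or> j = (i + 1) mod 5) \<and> (j = (k + 1) mod 5 \<or> k = (j + 1) mod 5) \<and>
          (i = (k + 1) mod 5 \<or> k = (i + 1) mod 5))"
      by code_simp
    ultimately show False by blast
  qed
  moreover have fin: "finite (verts H)" by (simp add: verts)
  moreover have "clique H {}" by (simp add: clique_def)
  ultimately have "clique_number H \<le> 2"
    unfolding clique_number_def using finite_cliques[OF fin] by (subst Max_le_iff) auto
  with perf H have chi: "chromatic_number H \<le> 2"
    by (simp add: perfect_graph_def)
  \<comment> \<open>\<open>chromatic_number\<close> is a \<open>LEAST\<close>, so it yields a
    colouring only once some colouring is known to exist. An injective numbering of the vertices
    provides one.\<close>
  obtain h :: "'a \<Rightarrow> nat" and n where h: "h ` verts H = {i. i < n}" "inj_on h (verts H)"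
    using finite_imp_inj_to_nat_seg[OF fin] by metis
  have irrefl: "u \<noteq> w" if "u \<rightarrow>\<^bsub>H\<^esub> w" for u w
  proof
    assume "u = w"
    with that have "u \<rightarrow>\<^bsub>H\<^esub> u" by simp
    moreover from this obtain i where i: "u = v i" "i < 5"
      using induced_subgraph_dominates_iff[OF H] verts by auto
    ultimately have "i = (i + 1) mod 5" using adjH[of i i] by simp
    with i(2) show False by (simp add: mod_Suc split: if_splits)
  qed
  have "proper_colouring H n h"
    unfolding proper_colouring_def
  proof (intro conjI allI impI)
    show "h ` verts H \<subseteq> {..<n}" using h(1) by auto
    show "h u \<noteq> h w" if "u \<rightarrow>\<^bsub>H\<^esub> w" for u w
      using irrefl[OF that] that h(2) induced_subgraph_dominates_iff[OF H] by (auto simp: inj_on_def)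
  qed
  then have "\<exists>n c. proper_colouring H n c" by blast
  then have "\<exists>c. proper_colouring H (chromatic_number H) c"
    unfolding chromatic_number_def by (rule LeastI_ex)
  then obtain c where c: "proper_colouring H (chromatic_number H) c" by blast
  have bound: "c (v i) < 2" if "i < 5" for i
  proof -
    have "c (v i) < chromatic_number H"
      using c that by (simp add: proper_colouring_def verts image_subset_iff)
    with chi show ?thesis by linarith
  qed
  have "c (v 0) \<noteq> c (v 1)" "c (v 1) \<noteq> c (v 2)" "c (v 2) \<noteq> c (v 3)" "c (v 3) \<noteq> c (v 4)"
    "c (v 4) \<noteq> c (v 0)"
    using c adjH[of 0 1] adjH[of 1 2] adjH[of 2 3] adjH[of 3 4] adjH[of 4 0]
    unfolding proper_colouring_def by simp_all
  with bound[of 0] bound[of 1] bound[of 2] bound[of 3] bound[of 4] show False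
    by (auto dest!: less_2_cases)
qed


section \<open>Konig's theorems and perfect graphs\<close>

text \<open>This is a vertex cover in the usual terminology. Finiteness matters because
  \<open>card\<close> of an infinite set is 0, which would spoil the minimum below.\<close>

definition edge_cover :: "'v set set \<Rightarrow> 'v set \<Rightarrow> bool" where
  "edge_cover E C \<longleftrightarrow> finite C \<and> (\<forall>e \<in> E. e \<inter> C \<noteq> {})"

definition cover_number :: "'v set set \<Rightarrow> nat" where
  "cover_number E = (LEAST n. \<exists>C. edge_cover E C \<and> card C = n)"

lemma cover_number_le: "edge_cover E C \<Longrightarrow> cover_number E \<le> card C"
  unfolding cover_number_def by (rule Least_le) blast

lemma cover_number_attained:
  assumes "finite E" "{} \<notin> E" "\<forall>e \<in> E. finite e"
  obtains C where "edge_cover E C" "card C = cover_number E"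
proof -
  have "edge_cover E (\<Union>E)"
    unfolding edge_cover_def
  proof (intro conjI ballI)
    show "finite (\<Union>E)" using assms(1,3) by auto
    show "e \<inter> \<Union>E \<noteq> {}" if "e \<in> E" for e
    proof -
      have "e \<noteq> {}" using assms(2) that by auto
      with that show ?thesis by blast
    qed
  qed
  then have "\<exists>n. \<exists>C. edge_cover E C \<and> card C = n" by blast
  then have "\<exists>C. edge_cover E C \<and> card C = cover_number E"
    unfolding cover_number_def by (rule LeastI_ex)
  with that show ?thesis by blast
qed

text \<open>Lovasz's argument: it suffices to treat edge-critical \<open>E\<close>, and then \<open>E\<close> itself is a matching.
  For if \<open>x \<in> e \<inter> f\<close> and \<open>P\<close>, \<open>Q\<close> are smaller covers of \<open>E - {e}\<close>, \<open>E - {f}\<close>, every edge that avoids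
  \<open>P \<inter> Q\<close> lies inside the symmetric difference of \<open>P\<close> and \<open>Q\<close> enlarged by \<open>x\<close>, and the smaller side
  of that set together with \<open>P \<inter> Q\<close> is too small a cover of \<open>E\<close>.\<close>

lemma konig_cover_matching:
  assumes "finite E" "\<And>e. e \<in> E \<Longrightarrow> \<exists>a \<in> A. \<exists>b. b \<notin> A \<and> e = {a, b}"
  shows "\<exists>M C. M \<subseteq> E \<and> (\<forall>e \<in> M. \<forall>f \<in> M. e \<noteq> f \<longrightarrow> e \<inter> f = {}) \<and> edge_cover E C \<and> card C \<le> card M"
  using assms
proof (induction "card E" arbitrary: E rule: less_induct)
  case less
  have ne: "\<And>E'. E' \<subseteq> E \<Longrightarrow> {} \<notin> E'" "\<And>E'. E' \<subseteq> E \<Longrightarrow> \<forall>e \<in> E'. finite e"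
    using less.prems(2) by blast+
  obtain C where C: "edge_cover E C" "card C = cover_number E"
    by (rule cover_number_attained[OF less.prems(1) ne[of E]]) auto
  show ?case
  proof (cases "\<exists>e \<in> E. cover_number E \<le> cover_number (E - {e})")
    case True
    then obtain e where e: "e \<in> E" "cover_number E \<le> cover_number (E - {e})" by blast
    have "card (E - {e}) < card E"
      using e(1) less.prems(1) by (rule card_Diff1_less[rotated])
    then obtain M C' where M: "M \<subseteq> E - {e}" "\<forall>e \<in> M. \<forall>f \<in> M. e \<noteq> f \<longrightarrow> e \<inter> f = {}"
      "edge_cover (E - {e}) C'" "card C' \<le> card M"
      using less.hyps[of "E - {e}"] less.prems by auto
    then have "card C \<le> card M"
      using cover_number_le[OF M(3)] e(2) C(2) by linarith
    with M C show ?thesis by blast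
  next
    case False
    then have crit: "cover_number (E - {e}) < cover_number E" if "e \<in> E" for e
      using that by force
    have "e \<inter> f = {}" if ef: "e \<in> E" "f \<in> E" "e \<noteq> f" for e f
    proof (rule ccontr)
      assume "e \<inter> f \<noteq> {}"
      then obtain x where x: "x \<in> e" "x \<in> f" by blast
      obtain P where P: "edge_cover (E - {e}) P" "card P < cover_number E"
        by (rule cover_number_attained[of "E - {e}"])
          (use ne[of "E - {e}"] less.prems(1) crit[OF ef(1)] in auto)
      obtain Q where Q: "edge_cover (E - {f}) Q" "card Q < cover_number E"
        by (rule cover_number_attained[of "E - {f}"])
          (use ne[of "E - {f}"] less.prems(1) crit[OF ef(2)] in auto)
      have fin: "finite P" "finite Q" using P Q by (auto simp: edge_cover_def)
      \<comment> \<open>If \<open>P\<close> met \<open>e\<close> it would cover all of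
        \<open>E\<close> and be smaller than the cover number.\<close>
      have "e \<inter> P = {}"
      proof (rule ccontr)
        assume "e \<inter> P \<noteq> {}"
        then have "edge_cover E P" using P(1) by (auto simp: edge_cover_def)
        with cover_number_le P(2) show False by force
      qed
      moreover have "f \<inter> Q = {}"
      proof (rule ccontr)
        assume "f \<inter> Q \<noteq> {}"
        then have "edge_cover E Q" using Q(1) by (auto simp: edge_cover_def)
        with cover_number_le Q(2) show False by force
      qed
      moreover define D where "D = insert x ((P - Q) \<union> (Q - P))"
      \<comment> \<open>An edge other than \<open>e\<close> and \<open>f\<close> meets both
        \<open>P\<close> and \<open>Q\<close>, so one of its ends lies in \<open>P - Q\<close> and
        the other in \<open>Q - P\<close>. The edge \<open>e\<close> avoids \<open>P\<close> but
        meets \<open>Q\<close>, and it does so away from \<open>x\<close>, since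
        \<open>x \<in> f\<close> and \<open>f\<close> avoids \<open>Q\<close>; the edge
        \<open>f\<close> is symmetric.\<close>
      ultimately have gD: "g \<subseteq> D" if g: "g \<in> E" "g \<inter> (P \<inter> Q) = {}" for g
      proof -
        obtain a b where "g = {a, b}" using less.prems(2)[OF g(1)] by blast
        moreover have "g \<noteq> e \<Longrightarrow> g \<inter> P \<noteq> {}" "g \<noteq> f \<Longrightarrow> g \<inter> Q \<noteq> {}"
          using P(1) Q(1) g(1) by (auto simp: edge_cover_def)
        ultimately show ?thesis
          using g(2) x ef(3) \<open>e \<inter> P = {}\<close> \<open>f \<inter> Q = {}\<close> unfolding D_def by blast
      qed
      \<comment> \<open>An edge inside \<open>D\<close> has one end in \<open>A\<close> and one
        outside, so either half of \<open>D\<close> meets it.\<close>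
      have cov: "edge_cover E ((D \<inter> A) \<union> (P \<inter> Q))" "edge_cover E ((D - A) \<union> (P \<inter> Q))"
      proof -
        have "finite D" using fin by (simp add: D_def)
        moreover have "g \<inter> (D \<inter> A \<union> P \<inter> Q) \<noteq> {} \<and> g \<inter> (D - A \<union> P \<inter> Q) \<noteq> {}" if g: "g \<in> E" for g
        proof (cases "g \<inter> (P \<inter> Q) = {}")
          case True
          obtain a b where "a \<in> A" "b \<notin> A" "g = {a, b}" using less.prems(2)[OF g] by blast
          with gD[OF g True] show ?thesis by blast
        qed blast
        ultimately show "edge_cover E ((D \<inter> A) \<union> (P \<inter> Q))" "edge_cover E ((D - A) \<union> (P \<inter> Q))"
          using fin unfolding edge_cover_def by auto
      qed
      \<comment> \<open>Adding the sizes of both covers bounds twice the cover number by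
        \<open>card D + 2 * card (P \<inter> Q)\<close>, hence by
        \<open>1 + card P + card Q\<close>. As \<open>P\<close> and \<open>Q\<close> are each
        smaller than the cover number, this is impossible.\<close>
      have "card (P - Q) + card (P \<inter> Q) = card P" "card (Q - P) + card (P \<inter> Q) = card Q"
        using fin card_Int_Diff[of P Q] card_Int_Diff[of Q P] by (simp_all add: Int_commute)
      moreover have "card D \<le> Suc (card (P - Q) + card (Q - P))"
      proof -
        have "card D \<le> Suc (card ((P - Q) \<union> (Q - P)))"
          unfolding D_def using fin by (simp add: card_insert_if)
        with card_Un_le[of "P - Q" "Q - P"] show ?thesis by linarith
      qed
      moreover have "card (D \<inter> A) + card (D - A) = card D"
        using fin card_Int_Diff[of D A] by (simp add: D_def)
      moreover have "card ((D \<inter> A) \<union> (P \<inter> Q)) \<le> card (D \<inter> A) + card (P \<inter> Q)"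
        "card ((D - A) \<union> (P \<inter> Q)) \<le> card (D - A) + card (P \<inter> Q)"
        by (rule card_Un_le)+
      ultimately show False
        using cov[THEN cover_number_le] P(2) Q(2) by linarith
    qed
    \<comment> \<open>With all edges disjoint \<open>E\<close> is its own matching, and one vertex
      picked from each edge covers it.\<close>
    moreover have "\<exists>C. edge_cover E C \<and> card C \<le> card E"
    proof -
      have "edge_cover E ((\<lambda>e. SOME x. x \<in> e) ` E)"
        unfolding edge_cover_def
      proof (intro conjI ballI)
        show "e \<inter> (\<lambda>e. SOME x. x \<in> e) ` E \<noteq> {}" if "e \<in> E" for e
        proof -
          have "(SOME x. x \<in> e) \<in> e" using that ne(1)[of E] by (auto simp: some_in_eq)
          with that show ?thesis by blast
        qed
      qed (use less.prems(1) in simp)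
      with card_image_le[OF less.prems(1)] show ?thesis by blast
    qed
    ultimately show ?thesis by blast
  qed
qed

text \<open>Each vertex becomes the edge joining its two coordinates in a bipartite graph, and
  adjacency becomes disjointness of edges. The coordinates need not determine the vertex: in the
  application, elements congruent modulo the radical share them.\<close>

lemma perfect_tensor_type:
  assumes fin: "finite (verts G)"
    and adj: "\<And>u v. u \<in> verts G \<Longrightarrow> v \<in> verts G \<Longrightarrow> u \<rightarrow>\<^bsub>G\<^esub> v \<longleftrightarrow> f u \<noteq> f v \<and> g u \<noteq> g v"
  shows "perfect_graph G"
proof (rule perfect_graphI[OF fin])
  fix S assume S: "S \<subseteq> verts G"
  define h where "h u = {Inl (f u), Inr (g u)}" for u
  have fin_edges: "finite (h ` S)" using finite_subset[OF S fin] by simp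
  have edges: "\<exists>a \<in> range Inl. \<exists>b. b \<notin> range Inl \<and> e = {a, b}" if "e \<in> h ` S" for e
    using that by (auto simp: h_def)
  obtain M C where M: "M \<subseteq> h ` S" "\<forall>e \<in> M. \<forall>f \<in> M. e \<noteq> f \<longrightarrow> e \<inter> f = {}"
    and C: "edge_cover (h ` S) C" "card C \<le> card M"
    using konig_cover_matching[OF fin_edges edges] by metis
  \<comment> \<open>\<open>h\<close> may be many-to-one, so one representative in \<open>S\<close>
    is chosen for each edge of the matching.\<close>
  define Q where "Q = inv_into S h ` M"
  have QS: "Q \<subseteq> S" unfolding Q_def using M(1) by (meson image_subsetI inv_into_into subsetD)
  have cardQ: "card Q = card M"
    unfolding Q_def by (rule card_image) (rule inj_on_inv_into[OF M(1)])
  have hQ: "h u \<in> M \<and> inv_into S h (h u) = u" if u: "u \<in> Q" for u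
  proof -
    obtain e where e: "e \<in> M" "u = inv_into S h e" using u by (auto simp: Q_def)
    moreover have "h (inv_into S h e) = e"
      using e(1) M(1) by (intro f_inv_into_f) (auto)
    ultimately show ?thesis by simp
  qed
  have clique: "u \<rightarrow>\<^bsub>G\<^esub> v" if uv: "u \<in> Q" "v \<in> Q" "u \<noteq> v" for u v
  proof -
    have "h u \<noteq> h v" using hQ[OF uv(1)] hQ[OF uv(2)] uv(3) by metis
    then have "h u \<inter> h v = {}" using M(2) hQ uv by blast
    moreover have "u \<in> verts G" "v \<in> verts G" using uv QS S by auto
    ultimately show ?thesis using adj by (auto simp: h_def)
  qed
  obtain n where n: "bij_betw n C {..<card C}"
    using C(1) ex_bij_betw_finite_nat[of C] by (auto simp: edge_cover_def lessThan_atLeast0)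
  \<comment> \<open>The colour of \<open>u\<close> is the number of a cover vertex on its edge.
    Equal colours mean a common endpoint, hence no adjacency.\<close>
  define c where "c u = n (SOME x. x \<in> h u \<inter> C)" for u
  have some: "(SOME x. x \<in> h u \<inter> C) \<in> h u \<inter> C" if "u \<in> S" for u
    unfolding some_in_eq using C(1) that by (simp add: edge_cover_def)
  have "c ` S \<subseteq> {..<card Q}"
  proof -
    have "c u < card C" if "u \<in> S" for u
      using some[OF that] bij_betwE[OF n] by (auto simp: c_def)
    with C(2) cardQ show ?thesis by fastforce
  qed
  moreover have "c u \<noteq> c v" if uv: "u \<in> S" "v \<in> S" "u \<rightarrow>\<^bsub>G\<^esub> v" for u v
  proof
    assume "c u = c v"
    then have "(SOME x. x \<in> h u \<inter> C) = (SOME x. x \<in> h v \<inter> C)"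
      using some uv n unfolding c_def bij_betw_def inj_on_def by blast
    then have "h u \<inter> h v \<noteq> {}" using some uv by (metis Int_iff empty_iff)
    moreover have "u \<in> verts G" "v \<in> verts G" using uv S by auto
    ultimately show False using adj uv(3) by (auto simp: h_def)
  qed
  ultimately show "\<exists>Q c. Q \<subseteq> S \<and> (\<forall>u \<in> Q. \<forall>v \<in> Q. u \<noteq> v \<longrightarrow> u \<rightarrow>\<^bsub>G\<^esub> v) \<and>
      c ` S \<subseteq> {..<card Q} \<and> (\<forall>u \<in> S. \<forall>v \<in> S. u \<rightarrow>\<^bsub>G\<^esub> v \<longrightarrow> c u \<noteq> (c v :: nat))"
    using QS clique by (intro exI[of _ Q] exI[of _ c]) simp
qed

section \<open>Edge colourings of bipartite graphs\<close>

text \<open>The Kempe chain from the row \<open>x\<close>, where \<open>\<alpha>\<close> is missing. It leaves rows along \<open>\<beta>\<close> only and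
  columns along \<open>\<alpha>\<close> only, so it cannot reach a column at which \<open>\<beta>\<close> is missing.\<close>

inductive_set kempe :: "('a \<times> 'b) set \<Rightarrow> ('a \<times> 'b \<Rightarrow> nat) \<Rightarrow> nat \<Rightarrow> nat \<Rightarrow> 'a \<Rightarrow> ('a + 'b) set"
  for T c \<alpha> \<beta> x where
  start: "Inl x \<in> kempe T c \<alpha> \<beta> x"
| row: "Inl u \<in> kempe T c \<alpha> \<beta> x \<Longrightarrow> (u, v) \<in> T \<Longrightarrow> c (u, v) = \<beta> \<Longrightarrow> Inr v \<in> kempe T c \<alpha> \<beta> x"
| col: "Inr v \<in> kempe T c \<alpha> \<beta> x \<Longrightarrow> (u, v) \<in> T \<Longrightarrow> c (u, v) = \<alpha> \<Longrightarrow> Inl u \<in> kempe T c \<alpha> \<beta> x"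

definition edge_colouring :: "('a \<times> 'b) set \<Rightarrow> nat \<Rightarrow> ('a \<times> 'b \<Rightarrow> nat) \<Rightarrow> bool" where
  "edge_colouring T k c \<longleftrightarrow> c ` T \<subseteq> {..<k} \<and>
     (\<forall>u v v'. (u, v) \<in> T \<longrightarrow> (u, v') \<in> T \<longrightarrow> c (u, v) = c (u, v') \<longrightarrow> v = v') \<and>
     (\<forall>u u' v. (u, v) \<in> T \<longrightarrow> (u', v) \<in> T \<longrightarrow> c (u, v) = c (u', v) \<longrightarrow> u = u')"

text \<open>Exchanging \<alpha> and \<beta> along the chain frees \<beta> at the row
  \<open>x\<close>. The chain does not reach the column \<open>y\<close>, so \<beta> stays free
  there and can be given to the new edge.\<close>

lemma konig_edge_colouring_step:
  assumes c: "edge_colouring T k c" and k: "\<alpha> < k" "\<beta> < k"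
    and x: "\<And>v. (x, v) \<in> T \<Longrightarrow> c (x, v) \<noteq> \<alpha>" and y: "\<And>u. (u, y) \<in> T \<Longrightarrow> c (u, y) \<noteq> \<beta>"
    and xy: "(x, y) \<notin> T"
  shows "\<exists>c. edge_colouring (insert (x, y) T) k c"
proof -
  let ?K = "kempe T c \<alpha> \<beta> x"
  have row: "\<And>u v v'. (u, v) \<in> T \<Longrightarrow> (u, v') \<in> T \<Longrightarrow> c (u, v) = c (u, v') \<Longrightarrow> v = v'"
    and col: "\<And>u u' v. (u, v) \<in> T \<Longrightarrow> (u', v) \<in> T \<Longrightarrow> c (u, v) = c (u', v) \<Longrightarrow> u = u'"
    and bound: "\<And>u v. (u, v) \<in> T \<Longrightarrow> c (u, v) < k"
    using c unfolding edge_colouring_def by blast+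
  have K_Inl: "u = x \<or> (\<exists>v. Inr v \<in> ?K \<and> (u, v) \<in> T \<and> c (u, v) = \<alpha>)" if "Inl u \<in> ?K" for u
    by (rule kempe.cases[OF that]) (simp, simp, metis Inl_inject)
  have K_Inr: "\<exists>u. Inl u \<in> ?K \<and> (u, v) \<in> T \<and> c (u, v) = \<beta>" if "Inr v \<in> ?K" for v
    by (rule kempe.cases[OF that]) (simp, metis Inr_inject, simp)
  \<comment> \<open>The rules of \<open>kempe\<close> follow only \<beta> out of a row. An
    \<alpha>-edge at a chain row is also covered: the row is not \<open>x\<close>, so it was entered
    along an \<alpha>-edge, and a row has only one.\<close>
  have K_row: "Inr v \<in> ?K" if K: "Inl u \<in> ?K" "(u, v) \<in> T" "c (u, v) \<in> {\<alpha>, \<beta>}" for u v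
  proof (cases "c (u, v) = \<beta>")
    case True
    with that show ?thesis by (intro kempe.row[of u])
  next
    case False
    then have \<alpha>: "c (u, v) = \<alpha>" using that(3) by blast
    then have "u \<noteq> x" using x that(2) by blast
    then obtain v' where "Inr v' \<in> ?K" "(u, v') \<in> T" "c (u, v') = \<alpha>"
      using K_Inl[OF K(1)] by blast
    then show ?thesis using row[OF that(2)] \<alpha> by metis
  qed
  have K_col: "Inl u \<in> ?K" if K: "Inr v \<in> ?K" "(u, v) \<in> T" "c (u, v) \<in> {\<alpha>, \<beta>}" for u v
  proof (cases "c (u, v) = \<alpha>")
    case True
    with that show ?thesis by (intro kempe.col[of v])
  next
    case False
    then have "c (u, v) = \<beta>" using that(3) by blast
    moreover obtain u' where "Inl u' \<in> ?K" "(u', v) \<in> T" "c (u', v) = \<beta>"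
      using K_Inr[OF K(1)] by blast
    ultimately show ?thesis using col[OF that(2)] by metis
  qed
  have yK: "Inr y \<notin> ?K"
    using y K_Inr by blast
  let ?s = "Transposition.transpose \<alpha> \<beta>"
  \<comment> \<open>Testing only the row of \<open>e\<close> is enough: by \<open>K_row\<close> and
    \<open>K_col\<close> an edge coloured \<alpha> or \<beta> has both ends in the chain or
    neither.\<close>
  define c' where "c' e = (if e = (x, y) then \<beta> else if Inl (fst e) \<in> ?K then ?s (c e) else c e)" for e
  have c'T: "c' (u, v) = (if Inl u \<in> ?K then ?s (c (u, v)) else c (u, v))" if "(u, v) \<in> T" for u v
    using that xy by (auto simp: c'_def)
  have new_row: "c' (x, v) \<noteq> \<beta>" if "(x, v) \<in> T" for v
    using x[OF that] kempe.start[of x T c \<alpha> \<beta>]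
    by (auto simp: c'T[OF that] transpose_def)
  have new_col: "c' (u, y) \<noteq> \<beta>" if "(u, y) \<in> T" for u
    using y[OF that] yK K_row[of u y] that by (auto simp: c'T[OF that] transpose_def)
  have old_row: "v = v'" if "(u, v) \<in> T" "(u, v') \<in> T" "c' (u, v) = c' (u, v')" for u v v'
    using that row[of u v v'] by (auto simp: c'T dest: injD[OF inj_transpose] split: if_splits)
  \<comment> \<open>Only a row inside and a row outside the chain could newly clash in a column.
    Then both colours would be \<alpha> or \<beta>, and the column would pull the second row into
    the chain.\<close>
  have swap_col: False if uu: "(u, v) \<in> T" "(u', v) \<in> T" "?s (c (u, v)) = c (u', v)"
      "Inl u \<in> ?K" "Inl u' \<notin> ?K" for u u' v
  proof -
    have "c (u, v) \<noteq> c (u', v)" using col[of u v u'] uu by auto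
    with uu(3) have "c (u, v) \<in> {\<alpha>, \<beta>}" "c (u', v) \<in> {\<alpha>, \<beta>}"
      by (auto simp: transpose_def split: if_splits)
    with K_row[of u v] K_col[of v u'] uu show False by blast
  qed
  have old_col: "u = u'" if "(u, v) \<in> T" "(u', v) \<in> T" "c' (u, v) = c' (u', v)" for u u' v
    using that col[of u v u'] swap_col[of u v u'] swap_col[of u' v u]
    by (auto simp: c'T dest: injD[OF inj_transpose] split: if_splits)
  have "c' (u, v) < k" if "(u, v) \<in> T" for u v
    using bound[OF that] k by (auto simp: c'T[OF that] transpose_def)
  moreover have [simp]: "c' (x, y) = \<beta>" by (simp add: c'_def)
  ultimately have "edge_colouring (insert (x, y) T) k c'"
    unfolding edge_colouring_def using k(2) new_row new_col old_row old_col
    by (intro conjI allI impI) (auto, metis+)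
  then show ?thesis by blast
qed

text \<open>Edges are added one at a time. Before its insertion the ends of the new edge have degree
  below \<open>k\<close>, so each of them misses a colour.\<close>

lemma konig_edge_colouring:
  assumes "finite T" "\<And>u. card (T `` {u}) \<le> k" "\<And>v. card (converse T `` {v}) \<le> k"
  shows "\<exists>c. edge_colouring T k c"
  using assms
proof (induction T)
  case empty
  then show ?case by (auto simp: edge_colouring_def)
next
  case (insert e T)
  obtain x y where e: "e = (x, y)" by fastforce
  have fin: "finite (insert e T `` {u})" "finite (converse (insert e T) `` {v})" for u v
    using insert.hyps(1) by (auto intro: finite_Image)
  have "card (T `` {u}) \<le> k" "card (converse T `` {v}) \<le> k" for u v
    using insert.prems card_mono[OF fin(1)[of u], of "T `` {u}"]
      card_mono[OF fin(2)[of v], of "converse T `` {v}"]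
    by (meson Image_mono converse_mono order_refl order_trans subset_insertI)+
  then obtain c where c: "edge_colouring T k c" using insert.IH by blast
  \<comment> \<open>Pigeonhole, stated for an arbitrary type because rows and columns have different
    types.\<close>
  have missing: "\<exists>\<alpha> < k. \<alpha> \<notin> h ` B" if "finite B" "card B < k" for B :: "'c set" and h :: "'c \<Rightarrow> nat"
  proof -
    have "card (h ` B) < card {..<k}"
      using card_image_le[OF that(1), of h] that(2) by simp
    then have "\<not> {..<k} \<subseteq> h ` B"
      using that(1) by (metis card_mono finite_imageI not_le)
    then show ?thesis by auto
  qed
  have "insert e T `` {x} = insert y (T `` {x})" "y \<notin> T `` {x}"
    using insert.hyps(2) by (auto simp: e)
  then have "card (T `` {x}) < k"
    using insert.prems(1)[of x] insert.hyps(1) by (simp add: finite_Image)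
  with insert.hyps(1) obtain \<alpha> where \<alpha>: "\<alpha> < k" "\<alpha> \<notin> (\<lambda>v. c (x, v)) ` (T `` {x})"
    using missing[of "T `` {x}"] by (metis finite_Image)
  have "converse (insert e T) `` {y} = insert x (converse T `` {y})" "x \<notin> converse T `` {y}"
    using insert.hyps(2) by (auto simp: e)
  then have "card (converse T `` {y}) < k"
    using insert.prems(2)[of y] insert.hyps(1) by (simp add: finite_Image)
  with insert.hyps(1) obtain \<beta> where \<beta>: "\<beta> < k" "\<beta> \<notin> (\<lambda>u. c (u, y)) ` (converse T `` {y})"
    using missing[of "converse T `` {y}"] by (metis finite_Image finite_converse)
  show ?case
    unfolding e using c \<alpha>(1) \<beta>(1)
  proof (rule konig_edge_colouring_step)
    show "c (x, v) \<noteq> \<alpha>" if "(x, v) \<in> T" for v using \<alpha>(2) that by blast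
    show "c (u, y) \<noteq> \<beta>" if "(u, y) \<in> T" for u using \<beta>(2) that by blast
    show "(x, y) \<notin> T" using insert.hyps(2) by (simp add: e)
  qed
qed

text \<open>Vertices become cells \<open>(f u, g u)\<close>, adjacent when they share exactly one
  coordinate. The cells of one row or column form a clique, and an edge colouring of the bipartite
  graph of occupied cells is a colouring. Again several vertices may occupy one cell.\<close>

lemma perfect_rook_type:
  assumes fin: "finite (verts G)"
    and adj: "\<And>u v. u \<in> verts G \<Longrightarrow> v \<in> verts G \<Longrightarrow> u \<rightarrow>\<^bsub>G\<^esub> v \<longleftrightarrow> (f u \<noteq> f v) \<noteq> (g u \<noteq> g v)"
  shows "perfect_graph G"
proof (rule perfect_graphI[OF fin])
  fix S assume S: "S \<subseteq> verts G"
  define h where "h u = (f u, g u)" for u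
  define T where "T = h ` S"
  have finS: "finite S" using S fin by (rule finite_subset)
  then have finT: "finite T" by (simp add: T_def)
  define lines where "lines = (\<lambda>u. {p \<in> T. fst p = f u}) ` S \<union> (\<lambda>u. {p \<in> T. snd p = g u}) ` S"
  \<comment> \<open>The inserted 0 gives \<open>Max\<close> a value when \<open>S\<close> is
    empty.\<close>
  define k where "k = Max (insert 0 (card ` lines))"
  have fin_lines: "finite lines" using finS by (simp add: lines_def)
  have line_le: "card L \<le> k" if "L \<in> lines" for L
    using that fin_lines by (simp add: k_def)
  have "card (T `` {a}) \<le> k" for a
  proof (cases "a \<in> f ` S")
    case True
    then have "{p \<in> T. fst p = a} \<in> lines" by (auto simp: lines_def)
    moreover have "card (T `` {a}) = card {p \<in> T. fst p = a}"
      by (rule bij_betw_same_card[of "Pair a"], rule bij_betw_byWitness[where f' = snd]) auto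
    ultimately show ?thesis using line_le by simp
  next
    case False
    then have "T `` {a} = {}" by (auto simp: T_def h_def)
    then show ?thesis by simp
  qed
  moreover have "card (converse T `` {b}) \<le> k" for b
  proof (cases "b \<in> g ` S")
    case True
    then have "{p \<in> T. snd p = b} \<in> lines" by (auto simp: lines_def)
    moreover have "card (converse T `` {b}) = card {p \<in> T. snd p = b}"
      by (rule bij_betw_same_card[of "\<lambda>a. (a, b)"], rule bij_betw_byWitness[where f' = fst]) auto
    ultimately show ?thesis using line_le by simp
  next
    case False
    then have "converse T `` {b} = {}" by (auto simp: T_def h_def)
    then show ?thesis by simp
  qed
  ultimately obtain c where c: "edge_colouring T k c"
    using konig_edge_colouring[OF finT] by blast
  \<comment> \<open>A longest line attains \<open>k\<close>. It becomes the clique that matches the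
    \<open>k\<close> colours.\<close>
  have "\<exists>L. L \<subseteq> T \<and> card L = k \<and> ((\<exists>a. fst ` L \<subseteq> {a}) \<or> (\<exists>b. snd ` L \<subseteq> {b}))"
  proof -
    have "k \<in> insert 0 (card ` lines)"
      unfolding k_def using fin_lines by (intro Max_in) auto
    then consider "k = 0" | L where "L \<in> lines" "card L = k" by blast
    then show ?thesis
    proof cases
      case 1
      then show ?thesis by (intro exI[of _ "{}"]) simp
    next
      case 2
      then obtain u where "L = {p \<in> T. fst p = f u} \<or> L = {p \<in> T. snd p = g u}"
        by (auto simp: lines_def)
      then have "L \<subseteq> T" "fst ` L \<subseteq> {f u} \<or> snd ` L \<subseteq> {g u}" by auto
      with 2(2) show ?thesis by blast
    qed
  qed
  then obtain L where L: "L \<subseteq> T" "card L = k" "(\<exists>a. fst ` L \<subseteq> {a}) \<or> (\<exists>b. snd ` L \<subseteq> {b})"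
    by blast
  define Q where "Q = inv_into S h ` L"
  have QS: "Q \<subseteq> S" unfolding Q_def using L(1)[unfolded T_def] by (meson image_subsetI inv_into_into subsetD)
  have cardQ: "card Q = k"
    unfolding Q_def L(2)[symmetric] by (rule card_image) (use L(1) inj_on_inv_into T_def in blast)
  have hQ: "h u \<in> L \<and> inv_into S h (h u) = u" if u: "u \<in> Q" for u
  proof -
    obtain e where e: "e \<in> L" "u = inv_into S h e" using u by (auto simp: Q_def)
    moreover have "h (inv_into S h e) = e"
      using e(1) L(1) by (intro f_inv_into_f) (auto simp: T_def)
    ultimately show ?thesis by simp
  qed
  have clique: "u \<rightarrow>\<^bsub>G\<^esub> v" if uv: "u \<in> Q" "v \<in> Q" "u \<noteq> v" for u v
  proof -
    have "h u \<noteq> h v" using hQ[OF uv(1)] hQ[OF uv(2)] uv(3) by metis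
    moreover have "fst (h u) = fst (h v) \<or> snd (h u) = snd (h v)"
      using L(3) hQ[OF uv(1)] hQ[OF uv(2)] by auto
    moreover have "u \<in> verts G" "v \<in> verts G" using uv QS S by auto
    ultimately show ?thesis using adj by (auto simp: h_def)
  qed
  have hT: "(f u, g u) \<in> T" if "u \<in> S" for u
    using that by (auto simp: T_def h_def)
  have "(c \<circ> h) ` S \<subseteq> {..<card Q}"
    using c cardQ by (auto simp: edge_colouring_def T_def image_subset_iff)
  moreover have "(c \<circ> h) u \<noteq> (c \<circ> h) v" if uv: "u \<in> S" "v \<in> S" "u \<rightarrow>\<^bsub>G\<^esub> v" for u v
  proof
    assume eq: "(c \<circ> h) u = (c \<circ> h) v"
    have "f u = f v \<and> g u \<noteq> g v \<or> f u \<noteq> f v \<and> g u = g v"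
      using adj uv S by (metis subsetD)
    then show False
      using c eq hT[OF uv(1)] hT[OF uv(2)] unfolding edge_colouring_def h_def comp_def by metis
  qed
  ultimately show "\<exists>Q c. Q \<subseteq> S \<and> (\<forall>u \<in> Q. \<forall>v \<in> Q. u \<noteq> v \<longrightarrow> u \<rightarrow>\<^bsub>G\<^esub> v) \<and>
      c ` S \<subseteq> {..<card Q} \<and> (\<forall>u \<in> S. \<forall>v \<in> S. u \<rightarrow>\<^bsub>G\<^esub> v \<longrightarrow> c u \<noteq> (c v :: nat))"
    using QS clique by (intro exI[of _ Q] exI[of _ "c \<circ> h"]) simp
qed


section \<open>The Jacobson radical of a finite ring\<close>

context ring
begin

text \<open>Multiplication by \<open>x\<close> on the left is injective, hence surjective on the
  finite carrier. This gives a right inverse, which must agree with \<open>y\<close>.\<close>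

lemma left_inverse_imp_Units:
  assumes "finite (carrier R)" "x \<in> carrier R" "y \<in> carrier R" "y \<otimes> x = \<one>"
  shows "x \<in> Units R"
proof -
  have "inj_on ((\<otimes>) x) (carrier R)"
  proof (rule inj_onI)
    fix a b assume ab: "a \<in> carrier R" "b \<in> carrier R" "x \<otimes> a = x \<otimes> b"
    then have "(y \<otimes> x) \<otimes> a = (y \<otimes> x) \<otimes> b"
      using assms(2,3) by (simp add: m_assoc)
    with ab assms(4) show "a = b" by simp
  qed
  then have "(\<otimes>) x ` carrier R = carrier R"
    using assms(1,2) by (intro endo_inj_surj) auto
  then obtain z where z: "z \<in> carrier R" "x \<otimes> z = \<one>"
    using one_closed by (metis imageE)
  have "y = (y \<otimes> x) \<otimes> z"
    using assms(2,3) z by (simp add: m_assoc)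
  with assms z have "y = z" by simp
  with assms z show ?thesis unfolding Units_def by blast
qed

text \<open>Closure under negation comes from multiplication by
  \<open>\<ominus> \<one>\<close>.\<close>

lemma left_idealI:
  assumes "I \<subseteq> carrier R" "\<zero> \<in> I" "\<And>a b. a \<in> I \<Longrightarrow> b \<in> I \<Longrightarrow> a \<oplus> b \<in> I"
    and mult: "\<And>x a. x \<in> carrier R \<Longrightarrow> a \<in> I \<Longrightarrow> x \<otimes> a \<in> I"
  shows "left_ideal I R"
proof -
  have "\<ominus> a \<in> I" if "a \<in> I" for a
  proof -
    have a: "a \<in> carrier R" using that assms(1) by blast
    then have "\<ominus> a = (\<ominus> \<one>) \<otimes> a" by (simp add: l_minus)
    with mult[of "\<ominus> \<one>" a] that show ?thesis by simp
  qed
  then have "subgroup I (add_monoid R)"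
    using assms(1-3) by (intro add.subgroupI) auto
  then show ?thesis
    using mult by (auto simp: left_ideal_def additive_subgroup_def)
qed

lemma left_idealD:
  assumes "left_ideal I R"
  shows "I \<subseteq> carrier R" "\<zero> \<in> I" "\<And>a b. a \<in> I \<Longrightarrow> b \<in> I \<Longrightarrow> a \<oplus> b \<in> I"
    "\<And>x a. x \<in> carrier R \<Longrightarrow> a \<in> I \<Longrightarrow> x \<otimes> a \<in> I" "\<And>a b. a \<in> I \<Longrightarrow> b \<in> I \<Longrightarrow> a \<ominus> b \<in> I"
proof -
  have add: "additive_subgroup I R" and mult: "\<forall>x \<in> carrier R. \<forall>a \<in> I. x \<otimes> a \<in> I"
    using assms by (auto simp: left_ideal_def)
  show sub: "I \<subseteq> carrier R" using additive_subgroup.a_subset[OF add] .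
  show "\<zero> \<in> I" using additive_subgroup.zero_closed[OF add] .
  show plus: "a \<oplus> b \<in> I" if "a \<in> I" "b \<in> I" for a b
    using additive_subgroup.a_closed[OF add that] .
  show "x \<otimes> a \<in> I" if "x \<in> carrier R" "a \<in> I" for x a using mult that by blast
  show "a \<ominus> b \<in> I" if "a \<in> I" "b \<in> I" for a b
  proof -
    have "b \<in> carrier R" using that(2) sub by blast
    then have "\<ominus> b = (\<ominus> \<one>) \<otimes> b" by (simp add: l_minus)
    also have "\<dots> \<in> I" using mult that(2) by blast
    finally show ?thesis unfolding a_minus_def using plus[OF that(1)] by blast
  qed
qed

lemma left_ideal_eq_carrier:
  assumes "left_ideal I R" "\<one> \<in> I"
  shows "I = carrier R"
proof
  show "carrier R \<subseteq> I"
  proof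
    fix x assume x: "x \<in> carrier R"
    then have "x \<otimes> \<one> \<in> I" using left_idealD(4)[OF assms(1) _ assms(2)] by blast
    with x show "x \<in> I" by simp
  qed
qed (use left_idealD(1)[OF assms(1)] in blast)

text \<open>Used with \<open>I\<close> zero for principal left ideals and with \<open>I\<close>
  maximal for one-element enlargements.\<close>

lemma left_ideal_sum_principal:
  assumes "left_ideal I R" "c \<in> carrier R"
  shows "left_ideal {b \<otimes> c \<oplus> m |b m. b \<in> carrier R \<and> m \<in> I} R"
proof (rule left_idealI)
  note I = left_idealD[OF assms(1)]
  let ?N = "{b \<otimes> c \<oplus> m |b m. b \<in> carrier R \<and> m \<in> I}"
  show "?N \<subseteq> carrier R" using I(1) assms(2) by auto
  have "\<zero> = \<zero> \<otimes> c \<oplus> \<zero>" using assms(2) by simp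
  then show "\<zero> \<in> ?N" using I(2) by blast
  show "x \<oplus> y \<in> ?N" if xy: "x \<in> ?N" "y \<in> ?N" for x y
  proof -
    obtain b m where x: "x = b \<otimes> c \<oplus> m" "b \<in> carrier R" "m \<in> I" using xy by blast
    obtain b' m' where y: "y = b' \<otimes> c \<oplus> m'" "b' \<in> carrier R" "m' \<in> I" using xy by blast
    have "m \<in> carrier R" "m' \<in> carrier R" using x y I(1) by auto
    then have "x \<oplus> y = (b \<oplus> b') \<otimes> c \<oplus> (m \<oplus> m')"
      using x(1,2) y(1,2) assms(2) by (simp add: l_distr a_ac)
    then show ?thesis using x(2,3) y(2,3) I(3) a_closed by blast
  qed
  show "a \<otimes> x \<in> ?N" if a: "a \<in> carrier R" and x: "x \<in> ?N" for a x
  proof -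
    obtain b m where x: "x = b \<otimes> c \<oplus> m" "b \<in> carrier R" "m \<in> I" using x by blast
    have "m \<in> carrier R" using x I(1) by auto
    then have "a \<otimes> x = (a \<otimes> b) \<otimes> c \<oplus> a \<otimes> m"
      using x(1,2) a assms(2) by (simp add: r_distr m_assoc)
    then show ?thesis using x(2,3) I(4)[OF a] a m_closed by blast
  qed
qed

text \<open>Finiteness of the carrier takes the place of Zorn's lemma.\<close>

lemma exists_maximal_left_ideal:
  assumes "finite (carrier R)" "left_ideal I R" "I \<noteq> carrier R"
  shows "\<exists>M. maximal_left_ideal M R \<and> I \<subseteq> M"
proof -
  let ?S = "{J. left_ideal J R \<and> J \<noteq> carrier R}"
  have "finite ?S"
    by (rule finite_subset[of _ "Pow (carrier R)"]) (use assms(1) left_idealD(1) in auto)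
  then obtain M where M: "M \<in> ?S" "I \<subseteq> M" "\<forall>J \<in> ?S. M \<subseteq> J \<longrightarrow> M = J"
    using finite_has_maximal2[of ?S I] assms(2,3) by auto
  then have "maximal_left_ideal M R"
    unfolding maximal_left_ideal_def by auto
  with M(2) show ?thesis by blast
qed

text \<open>This is the annihilator of the nonzero element r + M of the simple module R/M. In
  elements: if \<open>J\<close> contains some \<open>l\<close> with
  \<open>l \<otimes> r \<notin> M\<close>, then R l r + M is everything, so each \<open>a\<close>
  differs from a multiple of \<open>l\<close> by an element of the annihilator.\<close>

lemma maximal_left_ideal_colon:
  assumes M: "maximal_left_ideal M R" and r: "r \<in> carrier R" "r \<notin> M"
  shows "maximal_left_ideal {a \<in> carrier R. a \<otimes> r \<in> M} R"
proof -
  let ?C = "{a \<in> carrier R. a \<otimes> r \<in> M}"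
  have Ml: "left_ideal M R" using M by (simp add: maximal_left_ideal_def)
  note Md = left_idealD[OF Ml]
  have C: "left_ideal ?C R"
    by (rule left_idealI) (use r Md in \<open>auto simp: l_distr m_assoc\<close>)
  have "\<one> \<notin> ?C" using r by simp
  then have ne: "?C \<noteq> carrier R" using one_closed by blast
  have "J = carrier R" if J: "left_ideal J R" "?C \<subseteq> J" "J \<noteq> ?C" for J
  proof -
    note Jd = left_idealD[OF J(1)]
    obtain l where l: "l \<in> J" "l \<notin> ?C" using J(2,3) by blast
    then have lc: "l \<in> carrier R" "l \<otimes> r \<notin> M" using Jd(1) by auto
    let ?N = "{b \<otimes> (l \<otimes> r) \<oplus> m |b m. b \<in> carrier R \<and> m \<in> M}"
    have N: "left_ideal ?N R" using left_ideal_sum_principal[OF Ml] lc(1) r(1) by simp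
    have "M \<subseteq> ?N"
    proof
      fix m assume m: "m \<in> M"
      then have "m = \<zero> \<otimes> (l \<otimes> r) \<oplus> m" using Md(1) lc(1) r(1) by auto
      with m show "m \<in> ?N" by blast
    qed
    moreover have "l \<otimes> r = \<one> \<otimes> (l \<otimes> r) \<oplus> \<zero>" using lc(1) r(1) by simp
    then have "l \<otimes> r \<in> ?N" using Md(2) by blast
    ultimately have Nc: "?N = carrier R" using M N lc(2) unfolding maximal_left_ideal_def by blast
    have "a \<in> J" if a: "a \<in> carrier R" for a
    proof -
      have "a \<otimes> r \<in> ?N" using Nc a r(1) by simp
      then obtain b m where bm: "a \<otimes> r = b \<otimes> (l \<otimes> r) \<oplus> m" "b \<in> carrier R" "m \<in> M" by blast
      have m: "m \<in> carrier R" using bm(3) Md(1) by blast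
      have "(a \<ominus> b \<otimes> l) \<otimes> r = a \<otimes> r \<ominus> b \<otimes> (l \<otimes> r)"
        using a bm(2) lc(1) r(1) by (simp add: a_minus_def l_distr l_minus m_assoc)
      also have "\<dots> = m"
        unfolding bm(1) using bm(2) lc(1) r(1) m by (simp add: a_minus_def a_ac r_neg2 r_neg1 r_neg)
      finally have "a \<ominus> b \<otimes> l \<in> ?C" using bm a lc(1) by simp
      then have "a \<ominus> b \<otimes> l \<oplus> b \<otimes> l \<in> J" using J(2) Jd(3) Jd(4)[OF bm(2) l(1)] by blast
      moreover have "a \<ominus> b \<otimes> l \<oplus> b \<otimes> l = a"
        using a bm(2) lc(1) by (simp add: a_minus_def a_assoc l_neg)
      ultimately show ?thesis by simp
    qed
    with Jd(1) show ?thesis by blast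
  qed
  with C ne show ?thesis unfolding maximal_left_ideal_def by blast
qed

lemma jacobson_radical_subset: "jacobson_radical R \<subseteq> carrier R"
  by (simp add: jacobson_radical_def)

lemma left_ideal_jacobson_radical: "left_ideal (jacobson_radical R) R"
proof (rule left_idealI)
  have max: "left_ideal M R" if "maximal_left_ideal M R" for M
    using that by (simp add: maximal_left_ideal_def)
  show "jacobson_radical R \<subseteq> carrier R" by (rule jacobson_radical_subset)
  show "\<zero> \<in> jacobson_radical R"
    using left_idealD(2)[OF max] by (auto simp: jacobson_radical_def)
  show "a \<oplus> b \<in> jacobson_radical R" if "a \<in> jacobson_radical R" "b \<in> jacobson_radical R" for a b
    using that left_idealD(3)[OF max] by (auto simp: jacobson_radical_def)
  show "x \<otimes> a \<in> jacobson_radical R" if "x \<in> carrier R" "a \<in> jacobson_radical R" for x a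
    using that left_idealD(4)[OF max] by (auto simp: jacobson_radical_def)
qed

text \<open>Only closure under right multiplication needs an argument: for
  \<open>x \<notin> M\<close> the elements \<open>a\<close> with
  \<open>a \<otimes> x \<in> M\<close> form a maximal left ideal, which therefore contains the
  radical.\<close>

lemma ideal_jacobson_radical: "ideal (jacobson_radical R) R"
proof (rule idealI[OF ring_axioms])
  show "subgroup (jacobson_radical R) (add_monoid R)"
    using left_ideal_jacobson_radical by (simp add: left_ideal_def additive_subgroup_def)
  fix a x assume a: "a \<in> jacobson_radical R" and x: "x \<in> carrier R"
  then have ac: "a \<in> carrier R" using jacobson_radical_subset by blast
  show "x \<otimes> a \<in> jacobson_radical R"
    using left_idealD(4)[OF left_ideal_jacobson_radical x a] .
  have "a \<otimes> x \<in> M" if M: "maximal_left_ideal M R" for M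
  proof (cases "x \<in> M")
    case True
    with M ac show ?thesis by (simp add: maximal_left_ideal_def left_ideal_def)
  next
    case False
    then have "maximal_left_ideal {a \<in> carrier R. a \<otimes> x \<in> M} R"
      using maximal_left_ideal_colon[OF M x] by blast
    with a show ?thesis by (auto simp: jacobson_radical_def)
  qed
  with ac x show "a \<otimes> x \<in> jacobson_radical R" by (simp add: jacobson_radical_def)
qed

text \<open>If the left ideal generated by \<open>y \<otimes> x\<close> were proper, a maximal left
  ideal would contain both \<open>y \<otimes> x\<close> and
  \<open>\<one> \<ominus> y \<otimes> x\<close>, hence \<open>\<one>\<close>. So \<open>x\<close>
  has a left inverse, and finiteness makes it a unit.\<close>

lemma Units_of_left_inverse_mod_radical:
  assumes fin: "finite (carrier R)" and x: "x \<in> carrier R" and y: "y \<in> carrier R"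
    and yx: "\<one> \<ominus> y \<otimes> x \<in> jacobson_radical R"
  shows "x \<in> Units R"
proof -
  have zero: "left_ideal {\<zero>} R" by (rule left_idealI) auto
  let ?N = "{b \<otimes> (y \<otimes> x) \<oplus> m |b m. b \<in> carrier R \<and> m \<in> {\<zero>}}"
  have N: "left_ideal ?N R" using left_ideal_sum_principal[OF zero] x y by simp
  have "?N = carrier R"
  proof (rule ccontr)
    assume "?N \<noteq> carrier R"
    then obtain M where M: "maximal_left_ideal M R" "?N \<subseteq> M"
      using exists_maximal_left_ideal[OF fin N] by blast
    then have Ml: "left_ideal M R" by (simp add: maximal_left_ideal_def)
    have "y \<otimes> x = \<one> \<otimes> (y \<otimes> x) \<oplus> \<zero>" using x y by simp
    then have "y \<otimes> x \<in> M" using M(2) by blast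
    moreover have "\<one> \<ominus> y \<otimes> x \<in> M" using yx M(1) by (auto simp: jacobson_radical_def)
    ultimately have "\<one> \<ominus> y \<otimes> x \<oplus> y \<otimes> x \<in> M" using left_idealD(3)[OF Ml] by blast
    moreover have "\<one> \<ominus> y \<otimes> x \<oplus> y \<otimes> x = \<one>"
      using x y by (simp add: a_minus_def a_assoc l_neg)
    ultimately have "M = carrier R" using left_ideal_eq_carrier[OF Ml] by simp
    with M(1) show False by (simp add: maximal_left_ideal_def)
  qed
  then have "\<one> \<in> ?N" by simp
  then obtain b where "b \<in> carrier R" "\<one> = b \<otimes> (y \<otimes> x) \<oplus> \<zero>" by blast
  then have "b \<otimes> y \<in> carrier R" "(b \<otimes> y) \<otimes> x = \<one>" using x y by (simp_all add: m_assoc)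
  then show ?thesis using left_inverse_imp_Units[OF fin x] by blast
qed

end

section \<open>Units under homomorphisms and modulo the radical\<close>

lemma ring_hom_Units:
  assumes "h \<in> ring_hom R S" "x \<in> Units R"
  shows "h x \<in> Units S"
proof -
  obtain y where y: "y \<in> carrier R" "x \<otimes>\<^bsub>R\<^esub> y = \<one>\<^bsub>R\<^esub>" "y \<otimes>\<^bsub>R\<^esub> x = \<one>\<^bsub>R\<^esub>" and x: "x \<in> carrier R"
    using assms(2) unfolding Units_def by blast
  then have "h x \<otimes>\<^bsub>S\<^esub> h y = \<one>\<^bsub>S\<^esub>" "h y \<otimes>\<^bsub>S\<^esub> h x = \<one>\<^bsub>S\<^esub>"
    using ring_hom_memE(2,4)[OF assms(1)] by metis+
  then show ?thesis
    unfolding Units_def using ring_hom_memE(1)[OF assms(1)] x y(1) by blast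
qed

lemma ring_iso_Units_iff:
  assumes "h \<in> ring_iso R S" "x \<in> carrier R" "ring R"
  shows "h x \<in> Units S \<longleftrightarrow> x \<in> Units R"
proof
  assume "h x \<in> Units S"
  then have "inv_into (carrier R) h (h x) \<in> Units R"
    using ring_hom_Units ring_iso_set_sym[OF assms(3,1)] by (auto simp: ring_iso_def)
  moreover have "inv_into (carrier R) h (h x) = x"
    using assms by (auto simp: ring_iso_def bij_betw_def)
  ultimately show "x \<in> Units R" by simp
qed (use assms ring_hom_Units in \<open>auto simp: ring_iso_def\<close>)

lemma Units_iff_semisimplification:
  fixes R (structure)
  assumes "ring R" "finite (carrier R)" "x \<in> carrier R"
  shows "x \<in> Units R \<longleftrightarrow> jacobson_radical R +> x \<in> Units (semisimplification R)"
proof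
  interpret ring R by fact
  interpret J: ideal "jacobson_radical R" R by (rule ideal_jacobson_radical)
  note hom = J.rcos_ring_hom
  show "jacobson_radical R +> x \<in> Units (semisimplification R)" if "x \<in> Units R"
    unfolding semisimplification_def using ring_hom_Units[OF hom that] .
  assume "jacobson_radical R +> x \<in> Units (semisimplification R)"
  then obtain Y where Y: "Y \<in> carrier (R Quot jacobson_radical R)"
    "Y \<otimes>\<^bsub>R Quot jacobson_radical R\<^esub> (jacobson_radical R +> x) = \<one>\<^bsub>R Quot jacobson_radical R\<^esub>"
    unfolding semisimplification_def Units_def by blast
  then obtain y where y: "y \<in> carrier R" "Y = jacobson_radical R +> y"
    unfolding FactRing_def A_RCOSETS_def' by auto
  then have "jacobson_radical R +> y \<otimes> x = jacobson_radical R +> \<one>"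
    using Y(2) ring_hom_memE(2)[OF hom y(1) assms(3)] ring_hom_memE(4)[OF hom] by simp
  then have "\<one> \<in> jacobson_radical R +> y \<otimes> x"
    using J.a_rcos_self[OF one_closed] by simp
  then have "\<one> \<ominus> y \<otimes> x \<in> jacobson_radical R"
    using J.a_rcos_module_imp[of "y \<otimes> x" \<one>] y(1) assms(3) by (simp add: a_minus_def)
  then show "x \<in> Units R"
    using Units_of_left_inverse_mod_radical assms(2,3) y(1) by blast
qed

text \<open>The graph arguments see the radical only through such an \<open>h\<close>: it preserves
  and reflects units, so adjacency can be read off from images in \<open>P\<close>, and surjectivity
  lifts configurations back to \<open>R\<close>.\<close>

lemma ring_hom_of_semisimplification_iso:
  fixes R (structure)
  assumes "ring R" "finite (carrier R)" "semisimplification R \<simeq> P"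
  shows "\<exists>h \<in> ring_hom R P. h ` carrier R = carrier P \<and>
    (\<forall>x \<in> carrier R. x \<in> Units R \<longleftrightarrow> h x \<in> Units P)"
proof -
  interpret ring R by fact
  interpret J: ideal "jacobson_radical R" R by (rule ideal_jacobson_radical)
  obtain f where f: "f \<in> ring_iso (semisimplification R) P"
    using assms(3) by (auto simp: is_ring_iso_def)
  have Q: "ring (semisimplification R)"
    unfolding semisimplification_def by (rule J.quotient_is_ring)
  have hom: "(+>) (jacobson_radical R) \<in> ring_hom R (semisimplification R)"
    unfolding semisimplification_def by (rule J.rcos_ring_hom)
  have surj: "(+>) (jacobson_radical R) ` carrier R = carrier (semisimplification R)"
    unfolding semisimplification_def FactRing_def A_RCOSETS_def' by auto
  show ?thesis
  proof (intro bexI[of _ "f \<circ> (+>) (jacobson_radical R)"] conjI ballI)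
    show "f \<circ> (+>) (jacobson_radical R) \<in> ring_hom R P"
      using ring_hom_trans[OF hom] f by (auto simp: ring_iso_def)
    show "(f \<circ> (+>) (jacobson_radical R)) ` carrier R = carrier P"
      unfolding image_comp[symmetric] surj using f by (auto simp: ring_iso_def bij_betw_def)
    show "x \<in> Units R \<longleftrightarrow> (f \<circ> (+>) (jacobson_radical R)) x \<in> Units P" if "x \<in> carrier R" for x
      using Units_iff_semisimplification[OF assms(1,2) that]
        ring_iso_Units_iff[OF f ring_hom_memE(1)[OF hom that] Q] by simp
  qed
qed


section \<open>Patterns of units and zero divisors\<close>

text \<open>In a nonzero ring this includes 0, which is how coinciding vertices count as
  nonadjacent.\<close>

definition left_zero_divisor :: "('a, 'm) ring_scheme \<Rightarrow> 'a \<Rightarrow> bool" where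
  "left_zero_divisor A a \<longleftrightarrow> (\<exists>b \<in> carrier A. b \<noteq> \<zero>\<^bsub>A\<^esub> \<and> a \<otimes>\<^bsub>A\<^esub> b = \<zero>\<^bsub>A\<^esub>)"

text \<open>The second set asks for zero divisors and not just for non-units because zero divisors
  survive injective homomorphisms and pass from one factor to a product.\<close>

definition difference_pattern ::
  "('a, 'm) ring_scheme \<Rightarrow> (nat \<times> nat) set \<Rightarrow> (nat \<times> nat) set \<Rightarrow> bool" where
  "difference_pattern A E N \<longleftrightarrow>
     (\<exists>v. range v \<subseteq> carrier A \<and> (\<forall>(i, j) \<in> E. v i \<ominus>\<^bsub>A\<^esub> v j \<in> Units A) \<and>
       (\<forall>(i, j) \<in> N. left_zero_divisor A (v i \<ominus>\<^bsub>A\<^esub> v j)))"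

lemma (in ring) not_Units_if_left_zero_divisor:
  assumes "left_zero_divisor R a"
  shows "a \<notin> Units R"
proof
  assume a: "a \<in> Units R"
  obtain b where b: "b \<in> carrier R" "b \<noteq> \<zero>" "a \<otimes> b = \<zero>"
    using assms by (auto simp: left_zero_divisor_def)
  have "b = inv a \<otimes> (a \<otimes> b)"
    using a b(1) Units_l_inv[OF a] by (simp add: m_assoc[symmetric] Units_closed)
  with a b show False by simp
qed

lemma ring_hom_minus:
  assumes "ring R" "ring S" "h \<in> ring_hom R S" "x \<in> carrier R" "y \<in> carrier R"
  shows "h (x \<ominus>\<^bsub>R\<^esub> y) = h x \<ominus>\<^bsub>S\<^esub> h y"
proof -
  interpret ring_hom_ring R S h
    using assms(1-3) by (intro ring_hom_ringI2)
  show ?thesis using assms(4,5) by (simp add: a_minus_def)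
qed

lemma left_zero_divisor_inj_hom:
  assumes "ring A" "ring B" "h \<in> ring_hom A B" "inj_on h (carrier A)" "a \<in> carrier A"
    "left_zero_divisor A a"
  shows "left_zero_divisor B (h a)"
proof -
  interpret ring_hom_ring A B h
    using assms(1-3) by (intro ring_hom_ringI2)
  obtain b where b: "b \<in> carrier A" "b \<noteq> \<zero>\<^bsub>A\<^esub>" "a \<otimes>\<^bsub>A\<^esub> b = \<zero>\<^bsub>A\<^esub>"
    using assms(6) by (auto simp: left_zero_divisor_def)
  have "h a \<otimes>\<^bsub>B\<^esub> h b = \<zero>\<^bsub>B\<^esub>"
    using b assms(5) by (metis hom_mult hom_zero)
  moreover have "h b \<noteq> \<zero>\<^bsub>B\<^esub>"
    using b(1,2) assms(4) by (metis hom_zero inj_onD R.zero_closed)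
  ultimately show ?thesis using b(1) by (auto simp: left_zero_divisor_def)
qed

lemma difference_pattern_inj_hom:
  assumes "ring A" "ring B" "h \<in> ring_hom A B" "inj_on h (carrier A)" "difference_pattern A E N"
  shows "difference_pattern B E N"
proof -
  obtain v where v: "range v \<subseteq> carrier A" "\<forall>(i, j) \<in> E. v i \<ominus>\<^bsub>A\<^esub> v j \<in> Units A"
    "\<forall>(i, j) \<in> N. left_zero_divisor A (v i \<ominus>\<^bsub>A\<^esub> v j)"
    using assms(5) by (auto simp: difference_pattern_def)
  have vc: "v i \<in> carrier A" for i using v(1) by blast
  have minus: "(h \<circ> v) i \<ominus>\<^bsub>B\<^esub> (h \<circ> v) j = h (v i \<ominus>\<^bsub>A\<^esub> v j)" for i j
    using ring_hom_minus[OF assms(1-3)] vc by simp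
  have "v i \<ominus>\<^bsub>A\<^esub> v j \<in> carrier A" for i j
    using vc by (simp add: ring.ring_simprules(4)[OF assms(1)] abelian_group.minus_closed[OF ring.is_abelian_group[OF assms(1)]])
  then have "range (h \<circ> v) \<subseteq> carrier B \<and> (\<forall>(i, j) \<in> E. (h \<circ> v) i \<ominus>\<^bsub>B\<^esub> (h \<circ> v) j \<in> Units B) \<and>
      (\<forall>(i, j) \<in> N. left_zero_divisor B ((h \<circ> v) i \<ominus>\<^bsub>B\<^esub> (h \<circ> v) j))"
    unfolding minus
    using v(2,3) ring_hom_Units[OF assms(3)] left_zero_divisor_inj_hom[OF assms(1-4)]
      ring_hom_memE(1)[OF assms(3) vc] by auto
  then show ?thesis unfolding difference_pattern_def by blast
qed

section \<open>Patterns in product rings\<close>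

lemma RDirProd_simps:
  "\<zero>\<^bsub>RDirProd A B\<^esub> = (\<zero>\<^bsub>A\<^esub>, \<zero>\<^bsub>B\<^esub>)" "\<one>\<^bsub>RDirProd A B\<^esub> = (\<one>\<^bsub>A\<^esub>, \<one>\<^bsub>B\<^esub>)"
  "(a, b) \<otimes>\<^bsub>RDirProd A B\<^esub> (c, d) = (a \<otimes>\<^bsub>A\<^esub> c, b \<otimes>\<^bsub>B\<^esub> d)"
  "(a, b) \<oplus>\<^bsub>RDirProd A B\<^esub> (c, d) = (a \<oplus>\<^bsub>A\<^esub> c, b \<oplus>\<^bsub>B\<^esub> d)"
  by (simp_all add: RDirProd_def DirProd_def monoid.defs)

lemma fst_ring_hom: "fst \<in> ring_hom (RDirProd A B) A"
  by (rule ring_hom_memI) (auto simp: RDirProd_simps RDirProd_carrier)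

lemma snd_ring_hom: "snd \<in> ring_hom (RDirProd A B) B"
  by (rule ring_hom_memI) (auto simp: RDirProd_simps RDirProd_carrier)

lemma RDirProd_minus:
  assumes "ring A" "ring B" "x \<in> carrier (RDirProd A B)" "y \<in> carrier (RDirProd A B)"
  shows "x \<ominus>\<^bsub>RDirProd A B\<^esub> y = (fst x \<ominus>\<^bsub>A\<^esub> fst y, snd x \<ominus>\<^bsub>B\<^esub> snd y)"
  using ring_hom_minus[OF RDirProd_ring[OF assms(1,2)] assms(1) fst_ring_hom assms(3,4)]
    ring_hom_minus[OF RDirProd_ring[OF assms(1,2)] assms(2) snd_ring_hom assms(3,4)]
  by (simp add: prod_eq_iff)

lemma Units_RDirProd:
  fixes A :: "('a, 'm) ring_scheme" and B :: "('b, 'n) ring_scheme"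
  shows "Units (RDirProd A B) = Units A \<times> Units B"
proof (rule Set.set_eqI)
  fix x :: "'a \<times> 'b"
  obtain a b where x: "x = (a, b)" by fastforce
  show "x \<in> Units (RDirProd A B) \<longleftrightarrow> x \<in> Units A \<times> Units B"
    unfolding x Units_def RDirProd_carrier
    by (simp add: RDirProd_simps) blast
qed

text \<open>Edges have to be units in both coordinates, so \<open>E\<close> is shared. A zero
  divisor in one coordinate is enough, by padding its annihilated element with 0, so the other sets
  are united.\<close>

lemma difference_pattern_RDirProd:
  assumes "ring A" "ring B" "difference_pattern A E M" "difference_pattern B E N"
  shows "difference_pattern (RDirProd A B) E (M \<union> N)"
proof -
  interpret A: ring A by fact
  interpret B: ring B by fact
  obtain v where v: "range v \<subseteq> carrier A" "\<forall>(i, j) \<in> E. v i \<ominus>\<^bsub>A\<^esub> v j \<in> Units A"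
    "\<forall>(i, j) \<in> M. left_zero_divisor A (v i \<ominus>\<^bsub>A\<^esub> v j)"
    using assms(3) by (auto simp: difference_pattern_def)
  obtain w where w: "range w \<subseteq> carrier B" "\<forall>(i, j) \<in> E. w i \<ominus>\<^bsub>B\<^esub> w j \<in> Units B"
    "\<forall>(i, j) \<in> N. left_zero_divisor B (w i \<ominus>\<^bsub>B\<^esub> w j)"
    using assms(4) by (auto simp: difference_pattern_def)
  have vc: "v i \<in> carrier A" and wc: "w i \<in> carrier B" for i
    using v(1) w(1) by auto
  let ?u = "\<lambda>i. (v i, w i)"
  have minus: "?u i \<ominus>\<^bsub>RDirProd A B\<^esub> ?u j = (v i \<ominus>\<^bsub>A\<^esub> v j, w i \<ominus>\<^bsub>B\<^esub> w j)" for i j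
    using RDirProd_minus[OF assms(1,2), of "?u i" "?u j"] vc wc by (simp add: RDirProd_carrier)
  have left: "left_zero_divisor (RDirProd A B) (a, b)"
    if zd: "left_zero_divisor A a" "b \<in> carrier B" for a b
  proof -
    obtain c where "c \<in> carrier A" "c \<noteq> \<zero>\<^bsub>A\<^esub>" "a \<otimes>\<^bsub>A\<^esub> c = \<zero>\<^bsub>A\<^esub>"
      using zd(1) by (auto simp: left_zero_divisor_def)
    then show ?thesis
      unfolding left_zero_divisor_def using zd(2)
      by (intro bexI[of _ "(c, \<zero>\<^bsub>B\<^esub>)"]) (simp_all add: RDirProd_simps RDirProd_carrier)
  qed
  have right: "left_zero_divisor (RDirProd A B) (a, b)"
    if zd: "left_zero_divisor B b" "a \<in> carrier A" for a b
  proof -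
    obtain c where "c \<in> carrier B" "c \<noteq> \<zero>\<^bsub>B\<^esub>" "b \<otimes>\<^bsub>B\<^esub> c = \<zero>\<^bsub>B\<^esub>"
      using zd(1) by (auto simp: left_zero_divisor_def)
    then show ?thesis
      unfolding left_zero_divisor_def using zd(2)
      by (intro bexI[of _ "(\<zero>\<^bsub>A\<^esub>, c)"]) (simp_all add: RDirProd_simps RDirProd_carrier)
  qed
  have "range ?u \<subseteq> carrier (RDirProd A B)"
    using vc wc by (auto simp: RDirProd_carrier)
  moreover have "\<forall>(i, j) \<in> E. ?u i \<ominus>\<^bsub>RDirProd A B\<^esub> ?u j \<in> Units (RDirProd A B)"
    using v(2) w(2) by (auto simp: minus Units_RDirProd)
  moreover have "\<forall>(i, j) \<in> M \<union> N. left_zero_divisor (RDirProd A B) (?u i \<ominus>\<^bsub>RDirProd A B\<^esub> ?u j)"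
  proof (unfold minus, clarify)
    fix i j assume ij: "(i, j) \<in> M \<union> N"
    have "v i \<ominus>\<^bsub>A\<^esub> v j \<in> carrier A" "w i \<ominus>\<^bsub>B\<^esub> w j \<in> carrier B" using vc wc by simp_all
    with ij v(3) w(3) show "left_zero_divisor (RDirProd A B) (v i \<ominus>\<^bsub>A\<^esub> v j, w i \<ominus>\<^bsub>B\<^esub> w j)"
      using left right by blast
  qed
  ultimately show ?thesis unfolding difference_pattern_def by (intro exI[of _ ?u] conjI)
qed

lemma difference_pattern_RDirProd_list:
  assumes "\<And>i. i < length Rs \<Longrightarrow> ring (Rs ! i)"
    and "\<And>i. i < length Rs \<Longrightarrow> difference_pattern (Rs ! i) E (N i)"
  shows "difference_pattern (RDirProd_list Rs) E (\<Union>i<length Rs. N i)"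
  using assms
proof (induction Rs arbitrary: N)
  case Nil
  \<comment> \<open>The empty product is the zero ring, where 0 is a unit; the empty union demands
    no zero divisors there.\<close>
  have "([] :: 'a list) \<in> Units nil_ring"
    by (auto simp: Units_def monoid.defs)
  moreover have "[] \<ominus>\<^bsub>nil_ring\<^esub> [] = ([] :: 'a list)"
    by (simp add: a_minus_def monoid.defs)
  ultimately show ?case
    by (auto simp: difference_pattern_def intro!: exI[of _ "\<lambda>_. []"])
next
  case (Cons R Rs)
  have R: "ring R" "difference_pattern R E (N 0)"
    using Cons.prems(1)[of 0] Cons.prems(2)[of 0] by simp_all
  have Rs: "ring (Rs ! i)" "difference_pattern (Rs ! i) E (N (Suc i))" if "i < length Rs" for i
    using Cons.prems(1)[of "Suc i"] Cons.prems(2)[of "Suc i"] that by simp_all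
  have list: "ring (RDirProd_list Rs)"
    using Rs(1) by (rule RDirProd_list_is_ring)
  have "difference_pattern (RDirProd R (RDirProd_list Rs)) E (N 0 \<union> (\<Union>i<length Rs. N (Suc i)))"
    using difference_pattern_RDirProd[OF R(1) list R(2) Cons.IH[OF Rs]] by blast
  moreover have "(\<Union>i<length (R # Rs). N i) = N 0 \<union> (\<Union>i<length Rs. N (Suc i))"
    by (simp add: lessThan_Suc_eq_insert_0)
  moreover have "ring (RDirProd_list (R # Rs))"
    using Cons.prems(1) by (rule RDirProd_list_is_ring)
  ultimately show ?case
    using difference_pattern_inj_hom[OF RDirProd_ring[OF R(1) list] _ RDirProd_list_hom1 inj_on_RDirProd_carrier]
    by simp
qed

text \<open>The elements 0, 1, c form a triangle of the unitary Cayley graph. Excluding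
  \<open>\<one> = \<zero>\<close> makes 0 a zero divisor.\<close>

definition has_triangle :: "('a, 'm) ring_scheme \<Rightarrow> bool" where
  "has_triangle A \<longleftrightarrow> \<one>\<^bsub>A\<^esub> \<noteq> \<zero>\<^bsub>A\<^esub> \<and> (\<exists>c \<in> Units A. c \<ominus>\<^bsub>A\<^esub> \<one>\<^bsub>A\<^esub> \<in> Units A)"

text \<open>Index \<open>i\<close> is placed at 0, 1 or c according to its colour: distinct colours
  differ by a unit, and equal colours have difference 0.\<close>

lemma (in ring) difference_pattern_of_triangle:
  assumes "has_triangle R" and \<kappa>: "\<And>i. \<kappa> i < (3 :: nat)"
    and E: "\<And>i j. (i, j) \<in> E \<Longrightarrow> \<kappa> i \<noteq> \<kappa> j" and N: "\<And>i j. (i, j) \<in> N \<Longrightarrow> \<kappa> i = \<kappa> j"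
  shows "difference_pattern R E N"
proof -
  obtain c where c: "c \<in> Units R" "c \<ominus> \<one> \<in> Units R" and one: "\<one> \<noteq> \<zero>"
    using assms(1) by (auto simp: has_triangle_def)
  have cc: "c \<in> carrier R" using c(1) by blast
  define x where "x k = (if k = (0::nat) then \<zero> else if k = 1 then \<one> else c)" for k
  have xc: "x k \<in> carrier R" for k using cc by (simp add: x_def)
  have swap: "a \<ominus> b \<in> Units R" if "b \<ominus> a \<in> Units R" "a \<in> carrier R" "b \<in> carrier R" for a b
  proof -
    have "a \<ominus> b = \<ominus> (b \<ominus> a)" using that(2,3) by (simp add: a_minus_def minus_add a_comm)
    with Units_a_inv_closed[OF that(1)] show ?thesis by simp
  qed
  have "\<one> \<ominus> \<zero> \<in> Units R" "c \<ominus> \<zero> \<in> Units R" using c cc by (simp_all add: a_minus_def)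
  then have units: "x k \<ominus> x l \<in> Units R" if "k \<noteq> l" "k < 3" "l < 3" for k l
    using that c cc swap[of \<one> \<zero>] swap[of c \<zero>] swap[of c \<one>]
    by (auto simp: x_def numeral_3_eq_3 less_Suc_eq)
  have "left_zero_divisor R (x k \<ominus> x k)" for k
    using xc one by (auto simp: left_zero_divisor_def r_neg a_minus_def intro!: bexI[of _ \<one>])
  then have "range (x \<circ> \<kappa>) \<subseteq> carrier R \<and> (\<forall>(i, j) \<in> E. (x \<circ> \<kappa>) i \<ominus> (x \<circ> \<kappa>) j \<in> Units R) \<and>
      (\<forall>(i, j) \<in> N. left_zero_divisor R ((x \<circ> \<kappa>) i \<ominus> (x \<circ> \<kappa>) j))"
    using xc units \<kappa> E N by auto
  then show ?thesis unfolding difference_pattern_def by blast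
qed

lemma has_triangle_inj_hom:
  assumes "ring A" "ring B" "h \<in> ring_hom A B" "has_triangle A" "\<one>\<^bsub>B\<^esub> \<noteq> \<zero>\<^bsub>B\<^esub>"
  shows "has_triangle B"
proof -
  obtain c where c: "c \<in> Units A" "c \<ominus>\<^bsub>A\<^esub> \<one>\<^bsub>A\<^esub> \<in> Units A"
    using assms(4) by (auto simp: has_triangle_def)
  interpret A: ring A by fact
  have "h c \<in> Units B" "h c \<ominus>\<^bsub>B\<^esub> \<one>\<^bsub>B\<^esub> \<in> Units B"
    using ring_hom_Units[OF assms(3) c(1)] ring_hom_Units[OF assms(3) c(2)]
      ring_hom_minus[OF assms(1-3), of c "\<one>\<^bsub>A\<^esub>"] ring_hom_memE(4)[OF assms(3)] A.Units_closed[OF c(1)]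
    by simp_all
  with assms(5) show ?thesis by (auto simp: has_triangle_def)
qed

lemma has_triangle_RDirProd:
  assumes "ring A" "ring B" "has_triangle A" "has_triangle B"
  shows "has_triangle (RDirProd A B)"
proof -
  interpret A: ring A by fact
  interpret B: ring B by fact
  obtain c where c: "c \<in> Units A" "c \<ominus>\<^bsub>A\<^esub> \<one>\<^bsub>A\<^esub> \<in> Units A"
    using assms(3) by (auto simp: has_triangle_def)
  obtain d where d: "d \<in> Units B" "d \<ominus>\<^bsub>B\<^esub> \<one>\<^bsub>B\<^esub> \<in> Units B"
    using assms(4) by (auto simp: has_triangle_def)
  have "(c, d) \<ominus>\<^bsub>RDirProd A B\<^esub> \<one>\<^bsub>RDirProd A B\<^esub> = (c \<ominus>\<^bsub>A\<^esub> \<one>\<^bsub>A\<^esub>, d \<ominus>\<^bsub>B\<^esub> \<one>\<^bsub>B\<^esub>)"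
    using RDirProd_minus[OF assms(1,2), of "(c, d)" "\<one>\<^bsub>RDirProd A B\<^esub>"] c(1) d(1)
    by (simp add: RDirProd_carrier RDirProd_simps A.Units_closed B.Units_closed)
  then show ?thesis
    unfolding has_triangle_def using c d assms(3)
    by (intro conjI bexI[of _ "(c, d)"]) (simp_all add: Units_RDirProd RDirProd_simps has_triangle_def)
qed

lemma (in field) has_triangle_if_card:
  assumes "finite (carrier R)" "2 < card (carrier R)"
  shows "has_triangle R"
proof -
  have "\<not> carrier R \<subseteq> {\<zero>, \<one>}"
    using assms card_mono[of "{\<zero>, \<one>}" "carrier R"] by (auto simp: card_insert_if split: if_splits)
  then obtain c where c: "c \<in> carrier R" "c \<noteq> \<zero>" "c \<noteq> \<one>" by blast
  then have "c \<ominus> \<one> \<noteq> \<zero>" by (metis one_closed r_right_minus_eq)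
  with c show ?thesis
    by (auto simp: has_triangle_def field_Units intro!: bexI[of _ c])
qed


section \<open>Matrix rings\<close>

lemma matrix_ring_carrier_iff:
  "A \<in> carrier (matrix_ring n F) \<longleftrightarrow>
     A \<in> carrier_mat n n \<and> (\<forall>i < n. \<forall>j < n. A $$ (i, j) \<in> carrier F)"
  by (fastforce simp: matrix_ring_def elements_mat_def image_subset_iff)

lemma matrix_ring_index:
  "i < n \<Longrightarrow> j < n \<Longrightarrow> (A \<otimes>\<^bsub>matrix_ring n F\<^esub> B) $$ (i, j) = (\<Oplus>\<^bsub>F\<^esub>k \<in> {..<n}. A $$ (i, k) \<otimes>\<^bsub>F\<^esub> B $$ (k, j))"
  "i < n \<Longrightarrow> j < n \<Longrightarrow> (A \<oplus>\<^bsub>matrix_ring n F\<^esub> B) $$ (i, j) = A $$ (i, j) \<oplus>\<^bsub>F\<^esub> B $$ (i, j)"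
  "i < n \<Longrightarrow> j < n \<Longrightarrow> \<one>\<^bsub>matrix_ring n F\<^esub> $$ (i, j) = (if i = j then \<one>\<^bsub>F\<^esub> else \<zero>\<^bsub>F\<^esub>)"
  "i < n \<Longrightarrow> j < n \<Longrightarrow> \<zero>\<^bsub>matrix_ring n F\<^esub> $$ (i, j) = \<zero>\<^bsub>F\<^esub>"
  by (simp_all add: matrix_ring_def)

lemma matrix_ring_dims:
  "A \<otimes>\<^bsub>matrix_ring n F\<^esub> B \<in> carrier_mat n n" "A \<oplus>\<^bsub>matrix_ring n F\<^esub> B \<in> carrier_mat n n"
  "\<one>\<^bsub>matrix_ring n F\<^esub> \<in> carrier_mat n n" "\<zero>\<^bsub>matrix_ring n F\<^esub> \<in> carrier_mat n n"
  by (simp_all add: matrix_ring_def)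

lemma carrier_mat_eqI:
  assumes "A \<in> carrier_mat n m" "B \<in> carrier_mat n m" "\<And>i j. i < n \<Longrightarrow> j < m \<Longrightarrow> A $$ (i, j) = B $$ (i, j)"
  shows "A = B"
  using assms by (intro eq_matI) auto

text \<open>Serves the associativity of the matrix product.\<close>

lemma (in abelian_monoid) finsum_swap:
  assumes "finite A" "finite B" "\<And>i j. i \<in> A \<Longrightarrow> j \<in> B \<Longrightarrow> f i j \<in> carrier G"
  shows "(\<Oplus>i \<in> A. \<Oplus>j \<in> B. f i j) = (\<Oplus>j \<in> B. \<Oplus>i \<in> A. f i j)"
  using assms(1,3)
proof (induction A)
  case (insert a A)
  have "(\<Oplus>i \<in> insert a A. \<Oplus>j \<in> B. f i j) = (\<Oplus>j \<in> B. f a j) \<oplus> (\<Oplus>j \<in> B. \<Oplus>i \<in> A. f i j)"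
    using insert by (subst finsum_insert) (auto intro!: finsum_closed)
  also have "\<dots> = (\<Oplus>j \<in> B. f a j \<oplus> (\<Oplus>i \<in> A. f i j))"
    using insert.prems by (subst finsum_addf) (auto intro!: finsum_closed)
  also have "\<dots> = (\<Oplus>j \<in> B. \<Oplus>i \<in> insert a A. f i j)"
    using insert by (intro finsum_cong') (auto intro!: finsum_closed simp: finsum_insert)
  finally show ?case .
qed simp

context ring
begin

lemma ring_matrix_ring: "ring (matrix_ring n R)"
proof (rule ringI)
  let ?M = "matrix_ring n R"
  note carr = matrix_ring_carrier_iff matrix_ring_index matrix_ring_dims
  have entry: "A $$ (i, j) \<in> carrier R" if "A \<in> carrier ?M" "i < n" "j < n" for A i j
    using that by (simp add: matrix_ring_carrier_iff)
  have dim: "A \<in> carrier_mat n n" if "A \<in> carrier ?M" for A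
    using that by (simp add: matrix_ring_carrier_iff)
  have mult_closed: "A \<otimes>\<^bsub>?M\<^esub> B \<in> carrier ?M" if "A \<in> carrier ?M" "B \<in> carrier ?M" for A B
    using entry[OF that(1)] entry[OF that(2)] by (auto simp: carr intro!: finsum_closed)
  have add_closed: "A \<oplus>\<^bsub>?M\<^esub> B \<in> carrier ?M" if "A \<in> carrier ?M" "B \<in> carrier ?M" for A B
    using entry[OF that(1)] entry[OF that(2)] by (auto simp: carr)
  show "abelian_group ?M"
  proof (rule abelian_groupI)
    fix A assume A: "A \<in> carrier ?M"
    show "\<exists>B \<in> carrier ?M. B \<oplus>\<^bsub>?M\<^esub> A = \<zero>\<^bsub>?M\<^esub>"
    proof (rule bexI)
      show "mat n n (\<lambda>(i, j). \<ominus> A $$ (i, j)) \<oplus>\<^bsub>?M\<^esub> A = \<zero>\<^bsub>?M\<^esub>"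
        by (rule carrier_mat_eqI[OF matrix_ring_dims(2,4)]) (use entry[OF A] in \<open>auto simp: carr l_neg\<close>)
      show "mat n n (\<lambda>(i, j). \<ominus> A $$ (i, j)) \<in> carrier ?M"
        using entry[OF A] by (auto simp: carr)
    qed
  next
    show "A \<oplus>\<^bsub>?M\<^esub> B \<oplus>\<^bsub>?M\<^esub> C = A \<oplus>\<^bsub>?M\<^esub> (B \<oplus>\<^bsub>?M\<^esub> C)"
      if "A \<in> carrier ?M" "B \<in> carrier ?M" "C \<in> carrier ?M" for A B C
      by (rule carrier_mat_eqI[OF matrix_ring_dims(2) matrix_ring_dims(2)])
        (use that[THEN entry] in \<open>simp add: carr a_assoc\<close>)
    show "A \<oplus>\<^bsub>?M\<^esub> B = B \<oplus>\<^bsub>?M\<^esub> A" if "A \<in> carrier ?M" "B \<in> carrier ?M" for A B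
      by (rule carrier_mat_eqI[OF matrix_ring_dims(2) matrix_ring_dims(2)])
        (use that[THEN entry] in \<open>simp add: carr a_comm\<close>)
    show "\<zero>\<^bsub>?M\<^esub> \<oplus>\<^bsub>?M\<^esub> A = A" if "A \<in> carrier ?M" for A
      by (rule carrier_mat_eqI[OF matrix_ring_dims(2) dim[OF that]])
        (use that[THEN entry] in \<open>simp add: carr\<close>)
    show "\<zero>\<^bsub>?M\<^esub> \<in> carrier ?M" by (simp add: carr)
  qed (rule add_closed)
  show "monoid ?M"
  proof (rule monoidI)
    show "\<one>\<^bsub>?M\<^esub> \<in> carrier ?M" by (simp add: carr)
    fix A assume A: "A \<in> carrier ?M"
    show "\<one>\<^bsub>?M\<^esub> \<otimes>\<^bsub>?M\<^esub> A = A"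
    proof (rule carrier_mat_eqI[OF matrix_ring_dims(1) dim[OF A]])
      fix i j assume ij: "i < n" "j < n"
      have "(\<one>\<^bsub>?M\<^esub> \<otimes>\<^bsub>?M\<^esub> A) $$ (i, j) = (\<Oplus>k \<in> {..<n}. if i = k then A $$ (k, j) else \<zero>)"
        unfolding carr(2)[OF ij] using entry[OF A] ij by (intro finsum_cong') (auto simp: carr)
      also have "\<dots> = A $$ (i, j)"
        using entry[OF A] ij by (intro add.finprod_singleton) auto
      finally show "(\<one>\<^bsub>?M\<^esub> \<otimes>\<^bsub>?M\<^esub> A) $$ (i, j) = A $$ (i, j)" .
    qed
    show "A \<otimes>\<^bsub>?M\<^esub> \<one>\<^bsub>?M\<^esub> = A"
    proof (rule carrier_mat_eqI[OF matrix_ring_dims(1) dim[OF A]])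
      fix i j assume ij: "i < n" "j < n"
      have "(A \<otimes>\<^bsub>?M\<^esub> \<one>\<^bsub>?M\<^esub>) $$ (i, j) = (\<Oplus>k \<in> {..<n}. if k = j then A $$ (i, k) else \<zero>)"
        unfolding carr(2)[OF ij] using entry[OF A] ij by (intro finsum_cong') (auto simp: carr)
      also have "\<dots> = A $$ (i, j)"
        using entry[OF A] ij by (intro add.finprod_singleton_swap) auto
      finally show "(A \<otimes>\<^bsub>?M\<^esub> \<one>\<^bsub>?M\<^esub>) $$ (i, j) = A $$ (i, j)" .
    qed
  next
    fix A B C assume ABC: "A \<in> carrier ?M" "B \<in> carrier ?M" "C \<in> carrier ?M"
    note e = ABC[THEN entry]
    show "A \<otimes>\<^bsub>?M\<^esub> B \<otimes>\<^bsub>?M\<^esub> C = A \<otimes>\<^bsub>?M\<^esub> (B \<otimes>\<^bsub>?M\<^esub> C)"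
    proof (rule carrier_mat_eqI[OF matrix_ring_dims(1) matrix_ring_dims(1)])
      fix i j assume ij: "i < n" "j < n"
      have "(A \<otimes>\<^bsub>?M\<^esub> B \<otimes>\<^bsub>?M\<^esub> C) $$ (i, j) =
          (\<Oplus>k \<in> {..<n}. \<Oplus>l \<in> {..<n}. A $$ (i, l) \<otimes> B $$ (l, k) \<otimes> C $$ (k, j))"
        unfolding carr(2)[OF ij] using e ij
        by (intro finsum_cong') (auto simp: carr finsum_ldistr intro!: finsum_closed)
      also have "\<dots> = (\<Oplus>l \<in> {..<n}. \<Oplus>k \<in> {..<n}. A $$ (i, l) \<otimes> B $$ (l, k) \<otimes> C $$ (k, j))"
        using e ij by (intro finsum_swap) auto
      also have "\<dots> = (A \<otimes>\<^bsub>?M\<^esub> (B \<otimes>\<^bsub>?M\<^esub> C)) $$ (i, j)"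
        unfolding carr(2)[OF ij] using e ij
        by (intro finsum_cong') (auto simp: carr finsum_rdistr m_assoc Pi_def intro!: finsum_closed finsum_cong')
      finally show "(A \<otimes>\<^bsub>?M\<^esub> B \<otimes>\<^bsub>?M\<^esub> C) $$ (i, j) = (A \<otimes>\<^bsub>?M\<^esub> (B \<otimes>\<^bsub>?M\<^esub> C)) $$ (i, j)" .
    qed
  qed (rule mult_closed)
  fix A B C assume ABC: "A \<in> carrier ?M" "B \<in> carrier ?M" "C \<in> carrier ?M"
  note e = ABC[THEN entry]
  show "(A \<oplus>\<^bsub>?M\<^esub> B) \<otimes>\<^bsub>?M\<^esub> C = A \<otimes>\<^bsub>?M\<^esub> C \<oplus>\<^bsub>?M\<^esub> B \<otimes>\<^bsub>?M\<^esub> C"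
  proof (rule carrier_mat_eqI[OF matrix_ring_dims(1) matrix_ring_dims(2)])
    fix i j assume ij: "i < n" "j < n"
    have "((A \<oplus>\<^bsub>?M\<^esub> B) \<otimes>\<^bsub>?M\<^esub> C) $$ (i, j) =
        (\<Oplus>k \<in> {..<n}. A $$ (i, k) \<otimes> C $$ (k, j) \<oplus> B $$ (i, k) \<otimes> C $$ (k, j))"
      unfolding carr(2)[OF ij] using e ij by (intro finsum_cong') (auto simp: carr l_distr)
    also have "\<dots> = (A \<otimes>\<^bsub>?M\<^esub> C \<oplus>\<^bsub>?M\<^esub> B \<otimes>\<^bsub>?M\<^esub> C) $$ (i, j)"
      unfolding carr(3)[OF ij] carr(2)[OF ij] using e ij by (intro finsum_addf) auto
    finally show "((A \<oplus>\<^bsub>?M\<^esub> B) \<otimes>\<^bsub>?M\<^esub> C) $$ (i, j) = (A \<otimes>\<^bsub>?M\<^esub> C \<oplus>\<^bsub>?M\<^esub> B \<otimes>\<^bsub>?M\<^esub> C) $$ (i, j)" .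
  qed
  show "C \<otimes>\<^bsub>?M\<^esub> (A \<oplus>\<^bsub>?M\<^esub> B) = C \<otimes>\<^bsub>?M\<^esub> A \<oplus>\<^bsub>?M\<^esub> C \<otimes>\<^bsub>?M\<^esub> B"
  proof (rule carrier_mat_eqI[OF matrix_ring_dims(1) matrix_ring_dims(2)])
    fix i j assume ij: "i < n" "j < n"
    have "(C \<otimes>\<^bsub>?M\<^esub> (A \<oplus>\<^bsub>?M\<^esub> B)) $$ (i, j) =
        (\<Oplus>k \<in> {..<n}. C $$ (i, k) \<otimes> A $$ (k, j) \<oplus> C $$ (i, k) \<otimes> B $$ (k, j))"
      unfolding carr(2)[OF ij] using e ij by (intro finsum_cong') (auto simp: carr r_distr)
    also have "\<dots> = (C \<otimes>\<^bsub>?M\<^esub> A \<oplus>\<^bsub>?M\<^esub> C \<otimes>\<^bsub>?M\<^esub> B) $$ (i, j)"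
      unfolding carr(3)[OF ij] carr(2)[OF ij] using e ij by (intro finsum_addf) auto
    finally show "(C \<otimes>\<^bsub>?M\<^esub> (A \<oplus>\<^bsub>?M\<^esub> B)) $$ (i, j) = (C \<otimes>\<^bsub>?M\<^esub> A \<oplus>\<^bsub>?M\<^esub> C \<otimes>\<^bsub>?M\<^esub> B) $$ (i, j)" .
  qed
qed

text \<open>The record gives no entrywise negation, so the entries of a negative are recovered from
  uniqueness of additive inverses.\<close>

lemma matrix_ring_minus_index:
  assumes "A \<in> carrier (matrix_ring n R)" "B \<in> carrier (matrix_ring n R)" "i < n" "j < n"
  shows "(A \<ominus>\<^bsub>matrix_ring n R\<^esub> B) $$ (i, j) = A $$ (i, j) \<ominus> B $$ (i, j)"
proof -
  interpret M: ring "matrix_ring n R" by (rule ring_matrix_ring)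
  have e: "A $$ (i, j) \<in> carrier R" "B $$ (i, j) \<in> carrier R"
    "(\<ominus>\<^bsub>matrix_ring n R\<^esub> B) $$ (i, j) \<in> carrier R"
    using assms M.a_inv_closed[OF assms(2)] by (auto simp: matrix_ring_carrier_iff)
  have "B \<oplus>\<^bsub>matrix_ring n R\<^esub> \<ominus>\<^bsub>matrix_ring n R\<^esub> B = \<zero>\<^bsub>matrix_ring n R\<^esub>"
    using assms(2) by (rule M.r_neg)
  then have "B $$ (i, j) \<oplus> (\<ominus>\<^bsub>matrix_ring n R\<^esub> B) $$ (i, j) = \<zero>"
    using matrix_ring_index(2,4)[OF assms(3,4), of R] by metis
  then have "(\<ominus>\<^bsub>matrix_ring n R\<^esub> B) $$ (i, j) = \<ominus> B $$ (i, j)"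
    using e by (metis a_comm minus_equality)
  then show ?thesis
    using assms(3,4) by (simp add: a_minus_def matrix_ring_index)
qed

section \<open>Block diagonal embeddings\<close>

definition block_diag :: "nat \<Rightarrow> nat \<Rightarrow> 'a mat \<times> 'a mat \<Rightarrow> 'a mat" where
  "block_diag m n P = mat (m + n) (m + n) (\<lambda>(i, j).
     if i < m \<and> j < m then fst P $$ (i, j)
     else if m \<le> i \<and> m \<le> j then snd P $$ (i - m, j - m) else \<zero>)"

lemma finsum_lessThan_add:
  fixes m n :: nat
  assumes "\<And>k. k < m + n \<Longrightarrow> f k \<in> carrier R"
  shows "(\<Oplus>k \<in> {..<m + n}. f k) = (\<Oplus>k \<in> {..<m}. f k) \<oplus> (\<Oplus>k \<in> {..<n}. f (m + k))"
proof -
  have split: "{..<m + n} = {..<m} \<union> (+) m ` {..<n}"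
  proof (intro equalityI subsetI)
    fix k assume k: "k \<in> {..<m + n}"
    show "k \<in> {..<m} \<union> (+) m ` {..<n}"
    proof (cases "k < m")
      case False
      then have "k = m + (k - m)" "k - m < n" using k by auto
      then show ?thesis by blast
    qed simp
  qed auto
  have "(\<Oplus>k \<in> {..<m + n}. f k) = (\<Oplus>k \<in> {..<m}. f k) \<oplus> (\<Oplus>k \<in> (+) m ` {..<n}. f k)"
    unfolding split using assms by (intro finsum_Un_disjoint) auto
  also have "(\<Oplus>k \<in> (+) m ` {..<n}. f k) = (\<Oplus>k \<in> {..<n}. f (m + k))"
    using assms by (intro finsum_reindex) auto
  finally show ?thesis .
qed

text \<open>Lets patterns found in two smaller matrix rings be combined in one larger one. The sum
  over \<open>m + n\<close> indices splits at \<open>m\<close>, and each part is a product inside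
  one block or vanishes.\<close>

lemma block_diag_ring_hom:
  "block_diag m n \<in> ring_hom (RDirProd (matrix_ring m R) (matrix_ring n R)) (matrix_ring (m + n) R)"
proof (rule ring_hom_memI)
  let ?A = "matrix_ring m R" and ?B = "matrix_ring n R" and ?C = "matrix_ring (m + n) R"
  note carr = matrix_ring_carrier_iff matrix_ring_index matrix_ring_dims
  have dim: "block_diag m n P \<in> carrier_mat (m + n) (m + n)" for P
    by (simp add: block_diag_def)
  have index: "block_diag m n P $$ (i, j) = (if i < m \<and> j < m then fst P $$ (i, j)
     else if m \<le> i \<and> m \<le> j then snd P $$ (i - m, j - m) else \<zero>)"
    if "i < m + n" "j < m + n" for P i j
    using that by (simp add: block_diag_def)
  show closed: "block_diag m n P \<in> carrier ?C" if "P \<in> carrier (RDirProd ?A ?B)" for P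
    using that dim by (auto simp: carr index RDirProd_carrier)
  show "block_diag m n \<one>\<^bsub>RDirProd ?A ?B\<^esub> = \<one>\<^bsub>?C\<^esub>"
    by (rule carrier_mat_eqI[OF dim matrix_ring_dims(3)])
      (auto simp: index carr RDirProd_simps)
  fix P Q assume P: "P \<in> carrier (RDirProd ?A ?B)" and Q: "Q \<in> carrier (RDirProd ?A ?B)"
  obtain a b where Pab: "P = (a, b)" by fastforce
  obtain c d where Qcd: "Q = (c, d)" by fastforce
  have abcd: "a \<in> carrier ?A" "b \<in> carrier ?B" "c \<in> carrier ?A" "d \<in> carrier ?B"
    using P Q by (auto simp: Pab Qcd RDirProd_carrier)
  have e: "i < m \<Longrightarrow> j < m \<Longrightarrow> a $$ (i, j) \<in> carrier R" "i < n \<Longrightarrow> j < n \<Longrightarrow> b $$ (i, j) \<in> carrier R"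
    "i < m \<Longrightarrow> j < m \<Longrightarrow> c $$ (i, j) \<in> carrier R" "i < n \<Longrightarrow> j < n \<Longrightarrow> d $$ (i, j) \<in> carrier R" for i j
    using abcd by (auto simp: carr(1))
  show "block_diag m n (P \<oplus>\<^bsub>RDirProd ?A ?B\<^esub> Q) = block_diag m n P \<oplus>\<^bsub>?C\<^esub> block_diag m n Q"
    by (rule carrier_mat_eqI[OF dim matrix_ring_dims(2)])
      (auto simp: index carr Pab Qcd RDirProd_simps)
  show "block_diag m n (P \<otimes>\<^bsub>RDirProd ?A ?B\<^esub> Q) = block_diag m n P \<otimes>\<^bsub>?C\<^esub> block_diag m n Q"
  proof (rule carrier_mat_eqI[OF dim matrix_ring_dims(1)])
    fix i j assume ij: "i < m + n" "j < m + n"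
    let ?f = "\<lambda>k. block_diag m n P $$ (i, k) \<otimes> block_diag m n Q $$ (k, j)"
    have fc: "?f k \<in> carrier R" if "k < m + n" for k
      using closed[OF P] closed[OF Q] ij that by (auto simp: carr(1))
    have rhs: "(block_diag m n P \<otimes>\<^bsub>?C\<^esub> block_diag m n Q) $$ (i, j) =
        (\<Oplus>k \<in> {..<m}. ?f k) \<oplus> (\<Oplus>k \<in> {..<n}. ?f (m + k))"
      unfolding carr(2)[OF ij] using fc by (intro finsum_lessThan_add)
    have top: "(\<Oplus>k \<in> {..<m}. ?f k) = (if i < m \<and> j < m then (a \<otimes>\<^bsub>?A\<^esub> c) $$ (i, j) else \<zero>)"
    proof (cases "i < m \<and> j < m")
      case True
      then have "(\<Oplus>k \<in> {..<m}. ?f k) = (\<Oplus>k \<in> {..<m}. a $$ (i, k) \<otimes> c $$ (k, j))"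
        using e by (intro finsum_cong') (auto simp: index Pab Qcd)
      with True show ?thesis by (simp add: carr)
    next
      case False
      then have "?f k = \<zero>" if "k < m" for k
        using that ij e closed[OF P] closed[OF Q] by (auto simp: index Pab Qcd)
      then show ?thesis using False by (auto intro: add.finprod_one_eqI)
    qed
    have bot: "(\<Oplus>k \<in> {..<n}. ?f (m + k)) =
        (if m \<le> i \<and> m \<le> j then (b \<otimes>\<^bsub>?B\<^esub> d) $$ (i - m, j - m) else \<zero>)"
    proof (cases "m \<le> i \<and> m \<le> j")
      case True
      then have ij': "i - m < n" "j - m < n" using ij by auto
      have "(\<Oplus>k \<in> {..<n}. ?f (m + k)) = (\<Oplus>k \<in> {..<n}. b $$ (i - m, k) \<otimes> d $$ (k, j - m))"
        using e True ij ij' by (intro finsum_cong') (auto simp: index Pab Qcd)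
      with True ij' show ?thesis by (simp add: carr)
    next
      case False
      then have "?f (m + k) = \<zero>" if "k < n" for k
        using that ij e by (auto simp: index Pab Qcd)
      then show ?thesis using False by (auto intro: add.finprod_one_eqI)
    qed
    have "(a \<otimes>\<^bsub>?A\<^esub> c) $$ (i, j) \<in> carrier R" if "i < m" "j < m"
      unfolding carr(2)[OF that] using e that by (auto intro!: finsum_closed)
    moreover have "(b \<otimes>\<^bsub>?B\<^esub> d) $$ (i - m, j - m) \<in> carrier R" if "m \<le> i" "m \<le> j"
    proof -
      have ij': "i - m < n" "j - m < n" using that ij by auto
      show ?thesis unfolding carr(2)[OF ij'] using e ij' by (auto intro!: finsum_closed)
    qed
    ultimately show "block_diag m n (P \<otimes>\<^bsub>RDirProd ?A ?B\<^esub> Q) $$ (i, j) =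
        (block_diag m n P \<otimes>\<^bsub>?C\<^esub> block_diag m n Q) $$ (i, j)"
      unfolding rhs top bot index[OF ij] by (auto simp: Pab Qcd RDirProd_simps)
  qed
qed

lemma inj_on_block_diag:
  "inj_on (block_diag m n) (carrier (RDirProd (matrix_ring m R) (matrix_ring n R)))"
proof (rule inj_onI)
  fix P Q assume PQ: "P \<in> carrier (RDirProd (matrix_ring m R) (matrix_ring n R))"
    "Q \<in> carrier (RDirProd (matrix_ring m R) (matrix_ring n R))"
    and eq: "block_diag m n P = block_diag m n Q"
  have "fst P $$ (i, j) = fst Q $$ (i, j)" if "i < m" "j < m" for i j
  proof -
    have "block_diag m n P $$ (i, j) = block_diag m n Q $$ (i, j)" using eq by simp
    with that show ?thesis by (simp add: block_diag_def)
  qed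
  moreover have "snd P $$ (i, j) = snd Q $$ (i, j)" if "i < n" "j < n" for i j
  proof -
    have "block_diag m n P $$ (m + i, m + j) = block_diag m n Q $$ (m + i, m + j)" using eq by simp
    with that show ?thesis by (simp add: block_diag_def)
  qed
  ultimately show "P = Q"
    using PQ by (intro prod_eqI carrier_mat_eqI[of _ m m] carrier_mat_eqI[of _ n n])
      (auto simp: RDirProd_carrier matrix_ring_carrier_iff)
qed

end


section \<open>Pentagons in matrix rings\<close>

text \<open>One orientation of each pair suffices, since adjacency is symmetric.\<close>

definition pentagon :: "(nat \<times> nat) set" where
  "pentagon = {(0, 1), (1, 2), (2, 3), (3, 4), (4, 0)}"

text \<open>The pentagram 0, 2, 4, 1, 3, again with one orientation per pair.\<close>

definition diagonals :: "(nat \<times> nat) set" where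
  "diagonals = {(0, 2), (2, 4), (4, 1), (1, 3), (3, 0)}"

definition mat2 :: "'a \<Rightarrow> 'a \<Rightarrow> 'a \<Rightarrow> 'a \<Rightarrow> 'a mat" where
  "mat2 a b c d = mat 2 2 (\<lambda>(i, j). [[a, b], [c, d]] ! i ! j)"

definition mat3 :: "'a \<Rightarrow> 'a \<Rightarrow> 'a \<Rightarrow> 'a \<Rightarrow> 'a \<Rightarrow> 'a \<Rightarrow> 'a \<Rightarrow> 'a \<Rightarrow> 'a \<Rightarrow> 'a mat" where
  "mat3 a b c d e f g h i = mat 3 3 (\<lambda>(r, s). [[a, b, c], [d, e, f], [g, h, i]] ! r ! s)"

lemma mat2_index [simp]:
  "mat2 a b c d $$ (0, 0) = a" "mat2 a b c d $$ (0, Suc 0) = b"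
  "mat2 a b c d $$ (Suc 0, 0) = c" "mat2 a b c d $$ (Suc 0, Suc 0) = d"
  by (simp_all add: mat2_def)

lemma mat3_index [simp]:
  "mat3 a b c d e f g h i $$ (0, 0) = a" "mat3 a b c d e f g h i $$ (0, Suc 0) = b"
  "mat3 a b c d e f g h i $$ (0, 2) = c" "mat3 a b c d e f g h i $$ (Suc 0, 0) = d"
  "mat3 a b c d e f g h i $$ (Suc 0, Suc 0) = e" "mat3 a b c d e f g h i $$ (Suc 0, 2) = f"
  "mat3 a b c d e f g h i $$ (2, 0) = g" "mat3 a b c d e f g h i $$ (2, Suc 0) = h"
  "mat3 a b c d e f g h i $$ (2, 2) = i"
  by (simp_all add: mat3_def numeral_2_eq_2)

lemma mat2_dim: "mat2 a b c d \<in> carrier_mat 2 2"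
  by (simp add: mat2_def)

lemma mat3_dim: "mat3 a b c d e f g h i \<in> carrier_mat 3 3"
  by (simp add: mat3_def)

lemma less_3_cases: "n < 3 \<Longrightarrow> n = 0 \<or> n = Suc 0 \<or> n = (2 :: nat)"
  by linarith

lemma mat2_eqI:
  assumes "A \<in> carrier_mat 2 2" "A $$ (0, 0) = a" "A $$ (0, Suc 0) = b" "A $$ (Suc 0, 0) = c"
    "A $$ (Suc 0, Suc 0) = d"
  shows "A = mat2 a b c d"
  by (rule carrier_mat_eqI[OF assms(1) mat2_dim]) (use assms in \<open>auto dest!: less_2_cases\<close>)

lemma mat3_eqI:
  assumes "A \<in> carrier_mat 3 3" "A $$ (0, 0) = a" "A $$ (0, Suc 0) = b" "A $$ (0, 2) = c"
    "A $$ (Suc 0, 0) = d" "A $$ (Suc 0, Suc 0) = e" "A $$ (Suc 0, 2) = f"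
    "A $$ (2, 0) = g" "A $$ (2, Suc 0) = h" "A $$ (2, 2) = i"
  shows "A = mat3 a b c d e f g h i"
  by (rule carrier_mat_eqI[OF assms(1) mat3_dim]) (use assms in \<open>auto dest!: less_3_cases\<close>)

lemma mat2_carrier_iff:
  "mat2 a b c d \<in> carrier (matrix_ring 2 F) \<longleftrightarrow> {a, b, c, d} \<subseteq> carrier F"
proof -
  have "(\<forall>i < 2. P i) \<longleftrightarrow> P 0 \<and> P (Suc 0)" for P :: "nat \<Rightarrow> bool"
    by (auto dest!: less_2_cases)
  then show ?thesis by (simp add: matrix_ring_carrier_iff mat2_dim)
qed

lemma mat3_carrier_iff:
  "mat3 a b c d e f g h i \<in> carrier (matrix_ring 3 F) \<longleftrightarrow> {a, b, c, d, e, f, g, h, i} \<subseteq> carrier F"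
proof -
  have "(\<forall>i < 3. P i) \<longleftrightarrow> P 0 \<and> P (Suc 0) \<and> P 2" for P :: "nat \<Rightarrow> bool"
    by (auto dest!: less_3_cases)
  then show ?thesis by (simp add: matrix_ring_carrier_iff mat3_dim)
qed

lemma matrix_ring_2_consts:
  "\<one>\<^bsub>matrix_ring 2 F\<^esub> = mat2 \<one>\<^bsub>F\<^esub> \<zero>\<^bsub>F\<^esub> \<zero>\<^bsub>F\<^esub> \<one>\<^bsub>F\<^esub>"
  "\<zero>\<^bsub>matrix_ring 2 F\<^esub> = mat2 \<zero>\<^bsub>F\<^esub> \<zero>\<^bsub>F\<^esub> \<zero>\<^bsub>F\<^esub> \<zero>\<^bsub>F\<^esub>"
  by (rule mat2_eqI; simp add: matrix_ring_dims matrix_ring_index)+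

lemma matrix_ring_3_consts:
  "\<one>\<^bsub>matrix_ring 3 F\<^esub> = mat3 \<one>\<^bsub>F\<^esub> \<zero>\<^bsub>F\<^esub> \<zero>\<^bsub>F\<^esub> \<zero>\<^bsub>F\<^esub> \<one>\<^bsub>F\<^esub> \<zero>\<^bsub>F\<^esub> \<zero>\<^bsub>F\<^esub> \<zero>\<^bsub>F\<^esub> \<one>\<^bsub>F\<^esub>"
  "\<zero>\<^bsub>matrix_ring 3 F\<^esub> = mat3 \<zero>\<^bsub>F\<^esub> \<zero>\<^bsub>F\<^esub> \<zero>\<^bsub>F\<^esub> \<zero>\<^bsub>F\<^esub> \<zero>\<^bsub>F\<^esub> \<zero>\<^bsub>F\<^esub> \<zero>\<^bsub>F\<^esub> \<zero>\<^bsub>F\<^esub> \<zero>\<^bsub>F\<^esub>"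
  by (rule mat3_eqI; simp add: matrix_ring_dims matrix_ring_index)+

lemma mat2_eq_iff: "mat2 a b c d = mat2 a' b' c' d' \<longleftrightarrow> a = a' \<and> b = b' \<and> c = c' \<and> d = d'"
  by (metis mat2_index)

lemma mat3_eq_iff:
  "mat3 a b c d e f g h i = mat3 a' b' c' d' e' f' g' h' i' \<longleftrightarrow>
     a = a' \<and> b = b' \<and> c = c' \<and> d = d' \<and> e = e' \<and> f = f' \<and> g = g' \<and> h = h' \<and> i = i'"
  by (metis mat3_index)

context ring
begin

lemma mat2_mult:
  assumes "{a, b, c, d} \<subseteq> carrier R" "{a', b', c', d'} \<subseteq> carrier R"
  shows "mat2 a b c d \<otimes>\<^bsub>matrix_ring 2 R\<^esub> mat2 a' b' c' d' =
    mat2 (a \<otimes> a' \<oplus> b \<otimes> c') (a \<otimes> b' \<oplus> b \<otimes> d') (c \<otimes> a' \<oplus> d \<otimes> c') (c \<otimes> b' \<oplus> d \<otimes> d')"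
proof -
  have set: "{..<2} = {0, Suc 0}" by auto
  show ?thesis
    by (rule mat2_eqI) (use assms in \<open>simp_all add: matrix_ring_dims matrix_ring_index set finsum_insert finsum_empty\<close>)
qed

lemma mat3_mult:
  assumes "{a, b, c, d, e, f, g, h, i} \<subseteq> carrier R" "{a', b', c', d', e', f', g', h', i'} \<subseteq> carrier R"
  shows "mat3 a b c d e f g h i \<otimes>\<^bsub>matrix_ring 3 R\<^esub> mat3 a' b' c' d' e' f' g' h' i' =
    mat3 (a \<otimes> a' \<oplus> (b \<otimes> d' \<oplus> c \<otimes> g')) (a \<otimes> b' \<oplus> (b \<otimes> e' \<oplus> c \<otimes> h')) (a \<otimes> c' \<oplus> (b \<otimes> f' \<oplus> c \<otimes> i'))
      (d \<otimes> a' \<oplus> (e \<otimes> d' \<oplus> f \<otimes> g')) (d \<otimes> b' \<oplus> (e \<otimes> e' \<oplus> f \<otimes> h')) (d \<otimes> c' \<oplus> (e \<otimes> f' \<oplus> f \<otimes> i'))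
      (g \<otimes> a' \<oplus> (h \<otimes> d' \<oplus> i \<otimes> g')) (g \<otimes> b' \<oplus> (h \<otimes> e' \<oplus> i \<otimes> h')) (g \<otimes> c' \<oplus> (h \<otimes> f' \<oplus> i \<otimes> i'))"
proof -
  have set: "{..<3} = {0, Suc 0, 2}" by auto
  show ?thesis
    by (rule mat3_eqI) (use assms in \<open>simp_all add: matrix_ring_dims matrix_ring_index set finsum_insert finsum_empty\<close>)
qed

lemma mat2_minus:
  assumes "{a, b, c, d} \<subseteq> carrier R" "{a', b', c', d'} \<subseteq> carrier R"
  shows "mat2 a b c d \<ominus>\<^bsub>matrix_ring 2 R\<^esub> mat2 a' b' c' d' = mat2 (a \<ominus> a') (b \<ominus> b') (c \<ominus> c') (d \<ominus> d')"
proof (rule mat2_eqI)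
  interpret M: ring "matrix_ring 2 R" by (rule ring_matrix_ring)
  have c: "mat2 a b c d \<in> carrier (matrix_ring 2 R)" "mat2 a' b' c' d' \<in> carrier (matrix_ring 2 R)"
    using assms by (simp_all add: mat2_carrier_iff)
  show "mat2 a b c d \<ominus>\<^bsub>matrix_ring 2 R\<^esub> mat2 a' b' c' d' \<in> carrier_mat 2 2"
    using M.minus_closed[OF c] matrix_ring_carrier_iff by blast
qed (use assms in \<open>simp_all add: matrix_ring_minus_index mat2_carrier_iff\<close>)

lemma mat3_minus:
  assumes "{a, b, c, d, e, f, g, h, i} \<subseteq> carrier R" "{a', b', c', d', e', f', g', h', i'} \<subseteq> carrier R"
  shows "mat3 a b c d e f g h i \<ominus>\<^bsub>matrix_ring 3 R\<^esub> mat3 a' b' c' d' e' f' g' h' i' =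
    mat3 (a \<ominus> a') (b \<ominus> b') (c \<ominus> c') (d \<ominus> d') (e \<ominus> e') (f \<ominus> f') (g \<ominus> g') (h \<ominus> h') (i \<ominus> i')"
proof (rule mat3_eqI)
  interpret M: ring "matrix_ring 3 R" by (rule ring_matrix_ring)
  have c: "mat3 a b c d e f g h i \<in> carrier (matrix_ring 3 R)" "mat3 a' b' c' d' e' f' g' h' i' \<in> carrier (matrix_ring 3 R)"
    using assms by (simp_all add: mat3_carrier_iff)
  show "mat3 a b c d e f g h i \<ominus>\<^bsub>matrix_ring 3 R\<^esub> mat3 a' b' c' d' e' f' g' h' i' \<in> carrier_mat 3 3"
    using M.minus_closed[OF c] matrix_ring_carrier_iff by blast
qed (use assms in \<open>simp_all add: matrix_ring_minus_index mat3_carrier_iff\<close>)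

end

lemma mult_one_imp_Units:
  "\<lbrakk>x \<in> carrier G; y \<in> carrier G; x \<otimes>\<^bsub>G\<^esub> y = \<one>\<^bsub>G\<^esub>; y \<otimes>\<^bsub>G\<^esub> x = \<one>\<^bsub>G\<^esub>\<rbrakk> \<Longrightarrow> x \<in> Units G"
  by (auto simp: Units_def)

section \<open>Explicit configurations over a field\<close>

context field
begin

lemma mat2_in_Units:
  assumes "{a, b, c, d} \<subseteq> carrier R" "a \<otimes> d \<ominus> b \<otimes> c \<noteq> \<zero>"
  shows "mat2 a b c d \<in> Units (matrix_ring 2 R)"
proof -
  have abcd: "a \<in> carrier R" "b \<in> carrier R" "c \<in> carrier R" "d \<in> carrier R"
    using assms(1) by auto
  let ?D = "a \<otimes> d \<ominus> b \<otimes> c"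
  have D: "?D \<in> Units R" using assms(2) abcd by (simp add: field_Units)
  let ?u = "inv ?D"
  have u: "?u \<in> carrier R" using D by simp
  have uD: "?u \<otimes> ?D = \<one>" using D by simp
  let ?Y = "mat2 (?u \<otimes> d) (\<ominus> (?u \<otimes> b)) (\<ominus> (?u \<otimes> c)) (?u \<otimes> a)"
  have Y: "{?u \<otimes> d, \<ominus> (?u \<otimes> b), \<ominus> (?u \<otimes> c), ?u \<otimes> a} \<subseteq> carrier R" using abcd u by simp
  \<comment> \<open>A variable \<open>w\<close> in place of the inverse determinant leaves
    polynomial identities for the adjugate; the inverse enters only through
    \<open>uD\<close>.\<close>
  have eqs: "a \<otimes> (w \<otimes> d) \<oplus> b \<otimes> \<ominus> (w \<otimes> c) = w \<otimes> ?D" "a \<otimes> \<ominus> (w \<otimes> b) \<oplus> b \<otimes> (w \<otimes> a) = \<zero>"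
    "c \<otimes> (w \<otimes> d) \<oplus> d \<otimes> \<ominus> (w \<otimes> c) = \<zero>" "c \<otimes> \<ominus> (w \<otimes> b) \<oplus> d \<otimes> (w \<otimes> a) = w \<otimes> ?D"
    "w \<otimes> d \<otimes> a \<oplus> \<ominus> (w \<otimes> b) \<otimes> c = w \<otimes> ?D" "w \<otimes> d \<otimes> b \<oplus> \<ominus> (w \<otimes> b) \<otimes> d = \<zero>"
    "\<ominus> (w \<otimes> c) \<otimes> a \<oplus> w \<otimes> a \<otimes> c = \<zero>" "\<ominus> (w \<otimes> c) \<otimes> b \<oplus> w \<otimes> a \<otimes> d = w \<otimes> ?D"
    if "w \<in> carrier R" for w
    using abcd that by algebra+
  show ?thesis
  proof (rule mult_one_imp_Units[of _ _ ?Y])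
    show "mat2 a b c d \<otimes>\<^bsub>matrix_ring 2 R\<^esub> ?Y = \<one>\<^bsub>matrix_ring 2 R\<^esub>"
      unfolding mat2_mult[OF assms(1) Y] eqs[OF u] uD matrix_ring_2_consts ..
    show "?Y \<otimes>\<^bsub>matrix_ring 2 R\<^esub> mat2 a b c d = \<one>\<^bsub>matrix_ring 2 R\<^esub>"
      unfolding mat2_mult[OF Y assms(1)] eqs[OF u] uD matrix_ring_2_consts ..
  qed (use assms(1) Y in \<open>simp_all only: mat2_carrier_iff\<close>)
qed

text \<open>A singular matrix is annihilated by its adjugate, which is nonzero unless the matrix is
  zero.\<close>

lemma mat2_left_zero_divisor:
  assumes "{a, b, c, d} \<subseteq> carrier R" "a \<otimes> d \<ominus> b \<otimes> c = \<zero>"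
  shows "left_zero_divisor (matrix_ring 2 R) (mat2 a b c d)"
proof -
  have abcd: "a \<in> carrier R" "b \<in> carrier R" "c \<in> carrier R" "d \<in> carrier R"
    using assms(1) by auto
  show ?thesis
  proof (cases "a = \<zero> \<and> b = \<zero> \<and> c = \<zero> \<and> d = \<zero>")
    case True
    then show ?thesis
      unfolding left_zero_divisor_def
      by (intro bexI[of _ "mat2 \<one> \<one> \<one> \<one>"])
        (simp_all add: mat2_mult mat2_carrier_iff matrix_ring_2_consts mat2_eq_iff)
  next
    case False
    have eqs: "a \<otimes> d \<oplus> b \<otimes> \<ominus> c = a \<otimes> d \<ominus> b \<otimes> c" "a \<otimes> \<ominus> b \<oplus> b \<otimes> a = \<zero>"
      "c \<otimes> d \<oplus> d \<otimes> \<ominus> c = \<zero>" "c \<otimes> \<ominus> b \<oplus> d \<otimes> a = a \<otimes> d \<ominus> b \<otimes> c"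
      using abcd by algebra+
    have Y: "{d, \<ominus> b, \<ominus> c, a} \<subseteq> carrier R" using abcd by simp
    have "mat2 a b c d \<otimes>\<^bsub>matrix_ring 2 R\<^esub> mat2 d (\<ominus> b) (\<ominus> c) a = \<zero>\<^bsub>matrix_ring 2 R\<^esub>"
      unfolding mat2_mult[OF assms(1) Y] eqs assms(2) matrix_ring_2_consts ..
    moreover have "mat2 d (\<ominus> b) (\<ominus> c) a \<noteq> \<zero>\<^bsub>matrix_ring 2 R\<^esub>"
      using False abcd by (auto simp: matrix_ring_2_consts mat2_eq_iff)
    moreover have "mat2 d (\<ominus> b) (\<ominus> c) a \<in> carrier (matrix_ring 2 R)"
      using Y by (simp only: mat2_carrier_iff)
    ultimately show ?thesis unfolding left_zero_divisor_def by blast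
  qed
qed

lemmas zero_one_simps = minus_eq l_minus r_minus minus_minus r_neg l_neg

lemma minus_one_not_zero: "\<ominus> \<one> \<noteq> \<zero>"
  by (metis add.inv_eq_1_iff one_closed one_not_zero)

text \<open>The witness c satisfies c^2 = c + 1, so c and c - 1 are inverse to each other in every
  characteristic.\<close>

lemma has_triangle_matrix_ring_2: "has_triangle (matrix_ring 2 R)"
proof -
  have "mat2 \<zero> \<one> \<one> \<one> \<in> Units (matrix_ring 2 R)"
    by (rule mat2_in_Units) (simp_all add: zero_one_simps minus_one_not_zero)
  moreover have "mat2 \<zero> \<one> \<one> \<one> \<ominus>\<^bsub>matrix_ring 2 R\<^esub> \<one>\<^bsub>matrix_ring 2 R\<^esub> \<in> Units (matrix_ring 2 R)"
    unfolding matrix_ring_2_consts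
    by (subst mat2_minus) (simp_all add: mat2_in_Units zero_one_simps minus_one_not_zero)
  moreover have "\<one>\<^bsub>matrix_ring 2 R\<^esub> \<noteq> \<zero>\<^bsub>matrix_ring 2 R\<^esub>"
    by (simp add: matrix_ring_2_consts mat2_eq_iff)
  ultimately show ?thesis unfolding has_triangle_def by blast
qed

text \<open>All edge differences have determinant 1 or -1, so one choice serves every field. The
  omitted pair (3, 0) also has determinant 1, which adds a chord and turns the pentagon into the
  house graph.\<close>

lemma house_in_matrix_ring_2:
  "difference_pattern (matrix_ring 2 R) pentagon (diagonals - {(3, 0)})"
proof -
  let ?v = "\<lambda>k::nat. if k = 0 then mat2 \<zero> \<zero> \<zero> \<zero> else if k = 1 then mat2 \<one> \<zero> \<zero> \<one>
    else if k = 2 then mat2 \<zero> \<one> \<zero> \<zero> else if k = 3 then mat2 \<one> \<one> \<zero> \<one> else mat2 \<zero> \<one> \<one> \<zero>"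
  have "\<forall>(i, j) \<in> pentagon. ?v i \<ominus>\<^bsub>matrix_ring 2 R\<^esub> ?v j \<in> Units (matrix_ring 2 R)"
    by (auto simp: pentagon_def mat2_minus intro!: mat2_in_Units)
      (simp_all add: zero_one_simps minus_one_not_zero)
  moreover have "\<forall>(i, j) \<in> diagonals - {(3, 0)}. left_zero_divisor (matrix_ring 2 R) (?v i \<ominus>\<^bsub>matrix_ring 2 R\<^esub> ?v j)"
    by (auto simp: diagonals_def mat2_minus intro!: mat2_left_zero_divisor)
      (simp_all add: zero_one_simps)
  moreover have "range ?v \<subseteq> carrier (matrix_ring 2 R)"
    by (auto simp: mat2_carrier_iff)
  ultimately show ?thesis unfolding difference_pattern_def by (intro exI[of _ ?v] conjI)
qed

lemma pentagon_in_matrix_ring_2: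
  assumes "finite (carrier R)" "2 < card (carrier R)"
  shows "difference_pattern (matrix_ring 2 R) pentagon diagonals"
proof -
  obtain c where c: "c \<in> carrier R" "c \<noteq> \<zero>" "c \<noteq> \<one>"
  proof -
    have "\<not> carrier R \<subseteq> {\<zero>, \<one>}"
      using assms card_mono[of "{\<zero>, \<one>}" "carrier R"] by (auto simp: card_insert_if split: if_splits)
    then show ?thesis using that by blast
  qed
  have c1: "\<one> \<ominus> c \<noteq> \<zero>" using c by (metis one_closed r_right_minus_eq)
  have c0: "\<ominus> c \<noteq> \<zero>" using c by (metis add.inv_eq_1_iff)
  \<comment> \<open>The parameter \<open>c\<close> enters only the determinants
    \<open>\<one> \<ominus> c\<close> and \<open>\<ominus> c\<close> of the edges (1, 2) and (2, 3),
    which is why it must avoid 0 and 1. The other edges have determinant 1 or -1.\<close>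
  let ?v = "\<lambda>k::nat. if k = 0 then mat2 \<zero> \<zero> \<zero> \<zero> else if k = 1 then mat2 \<one> \<zero> \<zero> \<one>
    else if k = 2 then mat2 c \<one> \<zero> \<zero> else if k = 3 then mat2 \<zero> \<zero> \<zero> \<one> else mat2 \<zero> \<one> \<one> \<zero>"
  have "\<forall>(i, j) \<in> pentagon. ?v i \<ominus>\<^bsub>matrix_ring 2 R\<^esub> ?v j \<in> Units (matrix_ring 2 R)"
    using c(1) by (auto simp: pentagon_def mat2_minus intro!: mat2_in_Units)
      (use c c0 c1 in \<open>simp_all add: zero_one_simps minus_one_not_zero\<close>)
  moreover have "\<forall>(i, j) \<in> diagonals. left_zero_divisor (matrix_ring 2 R) (?v i \<ominus>\<^bsub>matrix_ring 2 R\<^esub> ?v j)"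
    using c(1) by (auto simp: diagonals_def mat2_minus intro!: mat2_left_zero_divisor)
      (use c in \<open>simp_all add: zero_one_simps\<close>)
  moreover have "range ?v \<subseteq> carrier (matrix_ring 2 R)"
    using c(1) by (auto simp: mat2_carrier_iff)
  ultimately show ?thesis unfolding difference_pattern_def by (intro exI[of _ ?v] conjI)
qed

text \<open>Splitting size 3 as 2 + 1 would leave the field itself as second block, and with two
  elements it has no triangle. Hence explicit matrices, with entries 0 and 1 and with inverses over
  the integers.\<close>

lemma pentagon_in_matrix_ring_3: "difference_pattern (matrix_ring 3 R) pentagon diagonals"
proof -
  let ?M = "matrix_ring 3 R"
  let ?v = "\<lambda>k::nat. if k = 0 then mat3 \<zero> \<zero> \<zero> \<zero> \<zero> \<zero> \<zero> \<zero> \<zero> else if k = 1 then mat3 \<one> \<zero> \<zero> \<zero> \<one> \<zero> \<zero> \<zero> \<one>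
    else if k = 2 then mat3 \<zero> \<zero> \<zero> \<zero> \<zero> \<zero> \<zero> \<one> \<zero> else if k = 3 then mat3 \<one> \<zero> \<zero> \<one> \<zero> \<one> \<zero> \<zero> \<zero>
    else mat3 \<zero> \<zero> \<one> \<one> \<zero> \<zero> \<zero> \<one> \<zero>"
  note simps = mat3_minus mat3_mult mat3_carrier_iff matrix_ring_3_consts mat3_eq_iff zero_one_simps
  have u01: "?v 0 \<ominus>\<^bsub>?M\<^esub> ?v 1 \<in> Units ?M"
    by (rule mult_one_imp_Units[of _ _ "mat3 (\<ominus> \<one>) \<zero> \<zero> \<zero> (\<ominus> \<one>) \<zero> \<zero> \<zero> (\<ominus> \<one>)"]) (simp_all add: simps)
  have u12: "?v 1 \<ominus>\<^bsub>?M\<^esub> ?v 2 \<in> Units ?M"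
    by (rule mult_one_imp_Units[of _ _ "mat3 \<one> \<zero> \<zero> \<zero> \<one> \<zero> \<zero> \<one> \<one>"]) (simp_all add: simps)
  have u23: "?v 2 \<ominus>\<^bsub>?M\<^esub> ?v 3 \<in> Units ?M"
    by (rule mult_one_imp_Units[of _ _ "mat3 (\<ominus> \<one>) \<zero> \<zero> \<zero> \<zero> \<one> \<one> (\<ominus> \<one>) \<zero>"]) (simp_all add: simps)
  have u34: "?v 3 \<ominus>\<^bsub>?M\<^esub> ?v 4 \<in> Units ?M"
    by (rule mult_one_imp_Units[of _ _ "mat3 \<one> \<one> \<zero> \<zero> \<zero> (\<ominus> \<one>) \<zero> \<one> \<zero>"]) (simp_all add: simps)
  have u40: "?v 4 \<ominus>\<^bsub>?M\<^esub> ?v 0 \<in> Units ?M"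
    by (rule mult_one_imp_Units[of _ _ "mat3 \<zero> \<one> \<zero> \<zero> \<zero> \<one> \<one> \<zero> \<zero>"]) (simp_all add: simps)
  \<comment> \<open>In each of the five cases the annihilated matrix has a kernel vector of the
    difference as its first column and zeros elsewhere.\<close>
  have z02: "left_zero_divisor ?M (?v 0 \<ominus>\<^bsub>?M\<^esub> ?v 2)"
    unfolding left_zero_divisor_def
    by (rule bexI[of _ "mat3 \<one> \<zero> \<zero> \<zero> \<zero> \<zero> \<zero> \<zero> \<zero>"]) (simp_all add: simps)
  have z24: "left_zero_divisor ?M (?v 2 \<ominus>\<^bsub>?M\<^esub> ?v 4)"
    unfolding left_zero_divisor_def
    by (rule bexI[of _ "mat3 \<zero> \<zero> \<zero> \<one> \<zero> \<zero> \<zero> \<zero> \<zero>"]) (simp_all add: simps)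
  have z41: "left_zero_divisor ?M (?v 4 \<ominus>\<^bsub>?M\<^esub> ?v 1)"
    unfolding left_zero_divisor_def
    by (rule bexI[of _ "mat3 \<one> \<zero> \<zero> \<one> \<zero> \<zero> \<one> \<zero> \<zero>"]) (simp_all add: simps)
  have z13: "left_zero_divisor ?M (?v 1 \<ominus>\<^bsub>?M\<^esub> ?v 3)"
    unfolding left_zero_divisor_def
    by (rule bexI[of _ "mat3 \<one> \<zero> \<zero> \<one> \<zero> \<zero> \<zero> \<zero> \<zero>"]) (simp_all add: simps)
  have z30: "left_zero_divisor ?M (?v 3 \<ominus>\<^bsub>?M\<^esub> ?v 0)"
    unfolding left_zero_divisor_def
    by (rule bexI[of _ "mat3 \<zero> \<zero> \<zero> \<one> \<zero> \<zero> \<zero> \<zero> \<zero>"]) (simp_all add: simps)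
  have "\<forall>(i, j) \<in> pentagon. ?v i \<ominus>\<^bsub>?M\<^esub> ?v j \<in> Units ?M"
    using u01 u12 u23 u34 u40 by (simp add: pentagon_def)
  moreover have "\<forall>(i, j) \<in> diagonals. left_zero_divisor ?M (?v i \<ominus>\<^bsub>?M\<^esub> ?v j)"
    using z02 z24 z41 z13 z30 by (simp add: diagonals_def)
  moreover have "range ?v \<subseteq> carrier ?M"
    by (auto simp: mat3_carrier_iff)
  ultimately show ?thesis unfolding difference_pattern_def by (intro exI[of _ ?v] conjI)
qed

text \<open>The witness has characteristic polynomial x^3 - x^2 + 1, whose value at 0 and at 1 is 1.
  So c and c - 1 are invertible already over the integers.\<close>

lemma has_triangle_matrix_ring_3: "has_triangle (matrix_ring 3 R)"
proof -
  let ?M = "matrix_ring 3 R"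
  let ?c = "mat3 \<zero> (\<ominus> \<one>) \<zero> \<zero> \<zero> (\<ominus> \<one>) (\<ominus> \<one>) \<zero> \<one>"
  note simps = mat3_minus mat3_mult mat3_carrier_iff matrix_ring_3_consts mat3_eq_iff zero_one_simps
    r_neg1 r_neg2
  have "?c \<in> Units ?M"
    by (rule mult_one_imp_Units[of _ _ "mat3 \<zero> (\<ominus> \<one>) (\<ominus> \<one>) (\<ominus> \<one>) \<zero> \<zero> \<zero> (\<ominus> \<one>) \<zero>"]) (simp_all add: simps)
  moreover have "?c \<ominus>\<^bsub>?M\<^esub> \<one>\<^bsub>?M\<^esub> \<in> Units ?M"
    by (rule mult_one_imp_Units[of _ _ "mat3 \<zero> \<zero> (\<ominus> \<one>) (\<ominus> \<one>) \<zero> \<one> \<one> (\<ominus> \<one>) (\<ominus> \<one>)"]) (simp_all add: simps)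
  moreover have "\<one>\<^bsub>?M\<^esub> \<noteq> \<zero>\<^bsub>?M\<^esub>"
    by (simp add: simps)
  ultimately show ?thesis unfolding has_triangle_def by blast
qed

lemma one_not_zero_matrix_ring: "0 < n \<Longrightarrow> \<one>\<^bsub>matrix_ring n R\<^esub> \<noteq> \<zero>\<^bsub>matrix_ring n R\<^esub>"
  using matrix_ring_index(3,4)[of 0 n 0 R] by auto

text \<open>Every size from 2 on is a sum of twos and threes, realised by diagonal blocks.\<close>

lemma has_triangle_matrix_ring:
  assumes "2 \<le> n"
  shows "has_triangle (matrix_ring n R)"
  using assms
proof (induction n rule: less_induct)
  case (less n)
  consider "n = 2" | "n = 3" | "4 \<le> n" using less.prems by linarith
  then show ?case
  proof cases
    case 3
    then have "has_triangle (matrix_ring (n - 2) R)" using less.IH[of "n - 2"] by simp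
    then have "has_triangle (RDirProd (matrix_ring 2 R) (matrix_ring (n - 2) R))"
      by (intro has_triangle_RDirProd ring_matrix_ring has_triangle_matrix_ring_2)
    then have "has_triangle (matrix_ring (2 + (n - 2)) R)"
      by (rule has_triangle_inj_hom[OF RDirProd_ring[OF ring_matrix_ring ring_matrix_ring] ring_matrix_ring
            block_diag_ring_hom]) (simp add: one_not_zero_matrix_ring)
    also have "2 + (n - 2) = n" using 3 by simp
    finally show ?thesis .
  qed (simp_all add: has_triangle_matrix_ring_2 has_triangle_matrix_ring_3)
qed

lemma pentagon_in_matrix_ring:
  assumes "3 \<le> n"
  shows "difference_pattern (matrix_ring n R) pentagon diagonals"
proof (cases "n = 3")
  case False
  let ?B = "matrix_ring (n - 2) R"
  \<comment> \<open>From size 4 on, a block of size two settles all diagonals but (3, 0), and the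
    remaining block has a triangle. This colouring of the pentagon gives 3 and 0 the same
    colour.\<close>
  define \<kappa> :: "nat \<Rightarrow> nat" where "\<kappa> = (\<lambda>i. if i = 1 then 1 else if i = 2 then 2 else if i = 4 then 1 else 0)"
  have "difference_pattern ?B pentagon {(3, 0)}"
    by (rule ring.difference_pattern_of_triangle[OF ring_matrix_ring, of _ \<kappa>])
      (use assms False in \<open>auto simp: \<kappa>_def pentagon_def has_triangle_matrix_ring\<close>)
  then have "difference_pattern (RDirProd (matrix_ring 2 R) ?B) pentagon (diagonals - {(3, 0)} \<union> {(3, 0)})"
    by (intro difference_pattern_RDirProd ring_matrix_ring house_in_matrix_ring_2)
  also have "diagonals - {(3, 0)} \<union> {(3, 0)} = diagonals" by (auto simp: diagonals_def)
  finally have "difference_pattern (matrix_ring (2 + (n - 2)) R) pentagon diagonals"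
    by (rule difference_pattern_inj_hom[OF RDirProd_ring[OF ring_matrix_ring ring_matrix_ring]
          ring_matrix_ring block_diag_ring_hom inj_on_block_diag])
  also have "2 + (n - 2) = n" using assms by simp
  finally show ?thesis .
qed (simp add: pentagon_in_matrix_ring_3)

end


section \<open>The unitary Cayley graph\<close>

lemma (in field) carrier_eq_zero_one:
  assumes "card (carrier R) = 2"
  shows "carrier R = {\<zero>, \<one>}"
proof -
  have "finite (carrier R)" using assms card.infinite by fastforce
  moreover have "card {\<zero>, \<one>} = card (carrier R)" using assms by simp
  ultimately have "{\<zero>, \<one>} = carrier R" by (intro card_subset_eq) auto
  then show ?thesis ..
qed

lemma (in field) one_add_one_eq_zero:
  assumes "carrier R = {\<zero>, \<one>}"
  shows "\<one> \<oplus> \<one> = \<zero>"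
proof (rule ccontr)
  assume "\<one> \<oplus> \<one> \<noteq> \<zero>"
  moreover have "\<one> \<oplus> \<one> \<in> {\<zero>, \<one>}" using assms by (metis a_closed one_closed)
  ultimately have "\<one> \<oplus> \<one> = \<one> \<oplus> \<zero>" by simp
  then show False using add.l_cancel[of \<one> \<one> \<zero>] by simp
qed

lemma (in field) iso_residue_ring_2:
  assumes "card (carrier R) = 2"
  shows "\<exists>f. f \<in> ring_iso R (residue_ring 2)"
proof -
  have c: "carrier R = {\<zero>, \<one>}" using assms by (rule carrier_eq_zero_one)
  have add: "\<one> \<oplus> \<one> = \<zero>" using c by (rule one_add_one_eq_zero)
  let ?f = "\<lambda>x. if x = \<zero> then 0 else (1 :: int)"
  have "?f \<in> ring_iso R (residue_ring 2)"
  proof (rule ring_iso_memI)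
    show "?f x \<in> carrier (residue_ring 2)" for x by (simp add: residue_ring_def)
    show "?f (x \<otimes> y) = ?f x \<otimes>\<^bsub>residue_ring 2\<^esub> ?f y" if "x \<in> carrier R" "y \<in> carrier R" for x y
      using that by (auto simp: c residue_ring_def)
    show "?f (x \<oplus> y) = ?f x \<oplus>\<^bsub>residue_ring 2\<^esub> ?f y" if "x \<in> carrier R" "y \<in> carrier R" for x y
      using that by (auto simp: c residue_ring_def add)
    show "?f \<one> = \<one>\<^bsub>residue_ring 2\<^esub>" by (simp add: residue_ring_def)
    have "{0..(1::int)} = {1, 0}" by auto
    then show "bij_betw ?f (carrier R) (carrier (residue_ring 2))"
      by (simp add: c residue_ring_def bij_betw_def inj_on_def)
  qed
  then show ?thesis by blast
qed

text \<open>Allows an abstract field with two elements to be exchanged for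
  \<open>residue_ring 2\<close> inside a matrix ring.\<close>

lemma matrix_ring_iso:
  assumes "ring F" "ring G" "f \<in> ring_iso F G"
  shows "map_mat f \<in> ring_iso (matrix_ring n F) (matrix_ring n G)"
proof (rule ring_iso_memI)
  have hom: "f \<in> ring_hom F G" and bij: "bij_betw f (carrier F) (carrier G)"
    using assms(3) by (auto simp: ring_iso_def)
  interpret ring_hom_ring F G f using assms(1,2) hom by (intro ring_hom_ringI2)
  note carr = matrix_ring_carrier_iff matrix_ring_index matrix_ring_dims
  have dim: "map_mat f A \<in> carrier_mat n n" if "A \<in> carrier_mat n n" for A using that by simp
  have index: "map_mat f A $$ (i, j) = f (A $$ (i, j))" if "A \<in> carrier_mat n n" "i < n" "j < n" for A i j
    using that by simp
  show closed: "map_mat f A \<in> carrier (matrix_ring n G)" if "A \<in> carrier (matrix_ring n F)" for A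
    using that by (auto simp: carr index)
  show "map_mat f (A \<otimes>\<^bsub>matrix_ring n F\<^esub> B) = map_mat f A \<otimes>\<^bsub>matrix_ring n G\<^esub> map_mat f B"
    if AB: "A \<in> carrier (matrix_ring n F)" "B \<in> carrier (matrix_ring n F)" for A B
  proof (rule carrier_mat_eqI[OF dim[OF matrix_ring_dims(1)] matrix_ring_dims(1)])
    fix i j assume ij: "i < n" "j < n"
    have e: "A $$ (i, k) \<in> carrier F" "B $$ (k, j) \<in> carrier F" if "k < n" for k
      using AB ij that by (auto simp: carr)
    have "map_mat f (A \<otimes>\<^bsub>matrix_ring n F\<^esub> B) $$ (i, j) = f (\<Oplus>\<^bsub>F\<^esub>k \<in> {..<n}. A $$ (i, k) \<otimes>\<^bsub>F\<^esub> B $$ (k, j))"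
      by (simp add: index[OF matrix_ring_dims(1) ij] carr ij)
    also have "\<dots> = (\<Oplus>\<^bsub>G\<^esub>k \<in> {..<n}. f (A $$ (i, k) \<otimes>\<^bsub>F\<^esub> B $$ (k, j)))"
      using e by (subst hom_finsum) (auto simp: comp_def)
    also have "\<dots> = (\<Oplus>\<^bsub>G\<^esub>k \<in> {..<n}. map_mat f A $$ (i, k) \<otimes>\<^bsub>G\<^esub> map_mat f B $$ (k, j))"
      using e ij AB by (intro S.finsum_cong') (auto simp: carr index)
    finally show "map_mat f (A \<otimes>\<^bsub>matrix_ring n F\<^esub> B) $$ (i, j) = (map_mat f A \<otimes>\<^bsub>matrix_ring n G\<^esub> map_mat f B) $$ (i, j)"
      by (simp add: carr ij)
  qed
  show "map_mat f (A \<oplus>\<^bsub>matrix_ring n F\<^esub> B) = map_mat f A \<oplus>\<^bsub>matrix_ring n G\<^esub> map_mat f B"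
    if "A \<in> carrier (matrix_ring n F)" "B \<in> carrier (matrix_ring n F)" for A B
    by (rule carrier_mat_eqI[OF dim[OF matrix_ring_dims(2)] matrix_ring_dims(2)])
      (use that in \<open>simp add: carr index del: index_map_mat\<close>)
  show "map_mat f \<one>\<^bsub>matrix_ring n F\<^esub> = \<one>\<^bsub>matrix_ring n G\<^esub>"
    by (rule carrier_mat_eqI[OF dim[OF matrix_ring_dims(3)] matrix_ring_dims(3)])
      (simp add: carr index del: index_map_mat)
  let ?g = "inv_into (carrier F) f"
  have g: "?g (f x) = x" "f x \<in> carrier G" if "x \<in> carrier F" for x
    using bij that by (auto simp: bij_betw_def)
  have g': "f (?g y) = y" "?g y \<in> carrier F" if "y \<in> carrier G" for y
    using bij that by (auto simp: bij_betw_def f_inv_into_f inv_into_into)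
  show "bij_betw (map_mat f) (carrier (matrix_ring n F)) (carrier (matrix_ring n G))"
  proof (rule bij_betw_byWitness[where f' = "map_mat ?g"])
    show "\<forall>A \<in> carrier (matrix_ring n F). map_mat ?g (map_mat f A) = A"
      by (auto intro!: eq_matI simp: carr g)
    show "\<forall>A \<in> carrier (matrix_ring n G). map_mat f (map_mat ?g A) = A"
      by (auto intro!: eq_matI simp: carr g')
    show "map_mat f ` carrier (matrix_ring n F) \<subseteq> carrier (matrix_ring n G)"
      using closed by blast
    show "map_mat ?g ` carrier (matrix_ring n G) \<subseteq> carrier (matrix_ring n F)"
      by (auto simp: carr g')
  qed
qed

text \<open>Over the field with two elements, \<open>M\<^sub>2 = F\<^sub>4 \<oplus> t F\<^sub>4\<close> for the swap matrix \<open>t\<close> and the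
  subfield \<open>F\<^sub>4\<close> of matrices with rows \<open>(p, q)\<close> and \<open>(q, p + q)\<close>, and a matrix is invertible iff
  exactly one of its two components is nonzero.\<close>

lemma (in field) matrix_ring_2_rook:
  assumes c: "carrier R = {\<zero>, \<one>}"
  shows "\<exists>(f :: 'a mat \<Rightarrow> 'a \<times> 'a) (g :: 'a mat \<Rightarrow> 'a \<times> 'a). \<forall>A \<in> carrier (matrix_ring 2 R). \<forall>B \<in> carrier (matrix_ring 2 R).
    A \<ominus>\<^bsub>matrix_ring 2 R\<^esub> B \<in> Units (matrix_ring 2 R) \<longleftrightarrow> (f A \<noteq> f B) \<noteq> (g A \<noteq> g B)"
proof -
  interpret M: ring "matrix_ring 2 R" by (rule ring_matrix_ring)
  \<comment> \<open>With A = a + t b for a, b in the subfield, \<open>f\<close> reads off the first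
    row of a and \<open>g\<close> the first row of b.\<close>
  define f where "f A = (A $$ (0, 0) \<oplus> A $$ (0, Suc 0) \<oplus> A $$ (Suc 0, 0), A $$ (0, 0) \<oplus> A $$ (Suc 0, Suc 0))" for A
  define g where "g A = (A $$ (0, 0) \<oplus> A $$ (Suc 0, 0) \<oplus> A $$ (Suc 0, Suc 0), A $$ (0, Suc 0) \<oplus> A $$ (Suc 0, 0))" for A
  have add: "\<one> \<oplus> \<one> = \<zero>" using c by (rule one_add_one_eq_zero)
  then have neg: "\<ominus> \<one> = \<one>" using minus_equality[of \<one> \<one>] by simp
  have unit: "D \<in> Units (matrix_ring 2 R) \<longleftrightarrow> (f D \<noteq> (\<zero>, \<zero>)) \<noteq> (g D \<noteq> (\<zero>, \<zero>))"
    if D: "D \<in> carrier (matrix_ring 2 R)" for D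
  proof -
    define p q r s where "p = D $$ (0, 0)" and "q = D $$ (0, Suc 0)" and "r = D $$ (Suc 0, 0)"
      and "s = D $$ (Suc 0, Suc 0)"
    have D_eq: "D = mat2 p q r s"
      using D by (intro mat2_eqI) (simp_all add: matrix_ring_carrier_iff p_def q_def r_def s_def)
    have pqrs: "p \<in> {\<zero>, \<one>}" "q \<in> {\<zero>, \<one>}" "r \<in> {\<zero>, \<one>}" "s \<in> {\<zero>, \<one>}"
      using D unfolding D_eq mat2_carrier_iff c by auto
    have "D \<in> Units (matrix_ring 2 R) \<longleftrightarrow> p \<otimes> s \<ominus> q \<otimes> r \<noteq> \<zero>"
      using mat2_in_Units[of p q r s] mat2_left_zero_divisor[of p q r s]
        M.not_Units_if_left_zero_divisor[of D] pqrs c D_eq by auto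
    \<comment> \<open>The determinant is the sum of the norms p^2 + p q + q^2 of the two components.
      Such a norm is 1 unless its component vanishes.\<close>
    also have "\<dots> \<longleftrightarrow> (f D \<noteq> (\<zero>, \<zero>)) \<noteq> (g D \<noteq> (\<zero>, \<zero>))"
      using pqrs by (auto simp: D_eq f_def g_def add neg minus_eq)
    finally show ?thesis .
  qed
  have diff: "f (A \<ominus>\<^bsub>matrix_ring 2 R\<^esub> B) = (\<zero>, \<zero>) \<longleftrightarrow> f A = f B"
    "g (A \<ominus>\<^bsub>matrix_ring 2 R\<^esub> B) = (\<zero>, \<zero>) \<longleftrightarrow> g A = g B"
    if A: "A \<in> carrier (matrix_ring 2 R)" and B: "B \<in> carrier (matrix_ring 2 R)" for A B
  proof -
    have e: "A $$ (i, j) \<in> carrier R" "B $$ (i, j) \<in> carrier R" if "i < 2" "j < 2" for i j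
      using A B that by (auto simp: matrix_ring_carrier_iff)
    have d: "(A \<ominus>\<^bsub>matrix_ring 2 R\<^esub> B) $$ (i, j) = A $$ (i, j) \<ominus> B $$ (i, j)" if "i < 2" "j < 2" for i j
      using matrix_ring_minus_index[OF A B that] .
    have three: "(x \<ominus> x') \<oplus> (y \<ominus> y') \<oplus> (z \<ominus> z') = \<zero> \<longleftrightarrow> x \<oplus> y \<oplus> z = x' \<oplus> y' \<oplus> z'"
      if "x \<in> carrier R" "x' \<in> carrier R" "y \<in> carrier R" "y' \<in> carrier R" "z \<in> carrier R" "z' \<in> carrier R"
      for x x' y y' z z'
    proof -
      have "(x \<ominus> x') \<oplus> (y \<ominus> y') \<oplus> (z \<ominus> z') = (x \<oplus> y \<oplus> z) \<ominus> (x' \<oplus> y' \<oplus> z')"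
        using that by algebra
      with that show ?thesis by simp
    qed
    have two: "(x \<ominus> x') \<oplus> (y \<ominus> y') = \<zero> \<longleftrightarrow> x \<oplus> y = x' \<oplus> y'"
      if "x \<in> carrier R" "x' \<in> carrier R" "y \<in> carrier R" "y' \<in> carrier R" for x x' y y'
    proof -
      have "(x \<ominus> x') \<oplus> (y \<ominus> y') = (x \<oplus> y) \<ominus> (x' \<oplus> y')"
        using that by algebra
      with that show ?thesis by simp
    qed
    show "f (A \<ominus>\<^bsub>matrix_ring 2 R\<^esub> B) = (\<zero>, \<zero>) \<longleftrightarrow> f A = f B"
      using e by (simp add: f_def d three two)
    show "g (A \<ominus>\<^bsub>matrix_ring 2 R\<^esub> B) = (\<zero>, \<zero>) \<longleftrightarrow> g A = g B"
      using e by (simp add: g_def d three two)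
  qed
  show ?thesis
    by (intro exI[of _ f] exI[of _ g] ballI) (simp add: unit diff)
qed

section \<open>Adjacency read off from the decomposition\<close>

lemma unitary_cayley_graph_simps:
  "verts (unitary_cayley_graph R) = carrier R"
  "pverts (unitary_cayley_graph R) = carrier R"
  "a \<rightarrow>\<^bsub>unitary_cayley_graph R\<^esub> b \<longleftrightarrow>
     a \<in> carrier R \<and> b \<in> carrier R \<and> a \<noteq> b \<and> a \<ominus>\<^bsub>R\<^esub> b \<in> Units R"
  "(a, b) \<in> parcs (unitary_cayley_graph R) \<longleftrightarrow>
     a \<in> carrier R \<and> b \<in> carrier R \<and> a \<noteq> b \<and> a \<ominus>\<^bsub>R\<^esub> b \<in> Units R"
  by (auto simp: unitary_cayley_graph_def)

lemma hom_to_field_minus_Units_iff: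
  assumes "ring R" "field K" "f \<in> ring_hom R K" "a \<in> carrier R" "b \<in> carrier R"
  shows "f (a \<ominus>\<^bsub>R\<^esub> b) \<in> Units K \<longleftrightarrow> f a \<noteq> f b"
proof -
  interpret K: field K by fact
  have "f a \<in> carrier K" "f b \<in> carrier K" using assms(3-5) ring_hom_memE(1) by fast+
  then show ?thesis
    using ring_hom_minus[OF assms(1) K.ring_axioms assms(3-5)] by (simp add: K.field_Units)
qed

lemma RDirProd_list_Cons_hom:
  "hd \<in> ring_hom (RDirProd_list (R # Rs)) R"
  "tl \<in> ring_hom (RDirProd_list (R # Rs)) (RDirProd_list Rs)"
proof -
  let ?P = "RDirProd R (RDirProd_list Rs)" and ?L = "RDirProd_list (R # Rs)"
  note hom = ring_hom_memE[OF RDirProd_list_hom1[of R Rs]]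
  have cons: "\<exists>a as. x = a # as \<and> (a, as) \<in> carrier ?P" if "x \<in> carrier ?L" for x
    using that by (auto simp: RDirProd_list_carrier RDirProd_carrier)
  have mult: "(a # as) \<otimes>\<^bsub>?L\<^esub> (b # bs) = (a \<otimes>\<^bsub>R\<^esub> b) # (as \<otimes>\<^bsub>RDirProd_list Rs\<^esub> bs)"
    and add: "(a # as) \<oplus>\<^bsub>?L\<^esub> (b # bs) = (a \<oplus>\<^bsub>R\<^esub> b) # (as \<oplus>\<^bsub>RDirProd_list Rs\<^esub> bs)"
    if "(a, as) \<in> carrier ?P" "(b, bs) \<in> carrier ?P" for a as b bs
    using hom(2)[OF that] hom(3)[OF that] by (simp_all add: RDirProd_simps)
  have one: "\<one>\<^bsub>?L\<^esub> = \<one>\<^bsub>R\<^esub> # \<one>\<^bsub>RDirProd_list Rs\<^esub>"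
    using hom(4) by (simp add: RDirProd_simps)
  show "hd \<in> ring_hom ?L R"
    by (rule ring_hom_memI) (auto dest!: cons simp: mult add one RDirProd_carrier)
  show "tl \<in> ring_hom ?L (RDirProd_list Rs)"
    by (rule ring_hom_memI) (auto dest!: cons simp: mult add one RDirProd_carrier)
qed

lemma Units_RDirProd_list_Cons:
  assumes "ring R" "ring (RDirProd_list Rs)" "x \<in> carrier (RDirProd_list (R # Rs))"
  shows "x \<in> Units (RDirProd_list (R # Rs)) \<longleftrightarrow> hd x \<in> Units R \<and> tl x \<in> Units (RDirProd_list Rs)"
proof -
  obtain a as where x: "x = a # as" "(a, as) \<in> carrier (RDirProd R (RDirProd_list Rs))"
    using assms(3) by (auto simp: RDirProd_list_carrier RDirProd_carrier)
  show ?thesis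
    using ring_iso_Units_iff[OF RDirProd_list_iso1 x(2) RDirProd_ring[OF assms(1,2)]]
    by (simp add: x(1) Units_RDirProd)
qed

text \<open>Preimages under \<open>h\<close> form the pentagon in \<open>R\<close>: as
  \<open>h\<close> preserves and reflects units, the units and zero divisors of \<open>P\<close>
  decide adjacency.\<close>

lemma not_perfect_if_pentagon:
  assumes R: "ring R" "finite (carrier R)" and P: "ring P"
    and h: "h \<in> ring_hom R P" "h ` carrier R = carrier P"
      "\<And>x. x \<in> carrier R \<Longrightarrow> x \<in> Units R \<longleftrightarrow> h x \<in> Units P"
    and pat: "difference_pattern P pentagon diagonals"
  shows "\<not> perfect_graph (unitary_cayley_graph R)"
proof -
  interpret R: ring R by fact
  interpret P: ring P by fact
  interpret G: pair_graph "unitary_cayley_graph R"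
    using R by (rule pair_graph_unitary_cayley_graph)
  obtain v where v: "range v \<subseteq> carrier P" "\<forall>(i, j) \<in> pentagon. v i \<ominus>\<^bsub>P\<^esub> v j \<in> Units P"
    "\<forall>(i, j) \<in> diagonals. left_zero_divisor P (v i \<ominus>\<^bsub>P\<^esub> v j)"
    using pat by (auto simp: difference_pattern_def)
  have vc: "v i \<in> carrier P" for i using v(1) by blast
  define w where "w i = inv_into (carrier R) h (v i)" for i
  have w: "w i \<in> carrier R" "h (w i) = v i" for i
    unfolding w_def using vc[of i] h(2) by (auto simp: inv_into_into f_inv_into_f)
  have minus: "w i \<ominus>\<^bsub>R\<^esub> w j \<in> Units R \<longleftrightarrow> v i \<ominus>\<^bsub>P\<^esub> v j \<in> Units P" for i j
    using h(3)[of "w i \<ominus>\<^bsub>R\<^esub> w j"] ring_hom_minus[OF R(1) P h(1) w(1) w(1)] w by simp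
  \<comment> \<open>In the zero ring 0 is a unit, so a unit difference would not separate vertices.
    The existence of a zero divisor excludes this.\<close>
  have one: "\<one>\<^bsub>P\<^esub> \<noteq> \<zero>\<^bsub>P\<^esub>"
  proof
    assume eq: "\<one>\<^bsub>P\<^esub> = \<zero>\<^bsub>P\<^esub>"
    have "(0, 2) \<in> diagonals" by (simp add: diagonals_def)
    then obtain b where b: "b \<in> carrier P" "b \<noteq> \<zero>\<^bsub>P\<^esub>"
      using v(3) by (auto simp: left_zero_divisor_def)
    have "b = \<one>\<^bsub>P\<^esub> \<otimes>\<^bsub>P\<^esub> b" using b(1) by simp
    also have "\<dots> = \<zero>\<^bsub>P\<^esub>" unfolding eq using b(1) by simp
    finally show False using b(2) by simp
  qed
  have edge: "w i \<rightarrow>\<^bsub>unitary_cayley_graph R\<^esub> w j \<longleftrightarrow> v i \<ominus>\<^bsub>P\<^esub> v j \<in> Units P" for i j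
  proof -
    have "\<zero>\<^bsub>P\<^esub> \<notin> Units P" using one by (auto simp: Units_def)
    then have "v i \<ominus>\<^bsub>P\<^esub> v j \<in> Units P \<Longrightarrow> w i \<noteq> w j"
      using w(2)[of i] w(2)[of j] vc[of i] by (auto simp: a_minus_def P.r_neg)
    then show ?thesis using minus w(1) by (auto simp: unitary_cayley_graph_simps)
  qed
  have sym: "w i \<rightarrow>\<^bsub>unitary_cayley_graph R\<^esub> w j \<longleftrightarrow> w j \<rightarrow>\<^bsub>unitary_cayley_graph R\<^esub> w i" for i j
    using G.graph_symmetric[of "w i" "w j"] G.graph_symmetric[of "w j" "w i"] by auto
  have yes: "w i \<rightarrow>\<^bsub>unitary_cayley_graph R\<^esub> w j" if "(i, j) \<in> pentagon \<or> (j, i) \<in> pentagon" for i j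
    using that v(2) edge sym by blast
  have no: "\<not> w i \<rightarrow>\<^bsub>unitary_cayley_graph R\<^esub> w j"
    if "(i, j) \<in> diagonals \<or> (j, i) \<in> diagonals \<or> i = j" for i j
  proof (cases "i = j")
    case False
    then show ?thesis using that v(3) edge sym P.not_Units_if_left_zero_divisor by blast
  qed (simp add: unitary_cayley_graph_simps)
  have pairs: "\<forall>i \<in> set [0..<5]. \<forall>j \<in> set [0..<5].
      (if i = (j + 1) mod 5 \<or> j = (i + 1) mod 5 then (i, j) \<in> pentagon \<or> (j, i) \<in> pentagon
       else (i, j) \<in> diagonals \<or> (j, i) \<in> diagonals \<or> i = j)"
    unfolding pentagon_def diagonals_def by code_simp
  show ?thesis
  proof (rule pentagon_imp_not_perfect)
    show "wf_digraph (unitary_cayley_graph R)" by (rule G.wf_digraph)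
    show "w ` {..<5} \<subseteq> verts (unitary_cayley_graph R)"
      using w(1) by (auto simp: unitary_cayley_graph_simps)
    fix i j :: nat assume "i < 5" "j < 5"
    then have "i \<in> set [0..<5]" "j \<in> set [0..<5]" by auto
    with pairs have "if i = (j + 1) mod 5 \<or> j = (i + 1) mod 5 then (i, j) \<in> pentagon \<or> (j, i) \<in> pentagon
       else (i, j) \<in> diagonals \<or> (j, i) \<in> diagonals \<or> i = j" by blast
    then show "w i \<rightarrow>\<^bsub>unitary_cayley_graph R\<^esub> w j \<longleftrightarrow> i = (j + 1) mod 5 \<or> j = (i + 1) mod 5"
      using yes no by metis
  qed
qed

lemma difference_pattern_mono:
  "difference_pattern A E N \<Longrightarrow> N' \<subseteq> N \<Longrightarrow> difference_pattern A E N'"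
  unfolding difference_pattern_def by blast

text \<open>Fixing the vertex that has a colour of its own determines the 3-colouring, and the other
  four vertices pair up along two diagonals. The singletons 3, 0 and 2 are used; the last colouring
  is recorded for (3, 0) alone because (4, 1) is already in the first list.\<close>

lemma pentagon_colourings:
  assumes "ring A" "has_triangle A" "N \<subseteq> {(0, 2), (4, 1)} \<or> N \<subseteq> {(2, 4), (1, 3)} \<or> N \<subseteq> {(3, 0)}"
  shows "difference_pattern A pentagon N"
proof -
  have pat: "difference_pattern A pentagon M"
    if "\<And>i. \<kappa> i < 3" "\<And>i j. (i, j) \<in> pentagon \<Longrightarrow> \<kappa> i \<noteq> \<kappa> j" "\<And>i j. (i, j) \<in> M \<Longrightarrow> \<kappa> i = \<kappa> j" for M and \<kappa> :: "nat \<Rightarrow> nat"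
    using ring.difference_pattern_of_triangle[OF assms(1,2) that] .
  have "difference_pattern A pentagon {(0, 2), (4, 1)}"
    by (rule pat[of "\<lambda>i. if i = 3 then 2 else if i = 1 \<or> i = 4 then 1 else 0"]) (auto simp: pentagon_def)
  moreover have "difference_pattern A pentagon {(2, 4), (1, 3)}"
    by (rule pat[of "\<lambda>i. if i = 0 then 2 else if i = 1 \<or> i = 3 then 1 else 0"]) (auto simp: pentagon_def)
  moreover have "difference_pattern A pentagon {(3, 0)}"
    by (rule pat[of "\<lambda>i. if i = 2 then 2 else if i = 1 \<or> i = 4 then 1 else 0"]) (auto simp: pentagon_def)
  ultimately show ?thesis using assms(3) difference_pattern_mono by blast
qed

lemma nil_ring_Units: "x \<in> carrier nil_ring \<Longrightarrow> x \<in> Units nil_ring"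
  by (auto simp: Units_def monoid.defs)

text \<open>For \<open>s = 0\<close> and \<open>r = 1\<close> the empty product of fields still
  stands in the decomposition and has to be stripped off.\<close>

lemma iso_singleton_RDirProd_list:
  fixes M :: "'c ring"
  assumes "ring M"
  shows "RDirProd (nil_ring :: 'b list ring) (RDirProd_list [M]) \<simeq> M"
proof -
  let ?N = "nil_ring :: 'b list ring"
  have "M \<simeq> RDirProd_list [M]"
    using RDirProd_list_iso3[of M] unfolding is_ring_iso_def by blast
  moreover have "RDirProd_list [M] \<simeq> RDirProd (RDirProd_list [M]) ?N"
    using RDirProd_iso7[of "RDirProd_list [M]"] unfolding is_ring_iso_def by blast
  moreover have "RDirProd (RDirProd_list [M]) ?N \<simeq> RDirProd ?N (RDirProd_list [M])"
    using RDirProd_iso1[of "RDirProd_list [M]" ?N] unfolding is_ring_iso_def by blast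
  ultimately have "M \<simeq> RDirProd ?N (RDirProd_list [M])"
    by (rule ring_iso_trans[OF ring_iso_trans])
  then show ?thesis by (rule ring_iso_sym[OF assms])
qed

lemma perfect_if_iso_matrix_ring_2:
  fixes R :: "('a, 'm) ring_scheme" and F :: "('b, 'n) ring_scheme"
  assumes R: "ring R" "finite (carrier R)"
    and iso: "semisimplification R \<simeq> matrix_ring 2 F" and F: "field F" "card (carrier F) = 2"
  shows "perfect_graph (unitary_cayley_graph R)"
proof -
  interpret F: field F by fact
  interpret R: ring R by fact
  let ?M = "matrix_ring 2 F"
  obtain h where h: "h \<in> ring_hom R ?M" "h ` carrier R = carrier ?M"
    "\<And>x. x \<in> carrier R \<Longrightarrow> x \<in> Units R \<longleftrightarrow> h x \<in> Units ?M"
    using ring_hom_of_semisimplification_iso[OF R iso] by auto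
  obtain f g :: "'b mat \<Rightarrow> 'b \<times> 'b" where fg: "\<forall>A \<in> carrier ?M. \<forall>B \<in> carrier ?M.
      A \<ominus>\<^bsub>?M\<^esub> B \<in> Units ?M \<longleftrightarrow> (f A \<noteq> f B) \<noteq> (g A \<noteq> g B)"
    using F.matrix_ring_2_rook[OF F.carrier_eq_zero_one[OF F(2)]] by blast
  show ?thesis
  proof (rule perfect_rook_type[of _ "f \<circ> h" "g \<circ> h"])
    show "finite (verts (unitary_cayley_graph R))" using R(2) by (simp add: unitary_cayley_graph_simps)
    fix a b assume "a \<in> verts (unitary_cayley_graph R)" "b \<in> verts (unitary_cayley_graph R)"
    then have ab: "a \<in> carrier R" "b \<in> carrier R" by (simp_all add: unitary_cayley_graph_simps)
    have "a \<ominus>\<^bsub>R\<^esub> b \<in> Units R \<longleftrightarrow> h a \<ominus>\<^bsub>?M\<^esub> h b \<in> Units ?M"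
      using h(3)[of "a \<ominus>\<^bsub>R\<^esub> b"] ab ring_hom_minus[OF R(1) F.ring_matrix_ring h(1) ab] by simp
    also have "\<dots> \<longleftrightarrow> (f (h a) \<noteq> f (h b)) \<noteq> (g (h a) \<noteq> g (h b))"
      using fg ring_hom_memE(1)[OF h(1) ab(1)] ring_hom_memE(1)[OF h(1) ab(2)] by simp
    finally show "a \<rightarrow>\<^bsub>unitary_cayley_graph R\<^esub> b \<longleftrightarrow>
        ((f \<circ> h) a \<noteq> (f \<circ> h) b) \<noteq> ((g \<circ> h) a \<noteq> (g \<circ> h) b)"
      using ab by (cases "a = b") (simp_all add: unitary_cayley_graph_simps)
  qed
qed

theorem theorem4p5:
  fixes R :: "('a, 'm) ring_scheme"
    and s r :: nat
    and K :: "nat \<Rightarrow> 'b ring"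
    and d :: "nat \<Rightarrow> nat"
    and F :: "nat \<Rightarrow> 'c ring"
  assumes "ring R" and "finite (carrier R)"
    and "\<And>i. i \<in> {1..s} \<Longrightarrow> field (K i) \<and> finite (carrier (K i))"
    and "\<And>i. i \<in> {1..s} \<Longrightarrow> 2 \<le> card (carrier (K i))"
    and "\<And>i j. 1 \<le> i \<Longrightarrow> i \<le> j \<Longrightarrow> j \<le> s \<Longrightarrow> card (carrier (K i)) \<le> card (carrier (K j))"
    and "\<And>i. i \<in> {1..r} \<Longrightarrow> 2 \<le> d i"
    and "\<And>i. i \<in> {1..r} \<Longrightarrow> field (F i) \<and> finite (carrier (F i))"
    and "semisimplification R \<simeq>
           RDirProd (RDirProd_list (map K [1..<s + 1]))
                    (RDirProd_list (map (\<lambda>i. matrix_ring (d i) (F i)) [1..<r + 1]))"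
  shows "(perfect_graph (unitary_cayley_graph R) \<longleftrightarrow>
            (s \<ge> 1 \<and> card (carrier (K 1)) = 2) \<or>
            (s \<le> 2 \<and> r = 0) \<or>
            semisimplification R \<simeq> matrix_ring 2 (residue_ring 2)) \<and>
         (s \<ge> 1 \<and> card (carrier (K 1)) = 2 \<longrightarrow> bipartite_graph (unitary_cayley_graph R))"
proof -
  let ?G = "unitary_cayley_graph R"
  let ?M = "\<lambda>i. matrix_ring (d i) (F i)"
  define Ks where "Ks = map K [1..<s + 1]"
  define Ms where "Ms = map ?M [1..<r + 1]"
  let ?A = "RDirProd_list Ks" and ?B = "RDirProd_list Ms"
  let ?P = "RDirProd ?A ?B"
  interpret R: ring R by fact
  interpret G: pair_graph ?G using assms(1,2) by (rule pair_graph_unitary_cayley_graph)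
  note field = assms(3)[THEN conjunct1] and field' = assms(7)[THEN conjunct1]
  have ringK: "ring (K i)" if "i \<in> {1..s}" for i
    using field[OF that] by (simp add: field_def domain_def cring_def)
  have ringM: "ring (?M i)" if "i \<in> {1..r}" for i
    using field'[OF that] ring.ring_matrix_ring by (fastforce simp: field_def domain_def cring_def)
  have iso: "semisimplification R \<simeq> ?P"
    using assms(8) unfolding Ks_def Ms_def .
  \<comment> \<open>List positions start at 0 whereas the factors are numbered from 1.\<close>
  have nthK: "length Ks = s" "\<And>i. i < s \<Longrightarrow> Ks ! i = K (i + 1)"
    by (simp_all add: Ks_def del: upt_Suc)
  have nthM: "length Ms = r" "\<And>i. i < r \<Longrightarrow> Ms ! i = ?M (i + 1)"
    by (simp_all add: Ms_def del: upt_Suc)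
  have ringA: "ring ?A"
    by (rule RDirProd_list_is_ring) (use ringK nthK in auto)
  have ringB: "ring ?B"
    by (rule RDirProd_list_is_ring) (use ringM nthM in auto)
  have ringP: "ring ?P" using ringA ringB by (rule RDirProd_ring)
  obtain h where h: "h \<in> ring_hom R ?P" "h ` carrier R = carrier ?P"
    "\<And>x. x \<in> carrier R \<Longrightarrow> x \<in> Units R \<longleftrightarrow> h x \<in> Units ?P"
    using ring_hom_of_semisimplification_iso[OF assms(1,2) iso] by auto
  have hA: "fst \<circ> h \<in> ring_hom R ?A" using h(1) fst_ring_hom by (rule ring_hom_trans)
  have finV: "finite (verts ?G)" using assms(2) by (simp add: unitary_cayley_graph_simps)

  \<comment> \<open>A factor with two elements\<close>
  have bip: "bipartite_graph ?G" if "s \<ge> 1" "card (carrier (K 1)) = 2"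
  proof -
    have K1: "field (K 1)" using field that(1) by simp
    have "Ks = K 1 # map K [2..<s + 1]"
      using that(1) by (simp add: Ks_def upt_conv_Cons numeral_2_eq_2 del: upt_Suc)
    then have "hd \<in> ring_hom ?A (K 1)" using RDirProd_list_Cons_hom(1) by metis
    then have f: "hd \<circ> (fst \<circ> h) \<in> ring_hom R (K 1)" using hA ring_hom_trans by blast
    let ?f = "hd \<circ> (fst \<circ> h)"
    \<comment> \<open>The image in \<open>K 1\<close> has only two values and changes along every
      edge, so it serves as the bipartition.\<close>
    have val: "?f a = \<zero>\<^bsub>K 1\<^esub> \<or> ?f a = \<one>\<^bsub>K 1\<^esub>" if "a \<in> carrier R" for a
      using ring_hom_memE(1)[OF f that] field.carrier_eq_zero_one[OF K1 \<open>card (carrier (K 1)) = 2\<close>] by simp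
    have ne: "?f a \<noteq> ?f b" if "a \<rightarrow>\<^bsub>?G\<^esub> b" for a b
      using that ring_hom_Units[OF f] hom_to_field_minus_Units_iff[OF assms(1) K1 f]
      by (auto simp: unitary_cayley_graph_simps)
    have inG: "a \<in> carrier R \<and> b \<in> carrier R" if "a \<rightarrow>\<^bsub>?G\<^esub> b" for a b
      using that by (simp add: unitary_cayley_graph_simps)
    show ?thesis
      unfolding bipartite_graph_def
    proof (intro exI conjI allI impI)
      show "{a \<in> carrier R. ?f a = \<zero>\<^bsub>K 1\<^esub>} \<union> {a \<in> carrier R. ?f a \<noteq> \<zero>\<^bsub>K 1\<^esub>} = verts ?G"
        by (auto simp: unitary_cayley_graph_simps)
      show "{a \<in> carrier R. ?f a = \<zero>\<^bsub>K 1\<^esub>} \<inter> {a \<in> carrier R. ?f a \<noteq> \<zero>\<^bsub>K 1\<^esub>} = {}" by blast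
      fix a b assume ab: "a \<rightarrow>\<^bsub>?G\<^esub> b"
      show "a \<in> {a \<in> carrier R. ?f a = \<zero>\<^bsub>K 1\<^esub>} \<and> b \<in> {a \<in> carrier R. ?f a \<noteq> \<zero>\<^bsub>K 1\<^esub>} \<or>
          a \<in> {a \<in> carrier R. ?f a \<noteq> \<zero>\<^bsub>K 1\<^esub>} \<and> b \<in> {a \<in> carrier R. ?f a = \<zero>\<^bsub>K 1\<^esub>}"
        using ne[OF ab] inG[OF ab] val[of a] val[of b] by auto
    qed
  qed

  \<comment> \<open>At most two fields\<close>
  have perfect2: "perfect_graph ?G" if "s \<le> 2" "r = 0"
  proof -
    have Bnil: "?B = nil_ring" using that(2) by (simp add: Ms_def)
    have unitA: "x \<in> Units R \<longleftrightarrow> fst (h x) \<in> Units ?A" if x: "x \<in> carrier R" for x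
    proof -
      obtain u v where uv: "h x = (u, v)" by fastforce
      have "v \<in> carrier ?B" using ring_hom_memE(1)[OF h(1) x] by (simp add: uv RDirProd_carrier)
      then have "v \<in> Units ?B" using nil_ring_Units unfolding Bnil by blast
      then show ?thesis using h(3)[OF x] by (simp add: uv Units_RDirProd)
    qed
    have carrA: "fst (h x) \<in> carrier ?A" if "x \<in> carrier R" for x
      using ring_hom_memE(1)[OF hA that] by simp
    consider "s = 0" | "s = 1" | "s = 2" using \<open>s \<le> 2\<close> by linarith
    then show ?thesis
    proof cases
      case 1
      then have A: "?A = nil_ring" by (simp add: Ks_def)
      have "\<zero>\<^bsub>R\<^esub> \<in> Units R"
        \<comment> \<open>An empty product makes 0 a unit, so \<open>R\<close> is the zero ring and
          its graph has no edges.\<close>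
        using unitA[OF R.zero_closed] carrA[OF R.zero_closed] nil_ring_Units unfolding A by blast
      then have "\<one>\<^bsub>R\<^esub> = \<zero>\<^bsub>R\<^esub>" by (auto simp: Units_def)
      then have "carrier R = {\<zero>\<^bsub>R\<^esub>}" by (rule R.one_zeroD)
      then have "\<not> a \<rightarrow>\<^bsub>?G\<^esub> b" for a b by (auto simp: unitary_cayley_graph_simps)
      then show ?thesis
        by (intro perfect_tensor_type[of _ "\<lambda>_. ()" "\<lambda>_. ()"] finV) simp
    next
      case 2
      then have A: "?A = RDirProd_list [K 1]" by (simp add: Ks_def)
      have K1: "field (K 1)" "ring (K 1)" using field ringK 2 by simp_all
      have f: "hd \<circ> (fst \<circ> h) \<in> ring_hom R (K 1)"
        using hA RDirProd_list_Cons_hom(1) unfolding A by (rule ring_hom_trans)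
      have unit: "a \<ominus>\<^bsub>R\<^esub> b \<in> Units R \<longleftrightarrow> (hd \<circ> (fst \<circ> h)) a \<noteq> (hd \<circ> (fst \<circ> h)) b"
        if ab: "a \<in> carrier R" "b \<in> carrier R" for a b
      proof -
        let ?x = "a \<ominus>\<^bsub>R\<^esub> b"
        have x: "fst (h ?x) \<in> carrier (RDirProd_list [K 1])" using carrA[of ?x] ab unfolding A by simp
        have "tl (fst (h ?x)) \<in> Units nil_ring"
          using nil_ring_Units ring_hom_memE(1)[OF RDirProd_list_Cons_hom(2) x] by simp
        then have "?x \<in> Units R \<longleftrightarrow> (hd \<circ> (fst \<circ> h)) ?x \<in> Units (K 1)"
          using unitA[of ?x] ab Units_RDirProd_list_Cons[OF K1(2) _ x] ringA unfolding A
          using RDirProd_list_is_ring[of "[]"] by simp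
        then show ?thesis using hom_to_field_minus_Units_iff[OF assms(1) K1(1) f ab] by simp
      qed
      show ?thesis
        \<comment> \<open>With a single field the same coordinate is used on both sides.\<close>
        by (rule perfect_tensor_type[of _ "hd \<circ> (fst \<circ> h)" "hd \<circ> (fst \<circ> h)"])
          (use finV unit in \<open>auto simp: unitary_cayley_graph_simps\<close>)
    next
      case 3
      then have A: "?A = RDirProd_list [K 1, K 2]" by (simp add: Ks_def upt_conv_Cons numeral_2_eq_2)
      have K: "field (K 1)" "ring (K 1)" "field (K 2)" "ring (K 2)" using field ringK 3 by simp_all
      have f: "hd \<circ> (fst \<circ> h) \<in> ring_hom R (K 1)"
        using hA RDirProd_list_Cons_hom(1) unfolding A by (rule ring_hom_trans)
      have "tl \<circ> (fst \<circ> h) \<in> ring_hom R (RDirProd_list [K 2])"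
        using hA RDirProd_list_Cons_hom(2) unfolding A by (rule ring_hom_trans)
      then have g: "hd \<circ> (tl \<circ> (fst \<circ> h)) \<in> ring_hom R (K 2)"
        using RDirProd_list_Cons_hom(1) by (rule ring_hom_trans)
      have rings: "ring (RDirProd_list ([] :: 'b ring list))" "ring (RDirProd_list [K 2])"
        using RDirProd_list_is_ring[of "[] :: 'b ring list"] RDirProd_list_is_ring[of "[K 2]"] K(4) by simp_all
      have unit: "a \<ominus>\<^bsub>R\<^esub> b \<in> Units R \<longleftrightarrow> (hd \<circ> (fst \<circ> h)) a \<noteq> (hd \<circ> (fst \<circ> h)) b \<and>
          (hd \<circ> (tl \<circ> (fst \<circ> h))) a \<noteq> (hd \<circ> (tl \<circ> (fst \<circ> h))) b"
        if ab: "a \<in> carrier R" "b \<in> carrier R" for a b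
      proof -
        let ?x = "a \<ominus>\<^bsub>R\<^esub> b"
        have x: "fst (h ?x) \<in> carrier (RDirProd_list [K 1, K 2])" using carrA[of ?x] ab unfolding A by simp
        have y: "tl (fst (h ?x)) \<in> carrier (RDirProd_list [K 2])"
          using ring_hom_memE(1)[OF RDirProd_list_Cons_hom(2) x] .
        have "tl (tl (fst (h ?x))) \<in> Units nil_ring"
          using nil_ring_Units ring_hom_memE(1)[OF RDirProd_list_Cons_hom(2) y] by simp
        then have "?x \<in> Units R \<longleftrightarrow>
            (hd \<circ> (fst \<circ> h)) ?x \<in> Units (K 1) \<and> (hd \<circ> (tl \<circ> (fst \<circ> h))) ?x \<in> Units (K 2)"
          using unitA[of ?x] ab Units_RDirProd_list_Cons[OF K(2) rings(2) x]
            Units_RDirProd_list_Cons[OF K(4) rings(1) y] unfolding A by simp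
        then show ?thesis
          using hom_to_field_minus_Units_iff[OF assms(1) K(1) f ab]
            hom_to_field_minus_Units_iff[OF assms(1) K(3) g ab] by simp
      qed
      show ?thesis
        by (rule perfect_tensor_type[of _ "hd \<circ> (fst \<circ> h)" "hd \<circ> (tl \<circ> (fst \<circ> h))"])
          (use finV unit in \<open>auto simp: unitary_cayley_graph_simps\<close>)
    qed
  qed

  \<comment> \<open>Two by two matrices over the field with two elements\<close>
  have perfect3: "perfect_graph ?G" if "semisimplification R \<simeq> matrix_ring 2 (residue_ring 2)"
  proof (rule perfect_if_iso_matrix_ring_2[OF assms(1,2) that])
    interpret Z2: residues_prime 2 "residue_ring (int 2)"
      by unfold_locales (simp_all add: two_is_prime_nat)
    show "field (residue_ring 2)" using Z2.is_field by simp
    show "card (carrier (residue_ring 2)) = 2" by (simp add: residue_ring_def)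
  qed

  \<comment> \<open>Pentagons in all other cases\<close>
  have imperfect: "\<not> perfect_graph ?G"
    if not1: "\<not> (s \<ge> 1 \<and> card (carrier (K 1)) = 2)" and not2: "\<not> (s \<le> 2 \<and> r = 0)"
      and not3: "\<not> semisimplification R \<simeq> matrix_ring 2 (residue_ring 2)"
  proof -
    \<comment> \<open>The first field is a smallest one, so if it does not have two elements, every
      field has at least three.\<close>
    have triK: "has_triangle (K i)" if i: "i \<in> {1..s}" for i
    proof (rule field.has_triangle_if_card[OF field[OF i]])
      show "finite (carrier (K i))" using assms(3)[OF i] by simp
      have "card (carrier (K 1)) \<noteq> 2" "2 \<le> card (carrier (K 1))" "card (carrier (K 1)) \<le> card (carrier (K i))"
        using not1 assms(4)[of 1] assms(5)[of 1 i] i by auto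
      then show "2 < card (carrier (K i))" by linarith
    qed
    have triM: "has_triangle (?M i)" if i: "i \<in> {1..r}" for i
      using field.has_triangle_matrix_ring[OF field'[OF i] assms(6)[OF i]] .
    have patA: "difference_pattern ?A pentagon (\<Union>i<s. N i)"
      if "\<And>i. i < s \<Longrightarrow> difference_pattern (K (i + 1)) pentagon (N i)" for N
      using difference_pattern_RDirProd_list[of Ks pentagon N] ringK nthK that by simp
    have patB: "difference_pattern ?B pentagon (\<Union>i<r. N i)"
      if "\<And>i. i < r \<Longrightarrow> difference_pattern (?M (i + 1)) pentagon (N i)" for N
      using difference_pattern_RDirProd_list[of Ms pentagon N] ringM nthM that by simp
    have colourK: "difference_pattern (K (i + 1)) pentagon N"
      if "i < s" "N \<subseteq> {(0, 2), (4, 1)} \<or> N \<subseteq> {(2, 4), (1, 3)} \<or> N \<subseteq> {(3, 0)}" for i N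
      using pentagon_colourings[OF ringK triK that(2)] that(1) by simp
    have colourM: "difference_pattern (?M (i + 1)) pentagon N"
      if "i < r" "N \<subseteq> {(0, 2), (4, 1)} \<or> N \<subseteq> {(2, 4), (1, 3)} \<or> N \<subseteq> {(3, 0)}" for i N
      using pentagon_colourings[OF ringM triM that(2)] that(1) by simp
    have combine: "difference_pattern ?P pentagon diagonals"
      if "difference_pattern ?A pentagon N" "difference_pattern ?B pentagon N'" "diagonals \<subseteq> N \<union> N'" for N N'
      using difference_pattern_mono[OF difference_pattern_RDirProd[OF ringA ringB that(1,2)] that(3)] .
    \<comment> \<open>Even when the matrix factors settle all diagonals, the field factors must
      still turn the five edges into units.\<close>
    have A0: "difference_pattern ?A pentagon {}"
      using patA[of "\<lambda>_. {}"] colourK by simp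
    have "difference_pattern ?P pentagon diagonals"
    \<comment> \<open>A single matrix factor other than M_2 over two elements already contains the
      whole pentagon.\<close>
    proof (cases "\<exists>i<r. \<not> (d (i + 1) = 2 \<and> card (carrier (F (i + 1))) = 2)")
      case True
      then obtain k where k: "k < r" "\<not> (d (k + 1) = 2 \<and> card (carrier (F (k + 1))) = 2)" by blast
      define j where "j = k + 1"
      have Fj: "field (F j)" "finite (carrier (F j))" "2 \<le> d j" "\<not> (d j = 2 \<and> card (carrier (F j)) = 2)"
        using assms(6,7)[of j] k by (simp_all add: j_def)
      interpret Fj: field "F j" by (rule Fj(1))
      have full: "difference_pattern (?M j) pentagon diagonals"
      proof (cases "d j = 2")
        case True
        have "card {\<zero>\<^bsub>F j\<^esub>, \<one>\<^bsub>F j\<^esub>} \<le> card (carrier (F j))"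
          using Fj(2) by (intro card_mono) auto
        moreover have "card {\<zero>\<^bsub>F j\<^esub>, \<one>\<^bsub>F j\<^esub>} = 2" using Fj.one_not_zero by simp
        ultimately have "2 < card (carrier (F j))" using Fj(4) True by linarith
        then show ?thesis using Fj.pentagon_in_matrix_ring_2[OF Fj(2)] True by simp
      next
        case False
        then show ?thesis using Fj.pentagon_in_matrix_ring[of "d j"] Fj(3) by simp
      qed
      have "difference_pattern ?B pentagon (\<Union>i<r. if i = k then diagonals else {})"
      proof (rule patB)
        fix i assume "i < r"
        then show "difference_pattern (?M (i + 1)) pentagon (if i = k then diagonals else {})"
          using full colourM[of i "{}"] by (simp add: j_def)
      qed
      moreover have "diagonals \<subseteq> {} \<union> (\<Union>i<r. if i = k then diagonals else {})"
        using k(1) by auto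
      ultimately show ?thesis by (rule combine[OF A0])
    next
      case False
      then have small: "d (i + 1) = 2" "card (carrier (F (i + 1))) = 2" if "i < r" for i
        using that by auto
      have house: "difference_pattern (?M (i + 1)) pentagon (diagonals - {(3, 0)})" if "i < r" for i
        using field.house_in_matrix_ring_2[OF field', of "i + 1"] small[OF that] that by simp
      \<comment> \<open>Now every matrix factor is M_2 over two elements and leaves only (3, 0)
        over. In the first three cases there are enough factors to settle all diagonals; the last
        one is the ring excluded by \<open>not3\<close>.\<close>
      consider "r = 0" "3 \<le> s" | "1 \<le> r" "1 \<le> s" | "2 \<le> r" | "r = 1" "s = 0"
        using not2 by linarith
      then show ?thesis
      proof cases
        case 1
        define N :: "nat \<Rightarrow> (nat \<times> nat) set" where
          "N i = (if i = 0 then {(0, 2), (4, 1)} else if i = 1 then {(2, 4), (1, 3)} else {(3, 0)})" for i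
        have "difference_pattern ?A pentagon (\<Union>i<s. N i)"
          using colourK by (intro patA) (auto simp: N_def)
        moreover have "difference_pattern ?B pentagon {}"
          using patB[of "\<lambda>_. {}"] 1 by simp
        moreover have "0 \<in> {..<s}" "1 \<in> {..<s}" "2 \<in> {..<s}" using 1 by simp_all
        then have "N 0 \<union> N 1 \<union> N 2 \<subseteq> (\<Union>i<s. N i)" by blast
        then have "diagonals \<subseteq> (\<Union>i<s. N i) \<union> {}" by (auto simp: N_def diagonals_def)
        ultimately show ?thesis by (rule combine)
      next
        case 2
        have "difference_pattern ?A pentagon (\<Union>i<s. {(3, 0)})"
          using colourK by (intro patA) auto
        moreover have "difference_pattern ?B pentagon (\<Union>i<r. diagonals - {(3, 0)})"
          using house by (intro patB)
        moreover have "diagonals \<subseteq> (\<Union>i<s. {(3, 0)}) \<union> (\<Union>i<r. diagonals - {(3, 0)})"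
        proof -
          have "{..<s} \<noteq> {}" "{..<r} \<noteq> {}" using 2 by (auto simp: lessThan_empty_iff)
          then show ?thesis by auto
        qed
        ultimately show ?thesis by (rule combine)
      next
        case 3
        let ?N = "\<lambda>i::nat. if i = 0 then diagonals - {(3, 0)} else {(3, 0)}"
        have "difference_pattern ?B pentagon (\<Union>i<r. ?N i)"
        proof (rule patB)
          fix i assume "i < r"
          then show "difference_pattern (?M (i + 1)) pentagon (?N i)"
            using house[of i] colourM[of i "{(3, 0)}"] by (cases "i = 0") simp_all
        qed
        moreover have "0 \<in> {..<r}" "1 \<in> {..<r}" using 3 by simp_all
        then have "?N 0 \<union> ?N 1 \<subseteq> (\<Union>i<r. ?N i)" by blast
        then have "diagonals \<subseteq> {} \<union> (\<Union>i<r. ?N i)" by auto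
        ultimately show ?thesis by (rule combine[OF A0])
      next
        case 4
        have F1: "field (F 1)" "card (carrier (F 1)) = 2" "d 1 = 2" using field'[of 1] small[of 0] 4 by simp_all
        interpret F1: field "F 1" by (rule F1(1))
        interpret Z2: residues_prime 2 "residue_ring (int 2)"
          by unfold_locales (simp_all add: two_is_prime_nat)
        obtain f where "f \<in> ring_iso (F 1) (residue_ring 2)" using F1.iso_residue_ring_2[OF F1(2)] by blast
        then have M2: "matrix_ring 2 (F 1) \<simeq> matrix_ring 2 (residue_ring 2)"
          using matrix_ring_iso[OF F1.ring_axioms, of "residue_ring 2" f 2] Z2.ring_axioms
          unfolding is_ring_iso_def by auto
        have "?P \<simeq> matrix_ring 2 (F 1)"
          using iso_singleton_RDirProd_list[OF F1.ring_matrix_ring, where 'b = 'b] 4 F1(3)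
          by (simp add: Ks_def Ms_def)
        then have "semisimplification R \<simeq> matrix_ring 2 (residue_ring 2)"
          by (rule ring_iso_trans[OF ring_iso_trans[OF iso] M2])
        with not3 show ?thesis by blast
      qed
    qed
    from not_perfect_if_pentagon[OF assms(1,2) ringP h this] show ?thesis .
  qed

  have perfect1: "perfect_graph ?G" if "s \<ge> 1" "card (carrier (K 1)) = 2"
    by (rule bipartite_imp_perfect[OF finV bip[OF that]]) (use G.graph_symmetric in auto)
  show ?thesis using bip perfect1 perfect2 perfect3 imperfect by blast
qed

end
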